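(* Let $\xi_1,\xi_2,\ldots$ be a reversible, time homogeneous, positive recurrent Markov chain on a measurable space $(\Omega,\mathcal{F})$ with transition kernel $p(\cdot,\cdot)$ and uniquely determined stationary probability distribution $\pi$, and let $P$ be the associated Markov operator. Let $k$, $K$, $k_2$ be the isoperimetric constants of the chain, and let $\kappa$ be the Lawler--Sokal constant (all defined in the context). Then the following three conditions are equivalent: 1. $P$ has an $L^2$-spectral gap. 2. $0<k\le K<2$. 3. $k_2>0$. For the spectral gap the following estimate holds: the spectrum $\sigma(P)$ of $P$ as an operator on $L^2_0(\pi)$ satisfies $$\sigma(P)\subset\left[-\sqrt{1-\frac{\kappa}{8}k_2^2},\ \min\left(\sqrt{1-\frac{\kappa}{8}k_2^2},\ 1-\frac{\kappa}{8}k^2\right)\right],$$ where $k_2$ can be estimated from below by $$k_2\ \ge\ \sup_{\delta,\epsilon_1,\epsilon_2,\epsilon\in\mathbb{R}_+}\min\left[\frac{k^2}{16}\delta,\ \ \frac{k}{4}\bigl(\epsilon_1\epsilon_2(1-\delta)-\delta\bigr),\ \ \left(k\left(\frac{(2-\epsilon)(1-\epsilon_1)(1-\epsilon_2)(1-\delta)}{(1-\epsilon)K}-\frac{1}{1-\epsilon}\right)-\frac{\epsilon}{1-\epsilon}\right)\epsilon\right].$$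
   Context: The state space $(\Omega,\mathcal{F})$ is arbitrary; it is assumed that some $A\in\mathcal{F}$ satisfies $0<\pi(A)<1$. $\mathbb{R}_+$ denotes the positive real numbers. Reversible means $\pi(dx)p(x,dy)=\pi(dy)p(y,dx)$ as measures on $\Omega\times\Omega$. The Markov operator is $Pf(x)=\int_\Omega f(y)\,p(x,dy)$ on $L^2(\pi)$; it is self-adjoint under reversibility, has norm $1$, and maps $L^2_0(\pi)=\{f\in L^2(\pi):\int_\Omega f\,d\pi=0\}$ into itself. $L^2$-spectral gap: $P$ has an $L^2$-spectral gap if there exists $r>0$ such that $\lim_{n\to\infty}\|P^nf\|_2^{1/n}\le 1-r$ for all $f\in L^2(\pi)$ with $\int_\Omega f\,d\pi=0$ and $\int_\Omega f^2\,d\pi=1$. Isoperimetric constants: let $p^n$ denote the $n$-step transition kernel. For $A\in\mathcal{F}$ with $0<\pi(A)<1$ and $n\in\mathbb{N}$, $n\ge1$, put $$k_n(A)=\frac{1}{\pi(A)\pi(A^c)}\int_A p^n(x,A^c)\,\pi(dx),\qquad k(A)=k_1(A).$$ Then $k_n=\inf k_n(A)$, $k=k_1=\inf k(A)$ and $K=\sup k(A)$, where the infima and the supremum are over all $A\in\mathcal{F}$ with $0<\pi(A)<1$. Lawler--Sokal constant (a constant known to be at least one): $$\kappa=\inf_{(X,Y)}\ \sup_{c\in\mathbb{R}}\ \frac{\bigl(E\,|(X+c)^2-(Y+c)^2|\bigr)^2}{1+c^2},$$ where the infimum is over all pairs $(X,Y)$ of i.i.d. real random variables with mean $0$ and variance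 $1$.
   Formalization: The supremum is taken over δ, ε₁, ε₂, ε in (0,1) instead of all positive reals; with all positive reals the bound on k₂ fails for the two-point swap chain (k=K=2, k₂=0) at (1/16,1/2,1/2,3), and is undefined at ε=1. *)

theory Defs
  imports "HOL-Probability.Probability"
begin

section \<open>Kernels, stationarity and reversibility\<close>

text \<open>
  A Markov kernel on the measurable space \<open>M\<close> is an element of \<open>M \<rightarrow>\<^sub>M prob_algebra M\<close>.
  In the Giry monad, \<open>\<nu> \<bind> p\<close> is the measure \<open>A \<mapsto> \<integral> p(x,A) \<nu>(dx)\<close>.
\<close>

definition stationary_distributions :: "'a measure \<Rightarrow> ('a \<Rightarrow> 'a measure) \<Rightarrow> 'a measure set" where
  "stationary_distributions M p = {\<nu> \<in> space (prob_algebra M). \<nu> \<bind> p = \<nu>}"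

text \<open>The measures \<open>\<pi>(dx) p(x,dy)\<close> and \<open>\<pi>(dy) p(y,dx)\<close> on the product space agree.\<close>

definition reversible :: "'a measure \<Rightarrow> ('a \<Rightarrow> 'a measure) \<Rightarrow> bool" where
  "reversible \<pi> p \<longleftrightarrow>
     \<pi> \<bind> (\<lambda>x. distr (p x) (\<pi> \<Otimes>\<^sub>M \<pi>) (\<lambda>y. (x, y))) =
     \<pi> \<bind> (\<lambda>y. distr (p y) (\<pi> \<Otimes>\<^sub>M \<pi>) (\<lambda>x. (x, y)))"

primrec kernel_power :: "'a measure \<Rightarrow> ('a \<Rightarrow> 'a measure) \<Rightarrow> nat \<Rightarrow> 'a \<Rightarrow> 'a measure" where
  "kernel_power M p 0 x = return M x"
| "kernel_power M p (Suc n) x = kernel_power M p n x \<bind> p"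


section \<open>Isoperimetric constants\<close>

definition nontrivial_events :: "'a measure \<Rightarrow> 'a set set" where
  "nontrivial_events \<pi> = {A \<in> sets \<pi>. 0 < measure \<pi> A \<and> measure \<pi> A < 1}"

definition iso_ratio :: "'a measure \<Rightarrow> ('a \<Rightarrow> 'a measure) \<Rightarrow> nat \<Rightarrow> 'a set \<Rightarrow> real" where
  "iso_ratio \<pi> p n A =
     1 / (measure \<pi> A * measure \<pi> (space \<pi> - A)) *
     (LINT x:A|\<pi>. measure (kernel_power \<pi> p n x) (space \<pi> - A))"

text \<open>
  For stationary \<open>\<pi>\<close> all ratios lie in \<open>[0, 2]\<close>, so the real infimum and supremum are
  the usual ones as soon as there is a nontrivial event.
\<close>

definition iso_inf :: "'a measure \<Rightarrow> ('a \<Rightarrow> 'a measure) \<Rightarrow> nat \<Rightarrow> real" where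
  "iso_inf \<pi> p n = (INF A \<in> nontrivial_events \<pi>. iso_ratio \<pi> p n A)"

definition iso_sup :: "'a measure \<Rightarrow> ('a \<Rightarrow> 'a measure) \<Rightarrow> real" where
  "iso_sup \<pi> p = (SUP A \<in> nontrivial_events \<pi>. iso_ratio \<pi> p 1 A)"


section \<open>The Lawler--Sokal constant\<close>

definition iid_standardized :: "'s measure \<Rightarrow> ('s \<Rightarrow> real) \<Rightarrow> ('s \<Rightarrow> real) \<Rightarrow> bool" where
  "iid_standardized N X Y \<longleftrightarrow>
     prob_space N \<and>
     prob_space.indep_var N borel X borel Y \<and>
     distr N borel X = distr N borel Y \<and>
     integrable N (\<lambda>\<omega>. (X \<omega>)\<^sup>2) \<and>
     prob_space.expectation N X = 0 \<and>
     prob_space.variance N X = 1"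

text \<open>
  The sample space ranges over all probability spaces on the type \<open>real \<times> real\<close>. Since every
  joint law of two real random variables is realised by the coordinate projections of such
  a space, and the functional depends only on the joint law, this is the infimum over all pairs.
\<close>

definition lawler_sokal_const :: real where
  "lawler_sokal_const =
     (INF (N, X, Y) \<in> {(N :: (real \<times> real) measure, X, Y). iid_standardized N X Y}.
        SUP c. (prob_space.expectation N (\<lambda>\<omega>. \<bar>(X \<omega> + c)\<^sup>2 - (Y \<omega> + c)\<^sup>2\<bar>))\<^sup>2 / (1 + c\<^sup>2))"


section \<open>The Markov operator on square-integrable functions\<close>

text \<open>
  Elements of the Lebesgue space are represented by functions; the identification of functions
  that agree almost everywhere is made explicit where it matters. If \<open>f\<close> is square-integrable
  and \<open>\<pi>\<close> is stationary, then \<open>f\<close> is \<open>p x\<close>-integrable for \<open>\<pi>\<close>-almost every \<open>x\<close>, and the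
  operator respects equality almost everywhere.
\<close>

definition L2_fun :: "'a measure \<Rightarrow> ('a \<Rightarrow> 'b::{banach, second_countable_topology}) set" where
  "L2_fun \<pi> = {f \<in> borel_measurable \<pi>. integrable \<pi> (\<lambda>x. (norm (f x))\<^sup>2)}"

definition L2_norm :: "'a measure \<Rightarrow> ('a \<Rightarrow> 'b::{banach, second_countable_topology}) \<Rightarrow> real" where
  "L2_norm \<pi> f = sqrt (\<integral>x. (norm (f x))\<^sup>2 \<partial>\<pi>)"

definition L20_fun :: "'a measure \<Rightarrow> ('a \<Rightarrow> 'b::{banach, second_countable_topology}) set" where
  "L20_fun \<pi> = {f \<in> L2_fun \<pi>. (\<integral>x. f x \<partial>\<pi>) = 0}"

definition markov_op ::
    "('a \<Rightarrow> 'a measure) \<Rightarrow> ('a \<Rightarrow> 'b::{banach, second_countable_topology}) \<Rightarrow> 'a \<Rightarrow> 'b" where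
  "markov_op p f = (\<lambda>x. \<integral>y. f y \<partial>(p x))"

definition has_L2_gap :: "'a measure \<Rightarrow> ('a \<Rightarrow> 'a measure) \<Rightarrow> bool" where
  "has_L2_gap \<pi> p \<longleftrightarrow>
     (\<exists>r>0. \<forall>f :: 'a \<Rightarrow> real. f \<in> L2_fun \<pi> \<and> (\<integral>x. f x \<partial>\<pi>) = 0 \<and> (\<integral>x. (f x)\<^sup>2 \<partial>\<pi>) = 1 \<longrightarrow>
        (\<exists>l \<le> 1 - r. (\<lambda>n. root n (L2_norm \<pi> ((markov_op p ^^ n) f))) \<longlonglongrightarrow> l))"

text \<open>
  \<open>z\<close> is in the resolvent set if \<open>z I - T\<close> is injective and surjective on the complex
  space of mean-zero square-integrable functions (modulo null sets), with bounded inverse.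
\<close>

definition L20_resolvent_set :: "'a measure \<Rightarrow> (('a \<Rightarrow> complex) \<Rightarrow> 'a \<Rightarrow> complex) \<Rightarrow> complex set" where
  "L20_resolvent_set \<pi> T = {z.
     (\<forall>f \<in> L20_fun \<pi>. (AE x in \<pi>. z * f x - T f x = 0) \<longrightarrow> (AE x in \<pi>. f x = 0)) \<and>
     (\<forall>g \<in> L20_fun \<pi>. \<exists>f \<in> L20_fun \<pi>. AE x in \<pi>. z * f x - T f x = g x) \<and>
     (\<exists>C. \<forall>f \<in> L20_fun \<pi>. L2_norm \<pi> f \<le> C * L2_norm \<pi> (\<lambda>x. z * f x - T f x))}"

definition L20_spectrum :: "'a measure \<Rightarrow> (('a \<Rightarrow> complex) \<Rightarrow> 'a \<Rightarrow> complex) \<Rightarrow> complex set" where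
  "L20_spectrum \<pi> T = - L20_resolvent_set \<pi> T"


section \<open>The parameter range of the lower bound\<close>

text \<open>
  The parameters \<open>(\<delta>, \<epsilon>\<^sub>1, \<epsilon>\<^sub>2, \<epsilon>)\<close> are positive proportions, so they are taken in the open unit
  interval. Larger values must be excluded: for \<open>\<epsilon> > 1\<close> the factor \<open>1 - \<epsilon>\<close> changes sign, and for
  \<open>\<epsilon>\<^sub>1, \<epsilon>\<^sub>2 > 1\<close> the product \<open>(1 - \<epsilon>\<^sub>1) (1 - \<epsilon>\<^sub>2)\<close> is positive again. In either case the minimum
  can be positive for the deterministic swap of two points, where \<open>k = K = 2\<close> and \<open>k\<^sub>2 = 0\<close>,
  e.g. at \<open>(1/16, 1/2, 1/2, 3)\<close>. All remaining positive parameters contribute only values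
  \<open>\<le> 0\<close>, which do not change the supremum.
\<close>

definition proportion_params :: "(real \<times> real \<times> real \<times> real) set" where
  "proportion_params = {0<..<1} \<times> {0<..<1} \<times> {0<..<1} \<times> {0<..<1}"

end

theory Submission
  imports Defs
begin

text \<open>
  No spectral theorem is used. Lawler and Sokal's argument (co-area formula for \<open>(f + c)\<^sup>2\<close>,
  Cauchy--Schwarz on the edge measure, and the i.i.d. pair \<open>(f(x), f(y))\<close> under \<open>\<pi> \<otimes> \<pi>\<close>)
  gives \<open>\<langle>f, Q f\<rangle> \<le> (1 - \<kappa> k\<^sub>Q\<^sup>2 / 8) \<parallel>f\<parallel>\<^sup>2\<close> on mean-zero functions for every kernel
  \<open>Q\<close> preserving \<open>\<pi>\<close>. Applied to \<open>P\<close> and \<open>P\<^sup>2\<close>, it bounds the numerical range of \<open>P\<close>,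
  and a Neumann series around a distant complex centre turns this into the spectral inclusion.
  Conversely, testing with \<open>f = 1\<^sub>A - \<pi>(A)\<close> gives \<open>\<langle>f, P f\<rangle> = (1 - k(A)) \<parallel>f\<parallel>\<^sup>2\<close> and
  \<open>\<parallel>P f\<parallel>\<^sup>2 = (1 - k\<^sub>2(A)) \<parallel>f\<parallel>\<^sup>2\<close>. Finally, testing the one-step inequality with
  \<open>h = f + P f\<close> gives \<open>k\<^sub>2 \<ge> k\<^sup>2 (2 - K) / 18\<close>, which dominates the parameter bound because
  its third term is positive only if \<open>2 \<delta> < 2 - K\<close>.
\<close>

section \<open>Kernels and square-integrable functions\<close>

text \<open>The obstacle is to locate a complex spectrum with real quadratic-form estimates only.
  With N = ||f||^2 and Q = <f, P f>, contractivity gives ||(P - c) f||^2 <= (1 + |c|^2) N - 2 Re c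
  Q. Compared with (|z - c|^2 - 1) N, the term |c|^2 cancels and an inequality affine in c remains,
  which holds once c is far enough on the side opposite to z. The 1 subtracted from |z - c|^2 makes
  (P - c) / (z - c) a strict contraction. The limit in \<open>has_L2_gap\<close> is tamed by
  self-adjointness: the n-th roots of ||P^n f|| are nondecreasing, so their limit already bounds ||P
  f||, and a gap means norm below 1 on mean-zero functions. Testing with f + P f produces <P f, P^2
  f>, which is not expressed by flows of one or two steps; the inequality <u, P u> >= -||u||^2 at u
  = f - P f removes it. A real \<open>INF\<close> or \<open>SUP\<close> is meaningful only for a
  nonempty bounded set, whence the auxiliary bounds 1/2 and 16 on the Lawler-Sokal functional and 0
  and 2 on the flow ratios. The bound 1/2 also fixes the constant 18.\<close>

lemma
  fixes f :: "'b \<Rightarrow> real"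
  assumes N: "N \<in> M \<rightarrow>\<^sub>M prob_algebra B" and f: "integrable (M \<bind> N) f" and fB: "f \<in> borel_measurable B"
  shows AE_integrable_bind: "AE x in M. integrable (N x) f"
    and integrable_integral_bind: "integrable M (\<lambda>x. \<integral>y. f y \<partial>N x)"
    and integral_bind_real: "(\<integral>y. f y \<partial>(M \<bind> N)) = (\<integral>x. \<integral>y. f y \<partial>N x \<partial>M)"
proof -
  have Ns: "N \<in> M \<rightarrow>\<^sub>M subprob_algebra B" using N by (rule measurable_prob_algebraD)
  note [measurable] = Ns fB
  \<comment> \<open>Nonnegative functions come first: there the iterated integral is computed by
    Tonelli in \<open>ennreal\<close>, and its finiteness gives integrability under
    \<open>N x\<close> for almost every x. A general f is then split into positive and negative
    parts.\<close>
  have pos: "(AE x in M. integrable (N x) g) \<and> integrable M (\<lambda>x. \<integral>y. g y \<partial>N x)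
     \<and> (\<integral>y. g y \<partial>(M \<bind> N)) = (\<integral>x. \<integral>y. g y \<partial>N x \<partial>M)"
    if g[measurable]: "g \<in> borel_measurable B" and g0: "\<And>x. 0 \<le> g x" and gi: "integrable (M \<bind> N) g" for g :: "'b \<Rightarrow> real"
  proof -
    have gm: "g \<in> borel_measurable (N x)" if "x \<in> space M" for x
      using g sets_kernel[OF Ns that] measurable_cong_sets by blast
    have fin: "(\<integral>\<^sup>+x. (\<integral>\<^sup>+y. ennreal (g y) \<partial>N x) \<partial>M) < \<infinity>"
      using gi by (simp add: nn_integral_bind[OF _ Ns, symmetric] real_integrable_def less_top)
    have "AE x in M. (\<integral>\<^sup>+y. ennreal (g y) \<partial>N x) \<noteq> \<infinity>"
      using fin by (intro nn_integral_noteq_infinite) auto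
    then have int: "AE x in M. integrable (N x) g"
    proof (rule AE_mp, intro AE_I2 impI)
      fix x assume "x \<in> space M" "(\<integral>\<^sup>+y. ennreal (g y) \<partial>N x) \<noteq> \<infinity>"
      then show "integrable (N x) g"
        using gm g0 by (intro integrableI_nonneg) (auto simp: less_top)
    qed
    then have eq: "AE x in M. ennreal (\<integral>y. g y \<partial>N x) = (\<integral>\<^sup>+y. ennreal (g y) \<partial>N x)"
      by (rule AE_mp) (auto intro!: AE_I2 nn_integral_eq_integral[symmetric] simp: g0)
    have nn: "(\<integral>\<^sup>+x. ennreal (\<integral>y. g y \<partial>N x) \<partial>M) = (\<integral>\<^sup>+y. ennreal (g y) \<partial>(M \<bind> N))"
      using nn_integral_cong_AE[OF eq] by (simp add: nn_integral_bind[OF _ Ns])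
    have m: "(\<lambda>x. \<integral>y. g y \<partial>N x) \<in> borel_measurable M" by measurable
    have i2: "integrable M (\<lambda>x. \<integral>y. g y \<partial>N x)"
      using nn gi fin by (intro integrableI_nonneg m) (auto simp: g0 nn_integral_bind[OF _ Ns])
    have "ennreal (\<integral>x. \<integral>y. g y \<partial>N x \<partial>M) = ennreal (\<integral>y. g y \<partial>(M \<bind> N))"
      using nn nn_integral_eq_integral[OF i2] nn_integral_eq_integral[OF gi] by (simp add: g0)
    then have "(\<integral>x. \<integral>y. g y \<partial>N x \<partial>M) = (\<integral>y. g y \<partial>(M \<bind> N))"
      by (subst (asm) ennreal_inj) (auto intro!: integral_nonneg_AE simp: g0)
    with int i2 show ?thesis by simp
  qed
  let ?p = "\<lambda>x. max 0 (f x)" and ?n = "\<lambda>x. max 0 (- f x)"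
  have p: "(AE x in M. integrable (N x) ?p) \<and> integrable M (\<lambda>x. \<integral>y. ?p y \<partial>N x)
     \<and> (\<integral>y. ?p y \<partial>(M \<bind> N)) = (\<integral>x. \<integral>y. ?p y \<partial>N x \<partial>M)"
    using f by (intro pos) auto
  have n: "(AE x in M. integrable (N x) ?n) \<and> integrable M (\<lambda>x. \<integral>y. ?n y \<partial>N x)
     \<and> (\<integral>y. ?n y \<partial>(M \<bind> N)) = (\<integral>x. \<integral>y. ?n y \<partial>N x \<partial>M)"
    using f by (intro pos) auto
  have fpn: "f = (\<lambda>x. ?p x - ?n x)" by (auto simp: max_def)
  from p n have "AE x in M. integrable (N x) ?p \<and> integrable (N x) ?n" by auto
  then have A: "AE x in M. integrable (N x) f \<and> (\<integral>y. f y \<partial>N x) = (\<integral>y. ?p y \<partial>N x) - (\<integral>y. ?n y \<partial>N x)"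
  proof (rule AE_mp, intro AE_I2 impI)
    fix x assume h: "integrable (N x) ?p \<and> integrable (N x) ?n"
    from h have "integrable (N x) (\<lambda>x. ?p x - ?n x)" by (intro Bochner_Integration.integrable_diff) auto
    moreover have "(\<integral>y. ?p y - ?n y \<partial>N x) = (\<integral>y. ?p y \<partial>N x) - (\<integral>y. ?n y \<partial>N x)"
      using h by (intro Bochner_Integration.integral_diff) auto
    ultimately show "integrable (N x) f \<and> (\<integral>y. f y \<partial>N x) = (\<integral>y. ?p y \<partial>N x) - (\<integral>y. ?n y \<partial>N x)"
      using fpn by auto
  qed
  then show "AE x in M. integrable (N x) f" by auto
  have A': "AE x in M. (\<integral>y. f y \<partial>N x) = (\<integral>y. ?p y \<partial>N x) - (\<integral>y. ?n y \<partial>N x)" using A by auto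
  have d: "integrable M (\<lambda>x. (\<integral>y. ?p y \<partial>N x) - (\<integral>y. ?n y \<partial>N x))"
    using p n by (intro Bochner_Integration.integrable_diff) auto
  have m1: "(\<lambda>x. \<integral>y. f y \<partial>N x) \<in> borel_measurable M" by measurable
  have m2: "(\<lambda>x. (\<integral>y. ?p y \<partial>N x) - (\<integral>y. ?n y \<partial>N x)) \<in> borel_measurable M" by measurable
  show "integrable M (\<lambda>x. \<integral>y. f y \<partial>N x)"
    using integrable_cong_AE[OF m1 m2 A'] d by simp
  have "(\<integral>x. \<integral>y. f y \<partial>N x \<partial>M) = (\<integral>x. (\<integral>y. ?p y \<partial>N x) - (\<integral>y. ?n y \<partial>N x) \<partial>M)"
    by (rule integral_cong_AE[OF m1 m2 A'])
  also have "\<dots> = (\<integral>y. ?p y \<partial>(M \<bind> N)) - (\<integral>y. ?n y \<partial>(M \<bind> N))" using p n by simp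
  also have "\<dots> = (\<integral>y. ?p y - ?n y \<partial>(M \<bind> N))"
    using f by (intro Bochner_Integration.integral_diff[symmetric]) auto
  finally show "(\<integral>y. f y \<partial>(M \<bind> N)) = (\<integral>x. \<integral>y. f y \<partial>N x \<partial>M)" using fpn by simp
qed

section \<open>Real square-integrable functions\<close>

lemma L2_funD: assumes "f \<in> L2_fun \<mu>" shows "f \<in> borel_measurable \<mu>" "integrable \<mu> (\<lambda>x. (norm (f x))\<^sup>2)"
  using assms by (auto simp: L2_fun_def)

lemma L2_real_iff: "f \<in> L2_fun \<mu> \<longleftrightarrow> f \<in> borel_measurable \<mu> \<and> integrable \<mu> (\<lambda>x. (f x)\<^sup>2)" for f :: "'a \<Rightarrow> real"
  by (auto simp: L2_fun_def)

lemma L2_mult_integrable: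
  fixes f g :: "'a \<Rightarrow> real"
  assumes "f \<in> L2_fun \<mu>" "g \<in> L2_fun \<mu>"
  shows "integrable \<mu> (\<lambda>x. f x * g x)"
proof -
  have [measurable]: "f \<in> borel_measurable \<mu>" "g \<in> borel_measurable \<mu>"
    and i: "integrable \<mu> (\<lambda>x. (f x)\<^sup>2)" "integrable \<mu> (\<lambda>x. (g x)\<^sup>2)"
    using assms by (auto simp: L2_real_iff)
  have "integrable \<mu> (\<lambda>x. (f x)\<^sup>2 + (g x)\<^sup>2)" using i by auto
  then show ?thesis
  proof (rule Bochner_Integration.integrable_bound)
    show "AE x in \<mu>. norm (f x * g x) \<le> norm ((f x)\<^sup>2 + (g x)\<^sup>2)"
    proof (rule AE_I2)
      fix x
      have "2 * (\<bar>f x\<bar> * \<bar>g x\<bar>) \<le> (f x)\<^sup>2 + (g x)\<^sup>2"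
        using sum_squares_bound[of "\<bar>f x\<bar>" "\<bar>g x\<bar>"] by simp
      moreover have "0 \<le> \<bar>f x\<bar> * \<bar>g x\<bar>" by simp
      ultimately show "norm (f x * g x) \<le> norm ((f x)\<^sup>2 + (g x)\<^sup>2)"
        unfolding real_norm_def abs_mult by linarith
    qed
  qed auto
qed

lemma L2_add:
  fixes f g :: "'a \<Rightarrow> real"
  assumes "f \<in> L2_fun \<mu>" "g \<in> L2_fun \<mu>"
  shows "(\<lambda>x. f x + g x) \<in> L2_fun \<mu>"
proof -
  have "(\<lambda>x. (f x + g x)\<^sup>2) = (\<lambda>x. (f x)\<^sup>2 + (g x)\<^sup>2 + 2 * (f x * g x))"
    by (auto simp: power2_sum)
  then show ?thesis using assms L2_mult_integrable[OF assms] by (auto simp: L2_real_iff)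
qed

lemma L2_scale: "f \<in> L2_fun \<mu> \<Longrightarrow> (\<lambda>x. c * f x) \<in> L2_fun \<mu>" for f :: "'a \<Rightarrow> real"
  by (auto simp: L2_real_iff power_mult_distrib)

lemma L2_diff:
  fixes f g :: "'a \<Rightarrow> real"
  assumes "f \<in> L2_fun \<mu>" "g \<in> L2_fun \<mu>"
  shows "(\<lambda>x. f x - g x) \<in> L2_fun \<mu>"
  using L2_add[OF assms(1) L2_scale[OF assms(2), of "-1"]] by simp

lemma (in finite_measure) L2_const: "(\<lambda>x. c) \<in> L2_fun M" for c :: real
  by (auto simp: L2_real_iff)

lemma (in finite_measure) L2_integrable: "f \<in> L2_fun M \<Longrightarrow> integrable M f" for f :: "'a \<Rightarrow> real"
  using L2_mult_integrable[OF _ L2_const[of 1]] by auto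

lemma L2_abs: "f \<in> L2_fun \<mu> \<Longrightarrow> (\<lambda>x. \<bar>f x\<bar>) \<in> L2_fun \<mu>" for f :: "'a \<Rightarrow> real"
  by (auto simp: L2_real_iff)

lemma L2_Cauchy_Schwarz:
  fixes f g :: "'a \<Rightarrow> real"
  assumes "f \<in> L2_fun \<mu>" "g \<in> L2_fun \<mu>"
  shows "(\<integral>x. f x * g x \<partial>\<mu>)\<^sup>2 \<le> (\<integral>x. (f x)\<^sup>2 \<partial>\<mu>) * (\<integral>x. (g x)\<^sup>2 \<partial>\<mu>)"
proof -
  define a b c where "a = (\<integral>x. (f x)\<^sup>2 \<partial>\<mu>)" and "b = (\<integral>x. f x * g x \<partial>\<mu>)" and "c = (\<integral>x. (g x)\<^sup>2 \<partial>\<mu>)"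
  have i: "integrable \<mu> (\<lambda>x. (f x)\<^sup>2)" "integrable \<mu> (\<lambda>x. (g x)\<^sup>2)" "integrable \<mu> (\<lambda>x. f x * g x)"
    using assms L2_mult_integrable[OF assms] by (auto simp: L2_real_iff)
  have q: "0 \<le> s\<^sup>2 * a - 2 * s * t * b + t\<^sup>2 * c" for s t
  proof -
    have "(\<integral>x. (s * f x - t * g x)\<^sup>2 \<partial>\<mu>) = (\<integral>x. s\<^sup>2 * (f x)\<^sup>2 - 2 * s * t * (f x * g x) + t\<^sup>2 * (g x)\<^sup>2 \<partial>\<mu>)"
      by (intro Bochner_Integration.integral_cong) (auto simp: power2_eq_square algebra_simps)
    also have "\<dots> = s\<^sup>2 * a - 2 * s * t * b + t\<^sup>2 * c"
      using i by (simp add: a_def b_def c_def)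
    finally have "s\<^sup>2 * a - 2 * s * t * b + t\<^sup>2 * c = (\<integral>x. (s * f x - t * g x)\<^sup>2 \<partial>\<mu>)" ..
    moreover have "0 \<le> (\<integral>x. (s * f x - t * g x)\<^sup>2 \<partial>\<mu>)" by simp
    ultimately show ?thesis by simp
  qed
  have a0: "0 \<le> a" "0 \<le> c" by (auto simp: a_def c_def)
  show ?thesis
  proof (cases "c = 0")
    case True
    have "b = 0"
    proof (rule ccontr)
      assume b: "b \<noteq> 0"
      \<comment> \<open>For c = 0 the form is affine in t at s = 1; this t makes it equal to
        -1.\<close>
      have "0 \<le> a - 2 * ((a + 1) / (2 * b)) * b" using q[of 1 "(a+1)/(2*b)"] True by simp
      also have "\<dots> = -1" using b by (simp add: field_simps)
      finally show False by simp
    qed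
    with True show ?thesis by (simp add: b_def[symmetric] c_def[symmetric])
  next
    case False
    \<comment> \<open>The choice s = c, t = b is the minimising direction, scaled to avoid a
      division.\<close>
    have "0 \<le> c\<^sup>2 * a - 2 * c * b * b + b\<^sup>2 * c" by (rule q)
    also have "\<dots> = c * (a * c - b\<^sup>2)" by (simp add: power2_eq_square algebra_simps)
    finally have "0 \<le> a * c - b\<^sup>2" using False a0 by (simp add: zero_le_mult_iff)
    then show ?thesis by (simp add: a_def b_def c_def)
  qed
qed

section \<open>Kernels with an invariant law: edge measure and Markov operator\<close>

locale stationary_kernel = prob_space \<pi> for \<pi> :: "'a measure" +
  fixes q :: "'a \<Rightarrow> 'a measure"
  assumes kernel: "q \<in> \<pi> \<rightarrow>\<^sub>M prob_algebra \<pi>"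
    and stationary: "\<pi> \<bind> q = \<pi>"
begin

text \<open>The joint law of two consecutive states of the stationary chain. It is literally the
  left-hand side of \<open>reversible\<close>, so reversibility becomes invariance of
  \<open>edge\<close> under swapping the coordinates.\<close>

definition edge :: "('a \<times> 'a) measure" where
  "edge = \<pi> \<bind> (\<lambda>x. distr (q x) (\<pi> \<Otimes>\<^sub>M \<pi>) (\<lambda>y. (x, y)))"

lemma kernel_subprob[measurable]: "q \<in> \<pi> \<rightarrow>\<^sub>M subprob_algebra \<pi>"
  using kernel by (rule measurable_prob_algebraD)

lemma prob_space_kernel: "x \<in> space \<pi> \<Longrightarrow> prob_space (q x)"
  using measurable_space[OF kernel] by (auto simp: space_prob_algebra)

lemma sets_q: "x \<in> space \<pi> \<Longrightarrow> sets (q x) = sets \<pi>"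
  using sets_kernel[OF kernel_subprob] .

lemma space_q: "x \<in> space \<pi> \<Longrightarrow> space (q x) = space \<pi>"
  using sets_q sets_eq_imp_space_eq by blast

lemma measurable_q: "x \<in> space \<pi> \<Longrightarrow> f \<in> \<pi> \<rightarrow>\<^sub>M B \<Longrightarrow> f \<in> q x \<rightarrow>\<^sub>M B"
  using sets_q measurable_cong_sets by blast

lemma edge_kernel: "(\<lambda>x. distr (q x) (\<pi> \<Otimes>\<^sub>M \<pi>) (\<lambda>y. (x, y))) \<in> \<pi> \<rightarrow>\<^sub>M prob_algebra (\<pi> \<Otimes>\<^sub>M \<pi>)"
  using kernel by (intro measurable_distr_prob_space2) auto

lemma edge_kernel_subprob: "(\<lambda>x. distr (q x) (\<pi> \<Otimes>\<^sub>M \<pi>) (\<lambda>y. (x, y))) \<in> \<pi> \<rightarrow>\<^sub>M subprob_algebra (\<pi> \<Otimes>\<^sub>M \<pi>)"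
  using edge_kernel by (rule measurable_prob_algebraD)

lemma sets_edge[measurable_cong, simp]: "sets edge = sets (\<pi> \<Otimes>\<^sub>M \<pi>)"
  unfolding edge_def using edge_kernel_subprob not_empty by (intro sets_bind) (auto dest: sets_kernel)

lemma space_edge: "space edge = space \<pi> \<times> space \<pi>"
  using sets_eq_imp_space_eq[OF sets_edge] by (simp add: space_pair_measure)

lemma prob_space_edge: "prob_space edge"
  unfolding edge_def using edge_kernel by (intro prob_space_bind'[where M = \<pi>]) (auto simp: space_prob_algebra prob_space_axioms)

lemma nn_integral_edge:
  assumes F[measurable]: "F \<in> borel_measurable (\<pi> \<Otimes>\<^sub>M \<pi>)"
  shows "(\<integral>\<^sup>+z. F z \<partial>edge) = (\<integral>\<^sup>+x. \<integral>\<^sup>+y. F (x, y) \<partial>q x \<partial>\<pi>)"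
  unfolding edge_def nn_integral_bind[OF F edge_kernel_subprob]
  by (intro nn_integral_cong nn_integral_distr) (auto intro!: measurable_q)

lemma distr_edge_fst: "distr edge \<pi> fst = \<pi>"
proof (rule measure_eqI)
  fix A assume "A \<in> sets (distr edge \<pi> fst)"
  then have A[measurable]: "A \<in> sets \<pi>" by simp
  have "emeasure (distr edge \<pi> fst) A = (\<integral>\<^sup>+z. indicator A z \<partial>distr edge \<pi> fst)" by simp
  also have "\<dots> = (\<integral>\<^sup>+z. indicator A (fst z) \<partial>edge)" by (rule nn_integral_distr) auto
  also have "\<dots> = (\<integral>\<^sup>+x. \<integral>\<^sup>+y. indicator A x \<partial>q x \<partial>\<pi>)" by (subst nn_integral_edge) auto
  also have "\<dots> = (\<integral>\<^sup>+x. indicator A x \<partial>\<pi>)"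
    by (intro nn_integral_cong) (simp add: prob_space.emeasure_space_1 prob_space_kernel)
  finally show "emeasure (distr edge \<pi> fst) A = emeasure \<pi> A" by simp
qed simp

lemma nn_integral_stationary:
  assumes F[measurable]: "F \<in> borel_measurable \<pi>"
  shows "(\<integral>\<^sup>+x. \<integral>\<^sup>+y. F y \<partial>q x \<partial>\<pi>) = (\<integral>\<^sup>+x. F x \<partial>\<pi>)"
  using nn_integral_bind[OF F kernel_subprob] stationary by simp

lemma distr_edge_snd: "distr edge \<pi> snd = \<pi>"
proof (rule measure_eqI)
  fix A assume "A \<in> sets (distr edge \<pi> snd)"
  then have A[measurable]: "A \<in> sets \<pi>" by simp
  have "emeasure (distr edge \<pi> snd) A = (\<integral>\<^sup>+z. indicator A z \<partial>distr edge \<pi> snd)" by simp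
  also have "\<dots> = (\<integral>\<^sup>+z. indicator A (snd z) \<partial>edge)" by (rule nn_integral_distr) auto
  also have "\<dots> = (\<integral>\<^sup>+x. indicator A x \<partial>\<pi>)" by (simp add: nn_integral_edge nn_integral_stationary)
  finally show "emeasure (distr edge \<pi> snd) A = emeasure \<pi> A" by simp
qed simp

lemma
  fixes f :: "'a \<Rightarrow> real"
  assumes f: "f \<in> borel_measurable \<pi>"
  shows integrable_edge_fst: "integrable edge (\<lambda>z. f (fst z)) \<longleftrightarrow> integrable \<pi> f"
    and integrable_edge_snd: "integrable edge (\<lambda>z. f (snd z)) \<longleftrightarrow> integrable \<pi> f"
    and integral_edge_fst: "(\<integral>z. f (fst z) \<partial>edge) = (\<integral>x. f x \<partial>\<pi>)"
    and integral_edge_snd: "(\<integral>z. f (snd z) \<partial>edge) = (\<integral>x. f x \<partial>\<pi>)"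
  using integrable_distr_eq[of fst edge \<pi> f] integrable_distr_eq[of snd edge \<pi> f]
    integral_distr[of fst edge \<pi> f] integral_distr[of snd edge \<pi> f] f
  by (simp_all add: distr_edge_fst distr_edge_snd)

lemma L2_edge:
  fixes f :: "'a \<Rightarrow> real"
  assumes "f \<in> L2_fun \<pi>"
  shows "(\<lambda>z. f (fst z)) \<in> L2_fun edge" "(\<lambda>z. f (snd z)) \<in> L2_fun edge"
  using assms by (auto simp: L2_real_iff integrable_edge_fst[of "\<lambda>x. (f x)\<^sup>2"] integrable_edge_snd[of "\<lambda>x. (f x)\<^sup>2"])

text \<open>By stationarity a \<open>\<pi>\<close>-null set is null for
  \<open>\<pi> \<bind> q\<close>, hence for \<open>q x\<close> at almost every x. This carries
  almost-everywhere statements under the kernel.\<close>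

lemma AE_kernel:
  assumes "AE x in \<pi>. R x"
  shows "AE x in \<pi>. AE y in q x. R y"
proof -
  from assms obtain N where N: "{x \<in> space \<pi>. \<not> R x} \<subseteq> N" "emeasure \<pi> N = 0" and [measurable]: "N \<in> sets \<pi>"
    by (rule AE_E)
  have "AE x in \<pi> \<bind> q. x \<notin> N"
    unfolding stationary using N by (intro AE_not_in) (auto simp: null_sets_def)
  then have "AE x in \<pi>. AE y in q x. y \<notin> N" by (subst (asm) AE_bind[OF kernel_subprob]) auto
  with AE_space show ?thesis
  proof eventually_elim
    case (elim x)
    from elim(2) show ?case
      by (rule AE_mp) (use N(1) in \<open>auto intro!: AE_I2 simp: space_q[OF elim(1)]\<close>)
  qed
qed

lemma
  fixes f :: "'a \<Rightarrow> real"
  assumes f: "integrable \<pi> f"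
  shows AE_integrable_kernel: "AE x in \<pi>. integrable (q x) f"
    and integrable_markov_op: "integrable \<pi> (markov_op q f)"
    and integral_markov_op: "(\<integral>x. markov_op q f x \<partial>\<pi>) = (\<integral>x. f x \<partial>\<pi>)"
  using AE_integrable_bind[OF kernel, of f] integrable_integral_bind[OF kernel, of f]
    integral_bind_real[OF kernel, of f] f by (simp_all add: stationary markov_op_def)

lemma measurable_markov_op[measurable]:
  fixes f :: "'a \<Rightarrow> 'b::{banach, second_countable_topology}"
  assumes [measurable]: "f \<in> borel_measurable \<pi>"
  shows "markov_op q f \<in> borel_measurable \<pi>"
  unfolding markov_op_def by measurable

lemma markov_op_lincomb:
  fixes f g :: "'a \<Rightarrow> real"
  assumes f: "integrable \<pi> f" and g: "integrable \<pi> g"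
  shows "AE x in \<pi>. markov_op q (\<lambda>x. a * f x + b * g x) x = a * markov_op q f x + b * markov_op q g x"
  using AE_integrable_kernel[OF f] AE_integrable_kernel[OF g]
  by eventually_elim (simp add: markov_op_def)

text \<open>Jensen's inequality for the square, obtained as Cauchy-Schwarz against the constant 1
  under the probability \<open>q x\<close>.\<close>

lemma markov_op_square_le:
  fixes f :: "'a \<Rightarrow> real"
  assumes f: "f \<in> L2_fun \<pi>"
  shows "AE x in \<pi>. (markov_op q f x)\<^sup>2 \<le> markov_op q (\<lambda>y. (f y)\<^sup>2) x"
proof -
  have i: "integrable \<pi> (\<lambda>x. (f x)\<^sup>2)" and [measurable]: "f \<in> borel_measurable \<pi>" using f by (auto simp: L2_real_iff)
  from AE_integrable_kernel[OF i] show ?thesis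
  proof (rule AE_mp, intro AE_I2 impI)
    fix x assume x: "x \<in> space \<pi>" and ix: "integrable (q x) (\<lambda>y. (f y)\<^sup>2)"
    interpret qx: prob_space "q x" using x by (rule prob_space_kernel)
    have L: "f \<in> L2_fun (q x)" using ix x by (auto simp: L2_real_iff intro!: measurable_q)
    show "(markov_op q f x)\<^sup>2 \<le> markov_op q (\<lambda>y. (f y)\<^sup>2) x"
      using L2_Cauchy_Schwarz[OF L qx.L2_const[of 1]] by (simp add: markov_op_def qx.prob_space)
  qed
qed

text \<open>Integrate the pointwise Jensen bound; stationarity evaluates the integral of its
  right-hand side.\<close>

lemma
  fixes f :: "'a \<Rightarrow> real"
  assumes f: "f \<in> L2_fun \<pi>"
  shows L2_markov_op: "markov_op q f \<in> L2_fun \<pi>"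
    and markov_op_contraction: "(\<integral>x. (markov_op q f x)\<^sup>2 \<partial>\<pi>) \<le> (\<integral>x. (f x)\<^sup>2 \<partial>\<pi>)"
proof -
  have i: "integrable \<pi> (\<lambda>x. (f x)\<^sup>2)" and [measurable]: "f \<in> borel_measurable \<pi>" using f by (auto simp: L2_real_iff)
  note P2 = integrable_markov_op[OF i]
  have sq: "integrable \<pi> (\<lambda>x. (markov_op q f x)\<^sup>2)"
    using P2
  proof (rule Bochner_Integration.integrable_bound)
    show "AE x in \<pi>. norm ((markov_op q f x)\<^sup>2) \<le> norm (markov_op q (\<lambda>x. (f x)\<^sup>2) x)"
      using markov_op_square_le[OF f] by eventually_elim auto
  qed measurable
  then show "markov_op q f \<in> L2_fun \<pi>" by (auto simp: L2_real_iff)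
  show "(\<integral>x. (markov_op q f x)\<^sup>2 \<partial>\<pi>) \<le> (\<integral>x. (f x)\<^sup>2 \<partial>\<pi>)"
    using integral_mono_AE[OF sq P2 markov_op_square_le[OF f]] integral_markov_op[OF i] by simp
qed

lemma integral_edge_product:
  fixes f g :: "'a \<Rightarrow> real"
  assumes f: "f \<in> L2_fun \<pi>" and g: "g \<in> L2_fun \<pi>"
  shows "(\<integral>z. f (fst z) * g (snd z) \<partial>edge) = (\<integral>x. f x * markov_op q g x \<partial>\<pi>)"
proof -
  note [measurable] = L2_funD(1)[OF f] L2_funD(1)[OF g]
  have i: "integrable edge (\<lambda>z. f (fst z) * g (snd z))"
    by (rule L2_mult_integrable[OF L2_edge(1)[OF f] L2_edge(2)[OF g]])
  have "(\<integral>z. f (fst z) * g (snd z) \<partial>edge) =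
     (\<integral>x. (\<integral>z. f (fst z) * g (snd z) \<partial>distr (q x) (\<pi> \<Otimes>\<^sub>M \<pi>) (\<lambda>y. (x, y))) \<partial>\<pi>)"
    using integral_bind_real[OF edge_kernel i[unfolded edge_def]] by (simp add: edge_def)
  also have "\<dots> = (\<integral>x. f x * markov_op q g x \<partial>\<pi>)"
    by (intro Bochner_Integration.integral_cong refl) (auto simp: integral_distr measurable_q markov_op_def)
  finally show ?thesis .
qed

end

section \<open>The Lawler--Sokal constant\<close>

text \<open>Factor U^2 - V^2 = (U - V)(U + V), apply Cauchy-Schwarz, and bound (U + V)^2 by 2 U^2 +
  2 V^2. It serves both for i.i.d. pairs and for the two endpoints of an edge.\<close>

lemma square_difference_integral_le:
  fixes U V :: "'a \<Rightarrow> real"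
  assumes U: "U \<in> L2_fun \<mu>" and V: "V \<in> L2_fun \<mu>"
  shows "(\<integral>x. \<bar>(U x)\<^sup>2 - (V x)\<^sup>2\<bar> \<partial>\<mu>)\<^sup>2
     \<le> (\<integral>x. (U x - V x)\<^sup>2 \<partial>\<mu>) * (2 * ((\<integral>x. (U x)\<^sup>2 \<partial>\<mu>) + (\<integral>x. (V x)\<^sup>2 \<partial>\<mu>)))"
proof -
  have d: "(\<lambda>x. U x - V x) \<in> L2_fun \<mu>" and s: "(\<lambda>x. U x + V x) \<in> L2_fun \<mu>"
    using U V by (auto intro: L2_diff L2_add)
  have "(\<integral>x. \<bar>(U x)\<^sup>2 - (V x)\<^sup>2\<bar> \<partial>\<mu>) = (\<integral>x. \<bar>U x - V x\<bar> * \<bar>U x + V x\<bar> \<partial>\<mu>)"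
    by (intro Bochner_Integration.integral_cong refl)
      (simp add: abs_mult[symmetric] power2_eq_square algebra_simps)
  then have "(\<integral>x. \<bar>(U x)\<^sup>2 - (V x)\<^sup>2\<bar> \<partial>\<mu>)\<^sup>2 \<le> (\<integral>x. (U x - V x)\<^sup>2 \<partial>\<mu>) * (\<integral>x. (U x + V x)\<^sup>2 \<partial>\<mu>)"
    using L2_Cauchy_Schwarz[OF L2_abs[OF d] L2_abs[OF s]] by simp
  also have "(\<integral>x. (U x + V x)\<^sup>2 \<partial>\<mu>) \<le> (\<integral>x. 2 * (U x)\<^sup>2 + 2 * (V x)\<^sup>2 \<partial>\<mu>)"
  proof (intro integral_mono)
    fix x show "(U x + V x)\<^sup>2 \<le> 2 * (U x)\<^sup>2 + 2 * (V x)\<^sup>2"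
      using sum_squares_bound[of "U x" "V x"] by (simp add: power2_sum)
  qed (use U V s in \<open>auto simp: L2_real_iff\<close>)
  also have "\<dots> = 2 * ((\<integral>x. (U x)\<^sup>2 \<partial>\<mu>) + (\<integral>x. (V x)\<^sup>2 \<partial>\<mu>))"
    using U V by (simp add: L2_real_iff)
  finally show ?thesis by (simp add: mult_left_mono)
qed

lemma iid_standardizedD:
  assumes "iid_standardized N X Y"
  shows "prob_space N" "X \<in> borel_measurable N" "Y \<in> borel_measurable N"
    "X \<in> L2_fun N" "Y \<in> L2_fun N"
    "(\<integral>\<omega>. X \<omega> \<partial>N) = 0" "(\<integral>\<omega>. Y \<omega> \<partial>N) = 0" "(\<integral>\<omega>. (X \<omega>)\<^sup>2 \<partial>N) = 1" "(\<integral>\<omega>. (Y \<omega>)\<^sup>2 \<partial>N) = 1"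
    "distr N (borel \<Otimes>\<^sub>M borel) (\<lambda>\<omega>. (X \<omega>, Y \<omega>)) = distr N borel X \<Otimes>\<^sub>M distr N borel X"
proof -
  interpret prob_space N using assms unfolding iid_standardized_def by blast
  have ind: "indep_var borel X borel Y" and d: "distr N borel X = distr N borel Y"
    and i: "integrable N (\<lambda>\<omega>. (X \<omega>)\<^sup>2)" and e: "expectation X = 0" and v: "variance X = 1"
    using assms by (auto simp: iid_standardized_def)
  show "prob_space N" by (rule prob_space_axioms)
  show X[measurable]: "X \<in> borel_measurable N" and Y[measurable]: "Y \<in> borel_measurable N"
    using ind indep_var_rv1 indep_var_rv2 by blast+
  have tr: "integrable N (\<lambda>\<omega>. h (Y \<omega>)) = integrable N (\<lambda>\<omega>. h (X \<omega>))"
    "(\<integral>\<omega>. h (Y \<omega>) \<partial>N) = (\<integral>\<omega>. h (X \<omega>) \<partial>N)" if "h \<in> borel_measurable borel" for h :: "real \<Rightarrow> real"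
    using integrable_distr_eq[OF X, of h] integrable_distr_eq[OF Y, of h]
      integral_distr[OF X, of h] integral_distr[OF Y, of h] that d by simp_all
  show "X \<in> L2_fun N" using i by (auto simp: L2_real_iff)
  show "Y \<in> L2_fun N" using i tr(1)[of "\<lambda>x. x\<^sup>2"] by (auto simp: L2_real_iff)
  show "(\<integral>\<omega>. X \<omega> \<partial>N) = 0" by fact
  show "(\<integral>\<omega>. Y \<omega> \<partial>N) = 0" using tr(2)[of "\<lambda>x. x"] e by simp
  show "(\<integral>\<omega>. (X \<omega>)\<^sup>2 \<partial>N) = 1" using v e by simp
  then show "(\<integral>\<omega>. (Y \<omega>)\<^sup>2 \<partial>N) = 1" using tr(2)[of "\<lambda>x. x\<^sup>2"] by simp
  show "distr N (borel \<Otimes>\<^sub>M borel) (\<lambda>\<omega>. (X \<omega>, Y \<omega>)) = distr N borel X \<Otimes>\<^sub>M distr N borel X"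
    using ind unfolding indep_var_distribution_eq d by simp
qed

lemma iid_functional_integrable:
  assumes "iid_standardized N X Y"
  shows "integrable N (\<lambda>\<omega>. \<bar>(X \<omega> + c)\<^sup>2 - (Y \<omega> + c)\<^sup>2\<bar>)"
proof -
  note D = iid_standardizedD[OF assms]
  interpret prob_space N by (rule D(1))
  have "(\<lambda>\<omega>. X \<omega> + c) \<in> L2_fun N" "(\<lambda>\<omega>. Y \<omega> + c) \<in> L2_fun N"
    using D(4,5) by (auto intro!: L2_add L2_const)
  then show ?thesis by (auto simp: L2_real_iff)
qed

text \<open>Makes the supremum over c a supremum of a bounded set. The 16 is 4 from the crude
  estimate E(X - Y)^2 <= 2 E X^2 + 2 E Y^2, times 4 from the sum of the second moments of X + c and
  Y + c.\<close>

lemma iid_functional_le: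
  assumes "iid_standardized N X Y"
  shows "(\<integral>\<omega>. \<bar>(X \<omega> + c)\<^sup>2 - (Y \<omega> + c)\<^sup>2\<bar> \<partial>N)\<^sup>2 / (1 + c\<^sup>2) \<le> 16"
proof -
  note D = iid_standardizedD[OF assms]
  interpret prob_space N by (rule D(1))
  have L: "(\<lambda>\<omega>. X \<omega> + c) \<in> L2_fun N" "(\<lambda>\<omega>. Y \<omega> + c) \<in> L2_fun N"
    using D(4,5) by (auto intro!: L2_add L2_const)
  have i: "integrable N X" "integrable N Y" "integrable N (\<lambda>\<omega>. (X \<omega>)\<^sup>2)" "integrable N (\<lambda>\<omega>. (Y \<omega>)\<^sup>2)"
    using L2_integrable[OF D(4)] L2_integrable[OF D(5)] D(4,5) by (simp_all add: L2_real_iff)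
  have sq: "(\<integral>\<omega>. (X \<omega> + c)\<^sup>2 \<partial>N) = 1 + c\<^sup>2" "(\<integral>\<omega>. (Y \<omega> + c)\<^sup>2 \<partial>N) = 1 + c\<^sup>2"
    using i D(6-9) by (simp_all add: power2_sum prob_space)
  have "(\<integral>\<omega>. (X \<omega> - Y \<omega>)\<^sup>2 \<partial>N) \<le> (\<integral>\<omega>. 2 * (X \<omega>)\<^sup>2 + 2 * (Y \<omega>)\<^sup>2 \<partial>N)"
  proof (intro integral_mono)
    fix x show "(X x - Y x)\<^sup>2 \<le> 2 * (X x)\<^sup>2 + 2 * (Y x)\<^sup>2"
      using sum_squares_bound[of "X x" "- Y x"] by (simp add: power2_diff)
  qed (use i L2_diff[OF D(4,5)] in \<open>auto simp: L2_real_iff\<close>)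
  also have "\<dots> = 4" using i D(6-9) by simp
  finally have "(\<integral>\<omega>. (X \<omega> - Y \<omega>)\<^sup>2 \<partial>N) \<le> 4" .
  then have "(\<integral>\<omega>. (X \<omega> - Y \<omega>)\<^sup>2 \<partial>N) * (4 * (1 + c\<^sup>2)) \<le> 4 * (4 * (1 + c\<^sup>2))"
    by (intro mult_right_mono) (auto simp: add_nonneg_nonneg)
  moreover have "(\<integral>\<omega>. \<bar>(X \<omega> + c)\<^sup>2 - (Y \<omega> + c)\<^sup>2\<bar> \<partial>N)\<^sup>2 \<le> (\<integral>\<omega>. (X \<omega> - Y \<omega>)\<^sup>2 \<partial>N) * (4 * (1 + c\<^sup>2))"
    using square_difference_integral_le[OF L] sq by simp
  ultimately show ?thesis
    by (subst pos_divide_le_eq) (auto simp: add_pos_nonneg)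
qed

text \<open>Jensen conditionally on X: with the first coordinate frozen at x, averaging (x + c)^2 -
  (y + c)^2 over y leaves x^2 + 2 c x - 1. Independence enters through the product form of the joint
  law.\<close>

lemma iid_functional_ge:
  assumes "iid_standardized N X Y"
  shows "(\<integral>\<omega>. \<bar>(X \<omega>)\<^sup>2 + 2 * c * X \<omega> - 1\<bar> \<partial>N) \<le> (\<integral>\<omega>. \<bar>(X \<omega> + c)\<^sup>2 - (Y \<omega> + c)\<^sup>2\<bar> \<partial>N)"
proof -
  note D = iid_standardizedD[OF assms]
  note [measurable] = D(2,3)
  interpret prob_space N by (rule D(1))
  define \<nu> where "\<nu> = distr N borel X"
  interpret nu: prob_space \<nu> unfolding \<nu>_def by (rule prob_space_distr) simp
  interpret P: pair_prob_space \<nu> \<nu> ..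
  have [measurable_cong, simp]: "sets \<nu> = sets borel" by (simp add: \<nu>_def)
  have iX: "integrable N X" "integrable N (\<lambda>\<omega>. (X \<omega>)\<^sup>2)"
    using L2_integrable[OF D(4)] L2_integrable[OF D(5)] D(4,5) by (simp_all add: L2_real_iff)
  have i: "integrable \<nu> (\<lambda>x. x)" "integrable \<nu> (\<lambda>x. x\<^sup>2)"
    using iX by (simp_all add: \<nu>_def integrable_distr_eq)
  have e: "(\<integral>x. x \<partial>\<nu>) = 0" "(\<integral>x. x\<^sup>2 \<partial>\<nu>) = 1"
    using D(6-9) by (simp_all add: \<nu>_def integral_distr)
  define h where "h = (\<lambda>(x, y). \<bar>(x + c)\<^sup>2 - (y + c)\<^sup>2\<bar> :: real)"
  have [measurable]: "h \<in> borel_measurable (borel \<Otimes>\<^sub>M borel)" unfolding h_def by measurable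
  have hN: "(\<integral>\<omega>. h (X \<omega>, Y \<omega>) \<partial>N) = (\<integral>z. h z \<partial>(\<nu> \<Otimes>\<^sub>M \<nu>))"
    and hi: "integrable (\<nu> \<Otimes>\<^sub>M \<nu>) h"
    using integral_distr[of "\<lambda>\<omega>. (X \<omega>, Y \<omega>)" N "borel \<Otimes>\<^sub>M borel" h]
      integrable_distr_eq[of "\<lambda>\<omega>. (X \<omega>, Y \<omega>)" N "borel \<Otimes>\<^sub>M borel" h]
      iid_functional_integrable[OF assms, of c] by (simp_all add: D(10) \<nu>_def h_def)
  have "(\<integral>\<omega>. \<bar>(X \<omega>)\<^sup>2 + 2 * c * X \<omega> - 1\<bar> \<partial>N) = (\<integral>x. \<bar>x\<^sup>2 + 2 * c * x - 1\<bar> \<partial>\<nu>)"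
    by (simp add: \<nu>_def integral_distr)
  also have "\<dots> \<le> (\<integral>x. (\<integral>y. h (x, y) \<partial>\<nu>) \<partial>\<nu>)"
  proof (rule integral_mono)
    show "integrable \<nu> (\<lambda>x. \<integral>y. h (x, y) \<partial>\<nu>)" by (rule P.integrable_fst'[OF hi])
    fix x
    have "x\<^sup>2 + 2 * c * x - 1 = (\<integral>y. (x + c)\<^sup>2 - (y + c)\<^sup>2 \<partial>\<nu>)"
      using i e by (simp add: power2_sum nu.prob_space algebra_simps)
    then show "\<bar>x\<^sup>2 + 2 * c * x - 1\<bar> \<le> (\<integral>y. h (x, y) \<partial>\<nu>)"
      using integral_abs_bound[of \<nu> "\<lambda>y. (x + c)\<^sup>2 - (y + c)\<^sup>2"] by (simp add: h_def)
  qed (use i in auto)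
  also have "\<dots> = (\<integral>z. h z \<partial>(\<nu> \<Otimes>\<^sub>M \<nu>))" by (rule P.integral_fst'[OF hi])
  also have "\<dots> = (\<integral>\<omega>. \<bar>(X \<omega> + c)\<^sup>2 - (Y \<omega> + c)\<^sup>2\<bar> \<partial>N)" using hN by (simp add: h_def)
  finally show ?thesis .
qed

text \<open>
  With \<open>a = E\<bar>X\<^sup>2 - 1\<bar>\<close>, conditioning on \<open>X\<close> bounds the expectation at \<open>c\<close> from below by \<open>a\<close> for
  \<open>c = 0\<close> and by \<open>8 E\<bar>X\<bar> - a\<close> for \<open>c = 4\<close>, while \<open>\<bar>X\<bar> \<ge> min 1 X\<^sup>2\<close> gives \<open>E\<bar>X\<bar> \<ge> 1 - a / 2\<close>.
\<close>

lemma iid_functional_SUP_ge: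
  assumes "iid_standardized N X Y"
  shows "1 / 2 \<le> (SUP c. (\<integral>\<omega>. \<bar>(X \<omega> + c)\<^sup>2 - (Y \<omega> + c)\<^sup>2\<bar> \<partial>N)\<^sup>2 / (1 + c\<^sup>2))"
    (is "_ \<le> (SUP c. ?F c)")
proof -
  note D = iid_standardizedD[OF assms]
  note [measurable] = D(2,3)
  interpret prob_space N by (rule D(1))
  have i: "integrable N X" "integrable N (\<lambda>\<omega>. (X \<omega>)\<^sup>2)"
    using L2_integrable[OF D(4)] L2_integrable[OF D(5)] D(4,5) by (simp_all add: L2_real_iff)
  define a where "a = (\<integral>\<omega>. \<bar>(X \<omega>)\<^sup>2 - 1\<bar> \<partial>N)"
  have bdd: "bdd_above (range ?F)"
    using iid_functional_le[OF assms] by (intro bdd_aboveI[of _ 16]) auto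
  show ?thesis
  proof (cases "1 \<le> a")
    case True
    then have "1 \<le> (\<integral>\<omega>. \<bar>(X \<omega> + 0)\<^sup>2 - (Y \<omega> + 0)\<^sup>2\<bar> \<partial>N)"
      using iid_functional_ge[OF assms, of 0] by (simp add: a_def)
    then have "1\<^sup>2 \<le> (\<integral>\<omega>. \<bar>(X \<omega> + 0)\<^sup>2 - (Y \<omega> + 0)\<^sup>2\<bar> \<partial>N)\<^sup>2" by (intro power_mono) auto
    then have "1 / 2 \<le> ?F 0" by simp
    also have "?F 0 \<le> (SUP c. ?F c)" by (rule cSUP_upper[OF _ bdd]) simp
    finally show ?thesis .
  next
    case False
    \<comment> \<open>The fraction is min 1 X^2, written through an absolute value so that its mean
      is expressed by a; it is at most |X|. The rest is |X^2 + 8 X - 1| >= 8 |X| - |X^2 - 1|. The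
      mean on the left is 8 (1 - a/2) - a = 8 - 5 a, above 3 since a < 1.\<close>
    have "(\<integral>\<omega>. 8 * ((1 + (X \<omega>)\<^sup>2 - \<bar>(X \<omega>)\<^sup>2 - 1\<bar>) / 2) - \<bar>(X \<omega>)\<^sup>2 - 1\<bar> \<partial>N)
        \<le> (\<integral>\<omega>. \<bar>(X \<omega>)\<^sup>2 + 2 * 4 * X \<omega> - 1\<bar> \<partial>N)"
    proof (rule integral_mono)
      fix \<omega>
      have "(1 + (X \<omega>)\<^sup>2 - \<bar>(X \<omega>)\<^sup>2 - 1\<bar>) / 2 \<le> \<bar>X \<omega>\<bar>"
      proof (cases "\<bar>X \<omega>\<bar> \<le> 1")
        case True
        then have "\<bar>X \<omega>\<bar> * \<bar>X \<omega>\<bar> \<le> \<bar>X \<omega>\<bar> * 1" by (intro mult_left_mono) auto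
        then have "(X \<omega>)\<^sup>2 \<le> \<bar>X \<omega>\<bar>" by (simp add: power2_eq_square)
        moreover have "\<bar>(X \<omega>)\<^sup>2 - 1\<bar> = 1 - (X \<omega>)\<^sup>2"
          using True \<open>(X \<omega>)\<^sup>2 \<le> \<bar>X \<omega>\<bar>\<close> by (simp add: abs_if)
        ultimately show ?thesis by simp
      next
        case False
        with abs_ge_self[of "(X \<omega>)\<^sup>2 - 1"] show ?thesis by (simp add: field_simps)
      qed
      then show "8 * ((1 + (X \<omega>)\<^sup>2 - \<bar>(X \<omega>)\<^sup>2 - 1\<bar>) / 2) - \<bar>(X \<omega>)\<^sup>2 - 1\<bar> \<le> \<bar>(X \<omega>)\<^sup>2 + 2 * 4 * X \<omega> - 1\<bar>"
        by linarith
    qed (use i in auto)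
    also have "(\<integral>\<omega>. 8 * ((1 + (X \<omega>)\<^sup>2 - \<bar>(X \<omega>)\<^sup>2 - 1\<bar>) / 2) - \<bar>(X \<omega>)\<^sup>2 - 1\<bar> \<partial>N) = 8 - 5 * a"
      using i D(6-9) by (simp add: a_def prob_space field_simps)
    finally have "3 \<le> (\<integral>\<omega>. \<bar>(X \<omega>)\<^sup>2 + 2 * 4 * X \<omega> - 1\<bar> \<partial>N)" using False by linarith
    then have "3 \<le> (\<integral>\<omega>. \<bar>(X \<omega> + 4)\<^sup>2 - (Y \<omega> + 4)\<^sup>2\<bar> \<partial>N)"
      using iid_functional_ge[OF assms, of 4] by simp
    then have "3\<^sup>2 \<le> (\<integral>\<omega>. \<bar>(X \<omega> + 4)\<^sup>2 - (Y \<omega> + 4)\<^sup>2\<bar> \<partial>N)\<^sup>2" by (intro power_mono) auto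
    \<comment> \<open>Here 3^2 / (1 + 4^2) = 9/17, just above 1/2.\<close>
    then have "1 / 2 \<le> ?F 4" by simp
    also have "?F 4 \<le> (SUP c. ?F c)" by (rule cSUP_upper[OF _ bdd]) simp
    finally show ?thesis .
  qed
qed

lemma lawler_sokal_const_le:
  fixes N :: "(real \<times> real) measure"
  assumes "iid_standardized N X Y"
  shows "lawler_sokal_const \<le> (SUP c. (\<integral>\<omega>. \<bar>(X \<omega> + c)\<^sup>2 - (Y \<omega> + c)\<^sup>2\<bar> \<partial>N)\<^sup>2 / (1 + c\<^sup>2))"
proof -
  let ?G = "\<lambda>(N :: (real \<times> real) measure, X :: real \<times> real \<Rightarrow> real, Y :: real \<times> real \<Rightarrow> real). SUP c. (\<integral>\<omega>. \<bar>(X \<omega> + c)\<^sup>2 - (Y \<omega> + c)\<^sup>2\<bar> \<partial>N)\<^sup>2 / (1 + c\<^sup>2)"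
  \<comment> \<open>A real infimum is known to be a lower bound only after the set has been shown
    bounded below.\<close>
  have "bdd_below (?G ` {(N, X, Y). iid_standardized N X Y})"
    using iid_functional_SUP_ge by (intro bdd_belowI[of _ "1/2"]) auto
  then have "lawler_sokal_const \<le> ?G (N, X, Y)"
    unfolding lawler_sokal_const_def using assms by (intro cINF_lower) auto
  then show ?thesis by simp
qed

section \<open>The Lawler--Sokal inequality\<close>

text \<open>The levels t exceeded by exactly one of a and b form the half-open interval from min a b
  to max a b.\<close>

lemma abs_diff_layer_cake:
  fixes a b :: real
  shows "ennreal \<bar>a - b\<bar> = (\<integral>\<^sup>+t. indicator {t. (t < a) \<noteq> (t < b)} t \<partial>lborel)"
proof -
  have "{t. (t < a) \<noteq> (t < b)} = {min a b..<max a b}" by (auto simp: min_def max_def)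
  then have "(\<integral>\<^sup>+t. indicator {t. (t < a) \<noteq> (t < b)} t \<partial>lborel) = emeasure lborel {min a b..<max a b}" by simp
  then show ?thesis by (simp add: max_def min_def abs_real_def)
qed

text \<open>The co-area formula: Fubini applied to the layer representation turns the L1 variation
  of G into an integral over t of the mass cut by the superlevel set {G > t}. R is left general
  because the formula is needed for both \<open>edge\<close> and the product measure.\<close>

lemma nn_integral_abs_diff_level_sets:
  fixes G :: "'a \<Rightarrow> real"
  assumes "sigma_finite_measure R" and [measurable_cong]: "sets R = sets (M \<Otimes>\<^sub>M M)"
    and [measurable]: "G \<in> borel_measurable M"
  shows "(\<integral>\<^sup>+z. ennreal \<bar>G (fst z) - G (snd z)\<bar> \<partial>R)
     = (\<integral>\<^sup>+t. emeasure R {z \<in> space (M \<Otimes>\<^sub>M M). (t < G (fst z)) \<noteq> (t < G (snd z))} \<partial>lborel)"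
proof -
  interpret R: sigma_finite_measure R by fact
  interpret P: pair_sigma_finite lborel R ..
  have sp: "space R = space (M \<Otimes>\<^sub>M M)" by (rule sets_eq_imp_space_eq) fact
  have "(\<integral>\<^sup>+z. ennreal \<bar>G (fst z) - G (snd z)\<bar> \<partial>R)
      = (\<integral>\<^sup>+z. \<integral>\<^sup>+t. indicator {(t, z). (t < G (fst z)) \<noteq> (t < G (snd z))} (t, z) \<partial>lborel \<partial>R)"
    unfolding abs_diff_layer_cake by (rule nn_integral_cong, rule nn_integral_cong) (simp add: indicator_def)
  also have "\<dots> = (\<integral>\<^sup>+t. \<integral>\<^sup>+z. indicator {(t, z). (t < G (fst z)) \<noteq> (t < G (snd z))} (t, z) \<partial>R \<partial>lborel)"
    by (rule P.Fubini') (simp add: indicator_def split_beta')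
  also have "\<dots> = (\<integral>\<^sup>+t. \<integral>\<^sup>+z. indicator {z \<in> space (M \<Otimes>\<^sub>M M). (t < G (fst z)) \<noteq> (t < G (snd z))} z \<partial>R \<partial>lborel)"
    by (intro nn_integral_cong) (auto simp: indicator_def sp)
  also have "\<dots> = (\<integral>\<^sup>+t. emeasure R {z \<in> space (M \<Otimes>\<^sub>M M). (t < G (fst z)) \<noteq> (t < G (snd z))} \<partial>lborel)"
    by (intro nn_integral_cong nn_integral_indicator) measurable
  finally show ?thesis .
qed

context stationary_kernel
begin

sublocale edge: prob_space edge by (rule prob_space_edge)
sublocale pair: pair_prob_space \<pi> \<pi> ..

text \<open>The numerator of \<open>iso_ratio\<close>, stated for the kernel of the locale rather
  than for \<open>kernel_power\<close>, so that an interpretation with the two-step kernel yields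
  the numerator belonging to k_2.\<close>

definition flow :: "'a set \<Rightarrow> real" where
  "flow A = (LINT x:A|\<pi>. measure (q x) (space \<pi> - A))"

lemma indicator_L2: "A \<in> sets \<pi> \<Longrightarrow> (indicator A :: 'a \<Rightarrow> real) \<in> L2_fun \<pi>"
proof -
  have "(\<lambda>x. (indicator A x :: real)\<^sup>2) = indicator A" by (auto simp: indicator_def)
  then show "A \<in> sets \<pi> \<Longrightarrow> (indicator A :: 'a \<Rightarrow> real) \<in> L2_fun \<pi>"
    by (simp add: L2_real_iff less_top[symmetric])
qed

lemma markov_op_indicator:
  "x \<in> space \<pi> \<Longrightarrow> A \<in> sets \<pi> \<Longrightarrow> markov_op q (indicator A) x = measure (q x) A"
  by (simp add: markov_op_def sets_q space_q sets.Int_space_eq2)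

lemma integral_prod_indicator:
  assumes [measurable]: "A \<in> sets \<pi>" "B \<in> sets \<pi>"
  shows "measure edge (A \<times> B) = (\<integral>x. (indicator A x :: real) * markov_op q (indicator B) x \<partial>\<pi>)"
proof -
  have "(\<integral>x. (indicator A x :: real) * markov_op q (indicator B) x \<partial>\<pi>) = (\<integral>z. indicator A (fst z) * indicator B (snd z) \<partial>edge)"
    using integral_edge_product[OF indicator_L2[OF assms(1)] indicator_L2[OF assms(2)]] by simp
  also have "\<dots> = (\<integral>z. indicator (A \<times> B) z \<partial>edge)"
    by (intro Bochner_Integration.integral_cong) (auto simp: indicator_def)
  also have "\<dots> = measure edge (A \<times> B)"
    using sets.sets_into_space[OF assms(1)] sets.sets_into_space[OF assms(2)]
    by (simp add: space_edge Int_absorb2 Sigma_mono)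
  finally show ?thesis by simp
qed

lemma flow_eq_edge:
  assumes [measurable]: "A \<in> sets \<pi>"
  shows "flow A = measure edge (A \<times> (space \<pi> - A))"
  unfolding flow_def set_lebesgue_integral_def
  by (subst integral_prod_indicator) (auto intro!: Bochner_Integration.integral_cong simp: markov_op_indicator)

text \<open>Each equation is one marginal of \<open>edge\<close>, and both marginals are
  \<open>\<pi>\<close>. Together they say that the mass leaving A equals the mass entering
  A.\<close>

lemma edge_rectangles:
  assumes [measurable]: "A \<in> sets \<pi>"
  shows "measure edge (A \<times> A) + measure edge (A \<times> (space \<pi> - A)) = measure \<pi> A"
    and "measure edge (A \<times> A) + measure edge ((space \<pi> - A) \<times> A) = measure \<pi> A"
proof -
  have s: "A \<subseteq> space \<pi>" by (rule sets.sets_into_space) fact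
  have "measure edge (fst -` A \<inter> space edge) = measure \<pi> A"
    using measure_distr[of fst edge \<pi> A] by (simp add: distr_edge_fst)
  moreover have "fst -` A \<inter> space edge = A \<times> A \<union> A \<times> (space \<pi> - A)" using s by (auto simp: space_edge)
  moreover have "measure edge (A \<times> A \<union> A \<times> (space \<pi> - A)) = measure edge (A \<times> A) + measure edge (A \<times> (space \<pi> - A))"
    by (intro edge.finite_measure_Union) auto
  ultimately show "measure edge (A \<times> A) + measure edge (A \<times> (space \<pi> - A)) = measure \<pi> A" by simp
  have "measure edge (snd -` A \<inter> space edge) = measure \<pi> A"
    using measure_distr[of snd edge \<pi> A] by (simp add: distr_edge_snd)
  moreover have "snd -` A \<inter> space edge = A \<times> A \<union> (space \<pi> - A) \<times> A" using s by (auto simp: space_edge)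
  moreover have "measure edge (A \<times> A \<union> (space \<pi> - A) \<times> A) = measure edge (A \<times> A) + measure edge ((space \<pi> - A) \<times> A)"
    by (intro edge.finite_measure_Union) auto
  ultimately show "measure edge (A \<times> A) + measure edge ((space \<pi> - A) \<times> A) = measure \<pi> A" by simp
qed

text \<open>A cut consists of the two rectangles leaving and entering A, of equal mass under either
  measure. The common factor 2 cancels when the cuts are compared.\<close>

lemma edge_cut:
  assumes A[measurable]: "A \<in> sets \<pi>"
  shows "measure edge {z \<in> space (\<pi> \<Otimes>\<^sub>M \<pi>). (fst z \<in> A) \<noteq> (snd z \<in> A)} = 2 * flow A"
    and "measure (\<pi> \<Otimes>\<^sub>M \<pi>) {z \<in> space (\<pi> \<Otimes>\<^sub>M \<pi>). (fst z \<in> A) \<noteq> (snd z \<in> A)} = 2 * (measure \<pi> A * measure \<pi> (space \<pi> - A))"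
proof -
  have s: "A \<subseteq> space \<pi>" by (rule sets.sets_into_space) fact
  have eq: "{z \<in> space (\<pi> \<Otimes>\<^sub>M \<pi>). (fst z \<in> A) \<noteq> (snd z \<in> A)} = A \<times> (space \<pi> - A) \<union> (space \<pi> - A) \<times> A"
    using s by (auto simp: space_pair_measure)
  have "measure edge (A \<times> (space \<pi> - A) \<union> (space \<pi> - A) \<times> A) = measure edge (A \<times> (space \<pi> - A)) + measure edge ((space \<pi> - A) \<times> A)"
    by (intro edge.finite_measure_Union) auto
  then show "measure edge {z \<in> space (\<pi> \<Otimes>\<^sub>M \<pi>). (fst z \<in> A) \<noteq> (snd z \<in> A)} = 2 * flow A"
    unfolding eq flow_eq_edge[OF A] using edge_rectangles[OF A] by simp
  have "measure (\<pi> \<Otimes>\<^sub>M \<pi>) (A \<times> (space \<pi> - A) \<union> (space \<pi> - A) \<times> A)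
      = measure (\<pi> \<Otimes>\<^sub>M \<pi>) (A \<times> (space \<pi> - A)) + measure (\<pi> \<Otimes>\<^sub>M \<pi>) ((space \<pi> - A) \<times> A)"
    by (intro pair.P.finite_measure_Union) auto
  then show "measure (\<pi> \<Otimes>\<^sub>M \<pi>) {z \<in> space (\<pi> \<Otimes>\<^sub>M \<pi>). (fst z \<in> A) \<noteq> (snd z \<in> A)} = 2 * (measure \<pi> A * measure \<pi> (space \<pi> - A))"
    unfolding eq by (simp add: measure_def emeasure_pair_measure_Times enn2real_mult)
qed

lemma integrable_pair_fst:
  fixes G :: "'a \<Rightarrow> real"
  assumes "integrable \<pi> G"
  shows "integrable (\<pi> \<Otimes>\<^sub>M \<pi>) (\<lambda>z. G (fst z))"
  using assms by (intro pair.Fubini_integrable) (auto simp: prob_space)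

text \<open>The hypothesis on k compares the two measures on the cut of every superlevel set of G;
  integrating over the level gives the comparison for G itself. The work is done in
  \<open>ennreal\<close> and brought back by integrability.\<close>

lemma coarea_bound:
  fixes G :: "'a \<Rightarrow> real"
  assumes k0: "0 \<le> k" and k: "\<And>A. A \<in> sets \<pi> \<Longrightarrow> k * (measure \<pi> A * measure \<pi> (space \<pi> - A)) \<le> flow A"
    and G: "integrable \<pi> G"
  shows "k * (\<integral>z. \<bar>G (fst z) - G (snd z)\<bar> \<partial>(\<pi> \<Otimes>\<^sub>M \<pi>)) \<le> (\<integral>z. \<bar>G (fst z) - G (snd z)\<bar> \<partial>edge)"
proof -
  have Gm[measurable]: "G \<in> borel_measurable \<pi>" using G by auto
  let ?C = "\<lambda>t. {z \<in> space (\<pi> \<Otimes>\<^sub>M \<pi>). (t < G (fst z)) \<noteq> (t < G (snd z))}"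
  have C: "?C t = {z \<in> space (\<pi> \<Otimes>\<^sub>M \<pi>). (fst z \<in> {x \<in> space \<pi>. t < G x}) \<noteq> (snd z \<in> {x \<in> space \<pi>. t < G x})}" for t
    by (auto simp: space_pair_measure)
  have "k * measure (\<pi> \<Otimes>\<^sub>M \<pi>) (?C t) \<le> measure edge (?C t)" for t
  proof -
    have S: "{x \<in> space \<pi>. t < G x} \<in> sets \<pi>" by measurable
    show ?thesis unfolding C edge_cut[OF S] using k[OF S] by simp
  qed
  then have le: "ennreal k * emeasure (\<pi> \<Otimes>\<^sub>M \<pi>) (?C t) \<le> emeasure edge (?C t)" for t
    using k0 by (simp add: pair.P.emeasure_eq_measure edge.emeasure_eq_measure ennreal_mult[symmetric])
  have m: "(\<lambda>t. emeasure (\<pi> \<Otimes>\<^sub>M \<pi>) (?C t)) \<in> borel_measurable lborel"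
    by measurable
  have nn: "ennreal k * (\<integral>\<^sup>+z. ennreal \<bar>G (fst z) - G (snd z)\<bar> \<partial>(\<pi> \<Otimes>\<^sub>M \<pi>))
     \<le> (\<integral>\<^sup>+z. ennreal \<bar>G (fst z) - G (snd z)\<bar> \<partial>edge)"
    using nn_integral_mono[of lborel "\<lambda>t. ennreal k * emeasure (\<pi> \<Otimes>\<^sub>M \<pi>) (?C t)" "\<lambda>t. emeasure edge (?C t)"] le m
    by (simp add: nn_integral_cmult nn_integral_abs_diff_level_sets[OF edge.sigma_finite_measure_axioms sets_edge Gm]
       nn_integral_abs_diff_level_sets[OF pair.P.sigma_finite_measure_axioms refl Gm])
  have ie: "integrable edge (\<lambda>z. \<bar>G (fst z) - G (snd z)\<bar>)"
    using G by (auto simp: integrable_edge_fst integrable_edge_snd)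
  have "integrable (\<pi> \<Otimes>\<^sub>M \<pi>) (\<lambda>z. G (fst z))" "integrable (\<pi> \<Otimes>\<^sub>M \<pi>) (\<lambda>z. G (snd z))"
    using integrable_pair_fst[OF G] pair.integrable_product_swap_iff[of "\<lambda>z. G (fst z)"] by (simp_all add: split_beta')
  then have ip: "integrable (\<pi> \<Otimes>\<^sub>M \<pi>) (\<lambda>z. \<bar>G (fst z) - G (snd z)\<bar>)" by auto
  show ?thesis
    using nn k0 by (simp add: nn_integral_eq_integral[OF ie] nn_integral_eq_integral[OF ip] ennreal_mult[symmetric])
qed

end

section \<open>Independent copies of a function on the state space\<close>

lemma distr_pair_prob_fst_snd:
  assumes "prob_space M" "prob_space N"
  shows "distr (M \<Otimes>\<^sub>M N) M fst = M" "distr (M \<Otimes>\<^sub>M N) N snd = N"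
proof -
  interpret M: prob_space M by fact
  interpret N: prob_space N by fact
  show "distr (M \<Otimes>\<^sub>M N) M fst = M"
  proof (rule measure_eqI)
    fix A assume "A \<in> sets (distr (M \<Otimes>\<^sub>M N) M fst)"
    then have A: "A \<in> sets M" by simp
    then have "fst -` A \<inter> space (M \<Otimes>\<^sub>M N) = A \<times> space N"
      using sets.sets_into_space[OF A] by (auto simp: space_pair_measure)
    with A show "emeasure (distr (M \<Otimes>\<^sub>M N) M fst) A = emeasure M A"
      by (simp add: emeasure_distr N.emeasure_pair_measure_Times N.emeasure_space_1)
  qed simp
  show "distr (M \<Otimes>\<^sub>M N) N snd = N"
  proof (rule measure_eqI)
    fix A assume "A \<in> sets (distr (M \<Otimes>\<^sub>M N) N snd)"
    then have A: "A \<in> sets N" by simp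
    then have "snd -` A \<inter> space (M \<Otimes>\<^sub>M N) = space M \<times> A"
      using sets.sets_into_space[OF A] by (auto simp: space_pair_measure)
    with A show "emeasure (distr (M \<Otimes>\<^sub>M N) N snd) A = emeasure N A"
      by (simp add: emeasure_distr N.emeasure_pair_measure_Times M.emeasure_space_1)
  qed simp
qed

text \<open>Independent copies of g are realised as coordinate projections on the square of its law.
  This sample space has type \<open>real \<times> real\<close>, so the pair lies in the index set of
  \<open>lawler_sokal_const\<close>.\<close>

lemma (in prob_space) iid_standardized_distr:
  fixes g :: "'a \<Rightarrow> real"
  assumes g: "g \<in> L2_fun M" and m: "(\<integral>x. g x \<partial>M) = 0" and v: "(\<integral>x. (g x)\<^sup>2 \<partial>M) = 1"
  shows "iid_standardized (distr M borel g \<Otimes>\<^sub>M distr M borel g) fst snd"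
proof -
  have [measurable]: "g \<in> borel_measurable M" and i: "integrable M (\<lambda>x. (g x)\<^sup>2)"
    using g by (auto simp: L2_real_iff)
  define \<nu> where "\<nu> = distr M borel g"
  have [simp, measurable_cong]: "sets \<nu> = sets borel" by (simp add: \<nu>_def)
  interpret nu: prob_space \<nu> unfolding \<nu>_def by (rule prob_space_distr) simp
  interpret P: pair_prob_space \<nu> \<nu> ..
  note fs = distr_pair_prob_fst_snd[OF nu.prob_space_axioms nu.prob_space_axioms]
  have b: "distr (\<nu> \<Otimes>\<^sub>M \<nu>) borel fst = \<nu>" "distr (\<nu> \<Otimes>\<^sub>M \<nu>) borel snd = \<nu>"
    using fs by (metis \<open>sets \<nu> = sets borel\<close> distr_cong)+
  have s: "sets (\<nu> \<Otimes>\<^sub>M \<nu>) = sets (borel \<Otimes>\<^sub>M borel)" by (rule sets_pair_measure_cong) simp_all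
  have tr: "integrable (\<nu> \<Otimes>\<^sub>M \<nu>) (\<lambda>z. h (fst z)) = integrable M (\<lambda>x. h (g x))"
    "(\<integral>z. h (fst z) \<partial>(\<nu> \<Otimes>\<^sub>M \<nu>)) = (\<integral>x. h (g x) \<partial>M)"
    if [measurable]: "h \<in> borel_measurable borel" for h :: "real \<Rightarrow> real"
    using integrable_distr_eq[of fst "\<nu> \<Otimes>\<^sub>M \<nu>" borel h] integral_distr[of fst "\<nu> \<Otimes>\<^sub>M \<nu>" borel h]
      integrable_distr_eq[of g M borel h] integral_distr[of g M borel h]
    by (simp_all add: b \<nu>_def[symmetric])
  have ind: "P.indep_var borel fst borel snd"
    unfolding P.indep_var_distribution_eq using distr_id2[OF s[symmetric]] by (simp add: b)
  show ?thesis
    unfolding iid_standardized_def \<nu>_def[symmetric]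
    using ind b i m v tr[of "\<lambda>x. x"] tr[of "\<lambda>x. x\<^sup>2"] P.prob_space_axioms by simp
qed

context stationary_kernel
begin

text \<open>Both marginals of \<open>edge\<close> are \<open>\<pi>\<close>, so each square
  contributes ||f||^2; the cross term is \<open>integral_edge_product\<close>.\<close>

lemma Dirichlet_form:
  fixes f :: "'a \<Rightarrow> real"
  assumes f: "f \<in> L2_fun \<pi>"
  shows "(\<integral>z. (f (fst z) - f (snd z))\<^sup>2 \<partial>edge) = 2 * ((\<integral>x. (f x)\<^sup>2 \<partial>\<pi>) - (\<integral>x. f x * markov_op q f x \<partial>\<pi>))"
proof -
  have m: "f \<in> borel_measurable \<pi>" "(\<lambda>x. (f x)\<^sup>2) \<in> borel_measurable \<pi>" and i: "integrable \<pi> (\<lambda>x. (f x)\<^sup>2)"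
    using f by (auto simp: L2_real_iff)
  note i1 = integrable_edge_fst[OF m(2), THEN iffD2, OF i] and i2 = integrable_edge_snd[OF m(2), THEN iffD2, OF i]
    and i3 = L2_mult_integrable[OF L2_edge[OF f]]
  have "(\<integral>z. (f (fst z) - f (snd z))\<^sup>2 \<partial>edge) = (\<integral>z. (f (fst z))\<^sup>2 + (f (snd z))\<^sup>2 - 2 * (f (fst z) * f (snd z)) \<partial>edge)"
    by (intro Bochner_Integration.integral_cong) (auto simp: power2_diff)
  also have "\<dots> = (\<integral>z. (f (fst z))\<^sup>2 \<partial>edge) + (\<integral>z. (f (snd z))\<^sup>2 \<partial>edge) - 2 * (\<integral>z. f (fst z) * f (snd z) \<partial>edge)"
    using i1 i2 i3 by simp
  finally show ?thesis
    by (simp add: integral_edge_fst[OF m(2)] integral_edge_snd[OF m(2)] integral_edge_product[OF f f])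
qed

text \<open>For each c, the co-area bound for (g + c)^2 and Cauchy-Schwarz on \<open>edge\<close>
  give k^2 E(c)^2 <= 4 D (1 + c^2), where D is the Dirichlet integral of g. Taking the supremum over
  c yields \<kappa> k^2 <= 4 D = 8 (1 - <g, P g>), which is the origin of the 8.\<close>

lemma lawler_sokal_normalized:
  fixes g :: "'a \<Rightarrow> real"
  assumes k0: "0 \<le> k" and k: "\<And>A. A \<in> sets \<pi> \<Longrightarrow> k * (measure \<pi> A * measure \<pi> (space \<pi> - A)) \<le> flow A"
    and g: "g \<in> L2_fun \<pi>" and m: "(\<integral>x. g x \<partial>\<pi>) = 0" and v: "(\<integral>x. (g x)\<^sup>2 \<partial>\<pi>) = 1"
  shows "(\<integral>x. g x * markov_op q g x \<partial>\<pi>) \<le> 1 - lawler_sokal_const / 8 * k\<^sup>2"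
proof -
  have gm[measurable]: "g \<in> borel_measurable \<pi>" and i: "integrable \<pi> (\<lambda>x. (g x)\<^sup>2)" "integrable \<pi> g"
    using g L2_integrable[OF g] by (auto simp: L2_real_iff)
  define D where "D = (\<integral>z. (g (fst z) - g (snd z))\<^sup>2 \<partial>edge)"
  have D0: "0 \<le> D" by (simp add: D_def)
  have D: "D = 2 * (1 - (\<integral>x. g x * markov_op q g x \<partial>\<pi>))"
    using Dirichlet_form[OF g] v by (simp add: D_def)
  define N where "N = distr \<pi> borel g \<Otimes>\<^sub>M distr \<pi> borel g"
  have iid: "iid_standardized N fst snd" unfolding N_def by (rule iid_standardized_distr[OF g m v])
  define E where "E c = (\<integral>\<omega>. \<bar>(fst \<omega> + c)\<^sup>2 - (snd \<omega> + c)\<^sup>2\<bar> \<partial>N)" for c :: real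
  have bound: "k\<^sup>2 * ((E c)\<^sup>2 / (1 + c\<^sup>2)) \<le> 4 * D" for c
  proof -
    have gc: "(\<lambda>x. g x + c) \<in> L2_fun \<pi>" by (intro L2_add g L2_const)
    have gc2: "integrable \<pi> (\<lambda>x. (g x + c)\<^sup>2)" using gc by (simp add: L2_real_iff)
    have sq: "(\<integral>x. (g x + c)\<^sup>2 \<partial>\<pi>) = 1 + c\<^sup>2"
      using i m v by (simp add: power2_sum prob_space)
    have N: "N = distr (\<pi> \<Otimes>\<^sub>M \<pi>) (borel \<Otimes>\<^sub>M borel) (\<lambda>(x, y). (g x, g y))"
      unfolding N_def by (intro pair_measure_distr gm prob_space_imp_sigma_finite prob_space_distr)
    have "E c = (\<integral>z. \<bar>(g (fst z) + c)\<^sup>2 - (g (snd z) + c)\<^sup>2\<bar> \<partial>(\<pi> \<Otimes>\<^sub>M \<pi>))"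
      unfolding E_def N by (subst integral_distr) (auto simp: split_beta')
    then have "k * E c \<le> (\<integral>z. \<bar>(g (fst z) + c)\<^sup>2 - (g (snd z) + c)\<^sup>2\<bar> \<partial>edge)"
      using coarea_bound[OF k0 k gc2] by simp
    moreover have "0 \<le> k * E c" using k0 by (simp add: E_def)
    ultimately have "(k * E c)\<^sup>2 \<le> (\<integral>z. \<bar>(g (fst z) + c)\<^sup>2 - (g (snd z) + c)\<^sup>2\<bar> \<partial>edge)\<^sup>2"
      by (rule power_mono)
    also have "\<dots> \<le> (\<integral>z. (g (fst z) + c - (g (snd z) + c))\<^sup>2 \<partial>edge) *
        (2 * ((\<integral>z. (g (fst z) + c)\<^sup>2 \<partial>edge) + (\<integral>z. (g (snd z) + c)\<^sup>2 \<partial>edge)))"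
      by (rule square_difference_integral_le[OF L2_edge[OF gc]])
    also have "\<dots> = D * (4 * (1 + c\<^sup>2))"
      using integral_edge_fst[of "\<lambda>x. (g x + c)\<^sup>2"] integral_edge_snd[of "\<lambda>x. (g x + c)\<^sup>2"]
      by (simp add: D_def sq)
    finally have "(k * E c)\<^sup>2 \<le> 4 * D * (1 + c\<^sup>2)" by (simp add: mult_ac)
    then have "(k * E c)\<^sup>2 / (1 + c\<^sup>2) \<le> 4 * D"
      by (subst pos_divide_le_eq) (auto simp: add_pos_nonneg)
    then show ?thesis by (simp add: power_mult_distrib)
  qed
  have "lawler_sokal_const * k\<^sup>2 \<le> 4 * D"
  \<comment> \<open>The supremum is isolated by dividing by k^2; for k = 0 the claim is just D >=
    0.\<close>
  proof (cases "k = 0")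
    case False
    have "lawler_sokal_const \<le> (SUP c. (E c)\<^sup>2 / (1 + c\<^sup>2))"
      unfolding E_def by (rule lawler_sokal_const_le[OF iid[unfolded N_def], folded N_def])
    also have "\<dots> \<le> 4 * D / k\<^sup>2"
    proof (rule cSUP_least)
      fix c
      show "(E c)\<^sup>2 / (1 + c\<^sup>2) \<le> 4 * D / k\<^sup>2"
        using bound[of c] False by (subst pos_le_divide_eq) (auto simp: mult_ac)
    qed simp
    finally show ?thesis using False by (subst (asm) pos_le_divide_eq) auto
  qed (use D0 in simp)
  then show ?thesis using D by (simp add: field_simps)
qed

lemma lawler_sokal_inequality:
  fixes f :: "'a \<Rightarrow> real"
  assumes k0: "0 \<le> k" and k: "\<And>A. A \<in> sets \<pi> \<Longrightarrow> k * (measure \<pi> A * measure \<pi> (space \<pi> - A)) \<le> flow A"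
    and f: "f \<in> L2_fun \<pi>" and m: "(\<integral>x. f x \<partial>\<pi>) = 0"
  shows "(\<integral>x. f x * markov_op q f x \<partial>\<pi>) \<le> (1 - lawler_sokal_const / 8 * k\<^sup>2) * (\<integral>x. (f x)\<^sup>2 \<partial>\<pi>)"
proof (cases "(\<integral>x. (f x)\<^sup>2 \<partial>\<pi>) = 0")
  case True
  then show ?thesis
    using L2_Cauchy_Schwarz[OF f L2_markov_op[OF f]] by simp
next
  case False
  define s where "s = sqrt (\<integral>x. (f x)\<^sup>2 \<partial>\<pi>)"
  have "0 < (\<integral>x. (f x)\<^sup>2 \<partial>\<pi>)" using False by (simp add: less_le)
  then have s: "s > 0" "s\<^sup>2 = (\<integral>x. (f x)\<^sup>2 \<partial>\<pi>)" by (simp_all add: s_def)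
  let ?g = "\<lambda>x. 1 / s * f x"
  have le: "(\<integral>x. ?g x * markov_op q ?g x \<partial>\<pi>) \<le> 1 - lawler_sokal_const / 8 * k\<^sup>2"
  proof (rule lawler_sokal_normalized[OF k0 k])
    show "(\<integral>x. (?g x)\<^sup>2 \<partial>\<pi>) = 1" using s by (simp add: power_divide flip: s(2))
  qed (use m L2_scale[OF f, of "1 / s"] in auto)
  have eq: "(\<integral>x. ?g x * markov_op q ?g x \<partial>\<pi>) = (\<integral>x. f x * markov_op q f x \<partial>\<pi>) / s\<^sup>2"
    by (simp add: markov_op_def power2_eq_square)
  from le have "(\<integral>x. f x * markov_op q f x \<partial>\<pi>) / s\<^sup>2 \<le> 1 - lawler_sokal_const / 8 * k\<^sup>2" unfolding eq .
  then show ?thesis using s(1) by (simp add: s(2)[symmetric] pos_divide_le_eq)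
qed

end

section \<open>Flow ratios and centered indicators\<close>

lemma (in stationary_kernel) markov_op_lincomb_integral:
  fixes f g h :: "'a \<Rightarrow> real"
  assumes f: "f \<in> L2_fun \<pi>" and g: "g \<in> L2_fun \<pi>" and h: "h \<in> L2_fun \<pi>"
  shows "(\<integral>x. h x * markov_op q (\<lambda>x. a * f x + b * g x) x \<partial>\<pi>)
     = a * (\<integral>x. h x * markov_op q f x \<partial>\<pi>) + b * (\<integral>x. h x * markov_op q g x \<partial>\<pi>)"
proof -
  note [measurable] = L2_funD(1)[OF f] L2_funD(1)[OF g] L2_funD(1)[OF h]
  note i = L2_mult_integrable[OF h L2_markov_op[OF f]] L2_mult_integrable[OF h L2_markov_op[OF g]]
  have "(\<integral>x. h x * markov_op q (\<lambda>x. a * f x + b * g x) x \<partial>\<pi>)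
     = (\<integral>x. a * (h x * markov_op q f x) + b * (h x * markov_op q g x) \<partial>\<pi>)"
    using markov_op_lincomb[OF L2_integrable[OF f] L2_integrable[OF g], of a b]
    by (intro integral_cong_AE) (auto simp: algebra_simps elim!: eventually_mono)
  then show ?thesis using i by simp
qed

context stationary_kernel
begin

text \<open>The idle factors put the function in the shape a * f x + b * g x expected by
  \<open>L2_add\<close>, \<open>L2_scale\<close> and
  \<open>markov_op_lincomb_integral\<close>.\<close>

definition centered :: "'a set \<Rightarrow> 'a \<Rightarrow> real" where
  "centered A = (\<lambda>x. 1 * indicator A x + - measure \<pi> A * 1)"

text \<open>For the last identity: since P 1 = 1 and the centred indicator has mean zero, the
  constant part on the right drops out. What remains starts from the edge mass of A \<times> A,
  which is \<open>\<pi>\<close>(A) minus the flow out of A.\<close>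

lemma
  assumes A[measurable]: "A \<in> sets \<pi>"
  shows centered_L2: "centered A \<in> L2_fun \<pi>"
    and integral_centered: "(\<integral>x. centered A x \<partial>\<pi>) = 0"
    and integral_centered_square: "(\<integral>x. (centered A x)\<^sup>2 \<partial>\<pi>) = measure \<pi> A * measure \<pi> (space \<pi> - A)"
    and flow_centered: "(\<integral>x. centered A x * markov_op q (centered A) x \<partial>\<pi>)
      = measure \<pi> A * measure \<pi> (space \<pi> - A) - flow A"
proof -
  define a where "a = measure \<pi> A"
  have i: "(indicator A :: 'a \<Rightarrow> real) \<in> L2_fun \<pi>" by (rule indicator_L2[OF A])
  show c: "centered A \<in> L2_fun \<pi>" unfolding centered_def by (intro L2_add L2_scale i L2_const)
  note ii = L2_integrable[OF i]
  show z: "(\<integral>x. centered A x \<partial>\<pi>) = 0" using ii by (simp add: centered_def prob_space)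
  have c': "measure \<pi> (space \<pi> - A) = 1 - a" unfolding a_def by (rule prob_compl[OF A])
  have "(\<integral>x. (centered A x)\<^sup>2 \<partial>\<pi>) = (\<integral>x. (1 - 2 * a) * indicator A x + a\<^sup>2 \<partial>\<pi>)"
    by (intro Bochner_Integration.integral_cong) (auto simp: centered_def a_def indicator_def power2_eq_square algebra_simps)
  also have "\<dots> = (1 - 2 * a) * a + a\<^sup>2" using ii by (simp add: prob_space a_def)
  finally show "(\<integral>x. (centered A x)\<^sup>2 \<partial>\<pi>) = measure \<pi> A * measure \<pi> (space \<pi> - A)"
    by (simp add: c' a_def[symmetric] power2_eq_square algebra_simps)
  have one: "(\<integral>x. h x * markov_op q (\<lambda>_. 1) x \<partial>\<pi>) = (\<integral>x. h x \<partial>\<pi>)" for h :: "'a \<Rightarrow> real"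
    by (intro Bochner_Integration.integral_cong refl) (simp add: markov_op_def prob_space.prob_space prob_space_kernel)
  have "(\<integral>x. centered A x * markov_op q (indicator A) x \<partial>\<pi>)
      = (\<integral>x. indicator A x * markov_op q (indicator A) x - a * markov_op q (indicator A) x \<partial>\<pi>)"
    by (intro Bochner_Integration.integral_cong) (auto simp: centered_def a_def algebra_simps)
  also have "\<dots> = measure edge (A \<times> A) - a * a"
    using L2_mult_integrable[OF i L2_markov_op[OF i]] integrable_markov_op[OF ii] integral_markov_op[OF ii]
    by (simp add: integral_prod_indicator[OF A A] a_def)
  also have "\<dots> = a - flow A - a * a"
    using edge_rectangles(1)[OF A] by (simp add: flow_eq_edge[OF A] a_def)
  finally have *: "(\<integral>x. centered A x * markov_op q (indicator A) x \<partial>\<pi>) = a - flow A - a * a" .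
  have "(\<integral>x. centered A x * markov_op q (\<lambda>x. 1 * indicator A x + - a * 1) x \<partial>\<pi>)
     = 1 * (\<integral>x. centered A x * markov_op q (indicator A) x \<partial>\<pi>) + - a * (\<integral>x. centered A x * markov_op q (\<lambda>_. 1) x \<partial>\<pi>)"
    by (rule markov_op_lincomb_integral[OF i L2_const c])
  moreover have "(\<lambda>x. 1 * indicator A x + - a * 1) = centered A" by (simp add: centered_def a_def)
  ultimately have "(\<integral>x. centered A x * markov_op q (centered A) x \<partial>\<pi>) = a - flow A - a * a"
    using * by (simp add: one z)
  then show "(\<integral>x. centered A x * markov_op q (centered A) x \<partial>\<pi>)
      = measure \<pi> A * measure \<pi> (space \<pi> - A) - flow A"
    by (simp add: c' a_def[symmetric] algebra_simps)
qed

text \<open>Cauchy-Schwarz with contractivity. Its lower half, <f, P f> >= -||f||^2, yields the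
  bound 2 on flow ratios and later eliminates a third moment.\<close>

lemma markov_op_form_bound:
  fixes f :: "'a \<Rightarrow> real"
  assumes f: "f \<in> L2_fun \<pi>"
  shows "\<bar>\<integral>x. f x * markov_op q f x \<partial>\<pi>\<bar> \<le> (\<integral>x. (f x)\<^sup>2 \<partial>\<pi>)"
proof (rule abs_le_square_iff[THEN iffD2, of _ "\<integral>x. (f x)\<^sup>2 \<partial>\<pi>", simplified])
  have "(\<integral>x. f x * markov_op q f x \<partial>\<pi>)\<^sup>2 \<le> (\<integral>x. (f x)\<^sup>2 \<partial>\<pi>) * (\<integral>x. (markov_op q f x)\<^sup>2 \<partial>\<pi>)"
    by (rule L2_Cauchy_Schwarz[OF f L2_markov_op[OF f]])
  also have "\<dots> \<le> (\<integral>x. (f x)\<^sup>2 \<partial>\<pi>) * (\<integral>x. (f x)\<^sup>2 \<partial>\<pi>)"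
    by (intro mult_left_mono markov_op_contraction[OF f]) simp
  finally show "(\<integral>x. f x * markov_op q f x \<partial>\<pi>)\<^sup>2 \<le> (\<integral>x. (f x)\<^sup>2 \<partial>\<pi>)\<^sup>2"
    by (simp add: power2_eq_square)
qed

definition flow_ratio :: "'a set \<Rightarrow> real" where
  "flow_ratio A = 1 / (measure \<pi> A * measure \<pi> (space \<pi> - A)) * flow A"

lemma nontrivial_variance_pos:
  "A \<in> nontrivial_events \<pi> \<Longrightarrow> 0 < measure \<pi> A * measure \<pi> (space \<pi> - A)"
  by (simp add: nontrivial_events_def prob_compl)

lemma flow_eq_ratio:
  "A \<in> nontrivial_events \<pi> \<Longrightarrow> flow A = flow_ratio A * (measure \<pi> A * measure \<pi> (space \<pi> - A))"
  using nontrivial_variance_pos[THEN less_imp_neq] by (auto simp: flow_ratio_def)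

lemma flow_nonneg: "A \<in> sets \<pi> \<Longrightarrow> 0 \<le> flow A"
  by (simp add: flow_eq_edge)

lemma flow_ratio_bounds:
  assumes A: "A \<in> nontrivial_events \<pi>"
  shows "0 \<le> flow_ratio A" "flow_ratio A \<le> 2"
proof -
  have As: "A \<in> sets \<pi>" using A by (simp add: nontrivial_events_def)
  note v = nontrivial_variance_pos[OF A]
  show "0 \<le> flow_ratio A" using flow_nonneg[OF As] v by (simp add: flow_ratio_def)
  have "flow A \<le> 2 * (measure \<pi> A * measure \<pi> (space \<pi> - A))"
    using markov_op_form_bound[OF centered_L2[OF As]]
    unfolding integral_centered_square[OF As] flow_centered[OF As] by linarith
  then show "flow_ratio A \<le> 2" using v by (simp add: flow_ratio_def divide_le_eq)
qed

definition flow_inf :: real where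
  "flow_inf = (INF A \<in> nontrivial_events \<pi>. flow_ratio A)"

lemma flow_inf_le: "A \<in> nontrivial_events \<pi> \<Longrightarrow> flow_inf \<le> flow_ratio A"
  unfolding flow_inf_def using flow_ratio_bounds by (intro cINF_lower bdd_belowI[of _ 0]) auto

lemma flow_inf_nonneg: "nontrivial_events \<pi> \<noteq> {} \<Longrightarrow> 0 \<le> flow_inf"
  unfolding flow_inf_def using flow_ratio_bounds by (intro cINF_greatest) auto

text \<open>Events of measure 0 or 1 have to be covered as well, because they occur among the
  superlevel sets in the co-area argument; there the left side vanishes.\<close>

lemma flow_inf_flow:
  assumes A: "A \<in> sets \<pi>"
  shows "flow_inf * (measure \<pi> A * measure \<pi> (space \<pi> - A)) \<le> flow A"
proof (cases "A \<in> nontrivial_events \<pi>")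
  case True
  then show ?thesis
    using flow_inf_le[OF True] nontrivial_variance_pos[OF True]
    by (simp add: flow_eq_ratio[OF True] mult_right_mono del: mult_nonneg_nonneg)
next
  case False
  then have "measure \<pi> A = 0 \<or> measure \<pi> A = 1"
    using A measure_nonneg[of \<pi> A] prob_le_1[of A] by (auto simp: nontrivial_events_def)
  then show ?thesis using flow_nonneg[OF A] by (auto simp: prob_compl[OF A])
qed

lemma flow_inf_spectral_bound:
  fixes f :: "'a \<Rightarrow> real"
  assumes "nontrivial_events \<pi> \<noteq> {}" "f \<in> L2_fun \<pi>" "(\<integral>x. f x \<partial>\<pi>) = 0"
  shows "(\<integral>x. f x * markov_op q f x \<partial>\<pi>) \<le> (1 - lawler_sokal_const / 8 * flow_inf\<^sup>2) * (\<integral>x. (f x)\<^sup>2 \<partial>\<pi>)"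
  using lawler_sokal_inequality[OF flow_inf_nonneg[OF assms(1)] flow_inf_flow assms(2,3)] by simp

end

section \<open>Reversible kernels and the spectral gap\<close>

locale reversible_kernel = stationary_kernel +
  assumes reversible: "reversible \<pi> q"
    and ex_nontrivial: "nontrivial_events \<pi> \<noteq> {}"
begin

lemma distr_edge_swap: "distr edge (\<pi> \<Otimes>\<^sub>M \<pi>) (\<lambda>z. (snd z, fst z)) = edge"
proof -
  have "distr edge (\<pi> \<Otimes>\<^sub>M \<pi>) (\<lambda>z. (snd z, fst z))
     = \<pi> \<bind> (\<lambda>x. distr (distr (q x) (\<pi> \<Otimes>\<^sub>M \<pi>) (\<lambda>y. (x, y))) (\<pi> \<Otimes>\<^sub>M \<pi>) (\<lambda>z. (snd z, fst z)))"
    unfolding edge_def by (rule distr_bind[OF edge_kernel_subprob not_empty]) measurable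
  also have "\<dots> = \<pi> \<bind> (\<lambda>x. distr (q x) (\<pi> \<Otimes>\<^sub>M \<pi>) (\<lambda>y. (y, x)))"
    by (intro bind_cong refl) (auto simp: distr_distr comp_def measurable_q)
  also have "\<dots> = edge" using reversible by (simp add: reversible_def edge_def)
  finally show ?thesis .
qed

text \<open>Self-adjointness is read off the edge measure: swapping its coordinates exchanges the
  roles of f and g.\<close>

lemma markov_op_symmetric:
  fixes f g :: "'a \<Rightarrow> real"
  assumes f: "f \<in> L2_fun \<pi>" and g: "g \<in> L2_fun \<pi>"
  shows "(\<integral>x. f x * markov_op q g x \<partial>\<pi>) = (\<integral>x. markov_op q f x * g x \<partial>\<pi>)"
proof -
  note [measurable] = L2_funD(1)[OF f] L2_funD(1)[OF g]
  have "(\<integral>x. f x * markov_op q g x \<partial>\<pi>) = (\<integral>z. f (fst z) * g (snd z) \<partial>distr edge (\<pi> \<Otimes>\<^sub>M \<pi>) (\<lambda>z. (snd z, fst z)))"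
    by (simp add: integral_edge_product[OF f g] distr_edge_swap)
  also have "\<dots> = (\<integral>z. g (fst z) * f (snd z) \<partial>edge)"
    by (subst integral_distr) (auto simp: mult.commute)
  also have "\<dots> = (\<integral>x. markov_op q f x * g x \<partial>\<pi>)"
    using integral_edge_product[OF g f] by (simp add: mult.commute)
  finally show ?thesis .
qed

lemma markov_op_funpow_L2:
  fixes f :: "'a \<Rightarrow> real"
  shows "f \<in> L2_fun \<pi> \<Longrightarrow> (markov_op q ^^ n) f \<in> L2_fun \<pi>"
  by (induction n) (auto intro: L2_markov_op)

text \<open>Move one factor P across: ||P^(n+1) f||^2 = <P^n f, P^(n+2) f>, then
  Cauchy-Schwarz.\<close>

lemma funpow_norm_log_convex:
  fixes f :: "'a \<Rightarrow> real"
  assumes f: "f \<in> L2_fun \<pi>"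
  shows "(L2_norm \<pi> ((markov_op q ^^ Suc n) f))\<^sup>2
    \<le> L2_norm \<pi> ((markov_op q ^^ n) f) * L2_norm \<pi> ((markov_op q ^^ Suc (Suc n)) f)"
proof -
  let ?u = "\<lambda>n. (markov_op q ^^ n) f"
  note L = markov_op_funpow_L2[OF f]
  have "(L2_norm \<pi> (?u (Suc n)))\<^sup>2 = (\<integral>x. markov_op q (?u n) x * ?u (Suc n) x \<partial>\<pi>)"
    by (simp add: L2_norm_def power2_eq_square)
  also have "\<dots> = (\<integral>x. ?u n x * ?u (Suc (Suc n)) x \<partial>\<pi>)"
    using markov_op_symmetric[OF L[of n] L[of "Suc n"]] by simp
  also have "\<dots> \<le> sqrt ((\<integral>x. (?u n x)\<^sup>2 \<partial>\<pi>) * (\<integral>x. (?u (Suc (Suc n)) x)\<^sup>2 \<partial>\<pi>))"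
    by (rule real_le_rsqrt[OF L2_Cauchy_Schwarz[OF L L]])
  finally show ?thesis by (simp add: L2_norm_def real_sqrt_mult)
qed

end

text \<open>Log-convexity makes the exponents \<open>ln (a n) / n\<close> nondecreasing, as \<open>ln (a 0) = 0\<close>.\<close>

lemma incseq_root_log_convex:
  fixes a :: "nat \<Rightarrow> real"
  assumes nn: "\<And>n. 0 \<le> a n" and a0: "a 0 = 1" and lc: "\<And>n. (a (Suc n))\<^sup>2 \<le> a n * a (Suc (Suc n))"
  shows "incseq (\<lambda>n. root n (a n))"
proof (rule incseq_SucI)
  \<comment> \<open>The comparison of consecutive roots raised to the power n (n + 1). Integer
    powers avoid logarithms, so vanishing terms are allowed.\<close>
  have pw: "a n ^ Suc n \<le> a (Suc n) ^ n" for n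
  proof (induction n)
    case (Suc n)
    show ?case
    proof (cases "a (Suc n) = 0")
      case False
      then have p: "0 < a (Suc n)" using nn[of "Suc n"] by simp
      have "a (Suc n) ^ n * a (Suc n) ^ Suc (Suc n) = ((a (Suc n))\<^sup>2) ^ Suc n"
        by (simp add: power_mult[symmetric] power_add[symmetric] mult_2 del: power_Suc)
      also have "\<dots> \<le> (a n * a (Suc (Suc n))) ^ Suc n" by (intro power_mono lc) simp
      also have "\<dots> = a n ^ Suc n * a (Suc (Suc n)) ^ Suc n" by (rule power_mult_distrib)
      also have "\<dots> \<le> a (Suc n) ^ n * a (Suc (Suc n)) ^ Suc n"
        by (intro mult_right_mono Suc zero_le_power nn)
      finally show ?thesis using p by (simp del: power_Suc)
    qed (use nn in simp)
  qed (simp add: a0)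
  fix n
  \<comment> \<open>The case n = 0 relies on the convention that \<open>root 0\<close> is 0.\<close>
  show "root n (a n) \<le> root (Suc n) (a (Suc n))"
  proof (cases "n = 0")
    case False
    then have n: "0 < n" by simp
    have "root n (a n) = root (Suc n) (root n (a n ^ Suc n))"
      using n nn[of n] by (simp add: real_root_power real_root_power_cancel del: power_Suc)
    also have "\<dots> \<le> root (Suc n) (root n (a (Suc n) ^ n))"
      using n pw[of n] by simp
    also have "\<dots> = root (Suc n) (a (Suc n))"
      using n nn[of "Suc n"] by (simp add: real_root_power_cancel)
    finally show ?thesis .
  qed (use nn in simp)
qed

context reversible_kernel
begin

text \<open>A nondecreasing sequence lies below its limit, so its term at n = 1 gives the one-step
  norm bound. Conversely, the one-step bound iterates on mean-zero functions, and monotonicity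
  provides the limit whose existence the definition demands.\<close>

lemma has_L2_gap_iff:
  "has_L2_gap \<pi> q \<longleftrightarrow> (\<exists>r<1. \<forall>f :: 'a \<Rightarrow> real. f \<in> L2_fun \<pi> \<and> (\<integral>x. f x \<partial>\<pi>) = 0 \<longrightarrow>
     L2_norm \<pi> (markov_op q f) \<le> r * L2_norm \<pi> f)"
proof -
  have inc: "incseq (\<lambda>n. root n (L2_norm \<pi> ((markov_op q ^^ n) f)))"
    if f: "f \<in> L2_fun \<pi>" and v: "(\<integral>x. (f x)\<^sup>2 \<partial>\<pi>) = 1" for f :: "'a \<Rightarrow> real"
    using funpow_norm_log_convex[OF f] v by (intro incseq_root_log_convex) (auto simp: L2_norm_def)
  show ?thesis
  proof
    assume "has_L2_gap \<pi> q"
    then obtain r where r: "r > 0" and lim: "\<And>f :: 'a \<Rightarrow> real. f \<in> L2_fun \<pi> \<Longrightarrow> (\<integral>x. f x \<partial>\<pi>) = 0 \<Longrightarrow>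
       (\<integral>x. (f x)\<^sup>2 \<partial>\<pi>) = 1 \<Longrightarrow> \<exists>l \<le> 1 - r. (\<lambda>n. root n (L2_norm \<pi> ((markov_op q ^^ n) f))) \<longlonglongrightarrow> l"
      unfolding has_L2_gap_def by blast
    have "L2_norm \<pi> (markov_op q f) \<le> (1 - r) * L2_norm \<pi> f"
      if f: "f \<in> L2_fun \<pi>" and m: "(\<integral>x. f x \<partial>\<pi>) = 0" for f :: "'a \<Rightarrow> real"
    proof (cases "(\<integral>x. (f x)\<^sup>2 \<partial>\<pi>) = 0")
      case True
      have "(\<integral>x. (markov_op q f x)\<^sup>2 \<partial>\<pi>) \<le> 0" using markov_op_contraction[OF f] True by simp
      moreover have "0 \<le> (\<integral>x. (markov_op q f x)\<^sup>2 \<partial>\<pi>)" by simp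
      ultimately show ?thesis using True by (simp add: L2_norm_def)
    next
      case False
      define s where "s = L2_norm \<pi> f"
      have "0 < (\<integral>x. (f x)\<^sup>2 \<partial>\<pi>)" using False by (simp add: less_le)
      then have s: "s > 0" "s\<^sup>2 = (\<integral>x. (f x)\<^sup>2 \<partial>\<pi>)" by (simp_all add: s_def L2_norm_def)
      let ?g = "\<lambda>x. 1 / s * f x"
      have g: "?g \<in> L2_fun \<pi>" "(\<integral>x. ?g x \<partial>\<pi>) = 0" using L2_scale[OF f, of "1 / s"] m by auto
      have gv: "(\<integral>x. (?g x)\<^sup>2 \<partial>\<pi>) = 1" using s by (simp add: power_divide flip: s(2))
      from lim[OF g gv] obtain l where l: "l \<le> 1 - r" "(\<lambda>n. root n (L2_norm \<pi> ((markov_op q ^^ n) ?g))) \<longlonglongrightarrow> l"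
        by auto
      have "root 1 (L2_norm \<pi> ((markov_op q ^^ 1) ?g)) \<le> l"
        by (rule incseq_le[OF inc[OF g(1) gv] l(2)])
      then have le: "L2_norm \<pi> (markov_op q ?g) \<le> 1 - r" using l(1) by simp
      have "markov_op q ?g = (\<lambda>x. markov_op q f x / s)" by (simp add: markov_op_def)
      then have "L2_norm \<pi> (markov_op q ?g) = L2_norm \<pi> (markov_op q f) / s"
        using s(1) by (simp add: L2_norm_def power_divide real_sqrt_divide)
      with le show ?thesis using s(1) by (simp add: s_def[symmetric] pos_divide_le_eq)
    qed
    then show "\<exists>r<1. \<forall>f :: 'a \<Rightarrow> real. f \<in> L2_fun \<pi> \<and> (\<integral>x. f x \<partial>\<pi>) = 0 \<longrightarrow>
       L2_norm \<pi> (markov_op q f) \<le> r * L2_norm \<pi> f"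
      using r by (intro exI[of _ "1 - r"]) auto
  next
    assume "\<exists>r<1. \<forall>f :: 'a \<Rightarrow> real. f \<in> L2_fun \<pi> \<and> (\<integral>x. f x \<partial>\<pi>) = 0 \<longrightarrow>
       L2_norm \<pi> (markov_op q f) \<le> r * L2_norm \<pi> f"
    then obtain r where r: "r < 1" and le: "\<And>f :: 'a \<Rightarrow> real. f \<in> L2_fun \<pi> \<Longrightarrow> (\<integral>x. f x \<partial>\<pi>) = 0 \<Longrightarrow>
       L2_norm \<pi> (markov_op q f) \<le> r * L2_norm \<pi> f" by blast
    \<comment> \<open>The constant r may be negative; the powers of the rate must dominate
      norms.\<close>
    define \<rho> where "\<rho> = max 0 r"
    have rho: "0 \<le> \<rho>" "\<rho> < 1" "r \<le> \<rho>" using r by (auto simp: \<rho>_def)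
    have "\<exists>l \<le> 1 - (1 - \<rho>). (\<lambda>n. root n (L2_norm \<pi> ((markov_op q ^^ n) f))) \<longlonglongrightarrow> l"
      if f: "f \<in> L2_fun \<pi>" and m: "(\<integral>x. f x \<partial>\<pi>) = 0" and v: "(\<integral>x. (f x)\<^sup>2 \<partial>\<pi>) = 1" for f :: "'a \<Rightarrow> real"
    proof -
      have mean: "(\<integral>x. (markov_op q ^^ n) f x \<partial>\<pi>) = 0" for n
        by (induction n) (simp_all add: m integral_markov_op L2_integrable markov_op_funpow_L2[OF f])
      have nb: "L2_norm \<pi> ((markov_op q ^^ n) f) \<le> \<rho> ^ n" for n
      proof (induction n)
        case (Suc n)
        have "L2_norm \<pi> ((markov_op q ^^ Suc n) f) \<le> r * L2_norm \<pi> ((markov_op q ^^ n) f)"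
          using le[OF markov_op_funpow_L2[OF f] mean] by simp
        also have "\<dots> \<le> \<rho> * \<rho> ^ n" using rho Suc by (intro mult_mono) (auto simp: L2_norm_def)
        finally show ?case by simp
      qed (simp add: L2_norm_def v)
      have rb: "root n (L2_norm \<pi> ((markov_op q ^^ n) f)) \<le> \<rho>" for n
      proof (cases "n = 0")
        case False
        then have n: "0 < n" by simp
        have "root n (L2_norm \<pi> ((markov_op q ^^ n) f)) \<le> root n (\<rho> ^ n)" using nb n by simp
        also have "\<dots> = \<rho>" using n rho by (simp add: real_root_power_cancel)
        finally show ?thesis .
      qed (use rho in simp)
      obtain l where l: "(\<lambda>n. root n (L2_norm \<pi> ((markov_op q ^^ n) f))) \<longlonglongrightarrow> l"
        using incseq_convergent[OF inc[OF f v], of \<rho>] rb by blast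
      moreover have "l \<le> \<rho>" using LIMSEQ_le_const2[OF l, of \<rho>] rb by blast
      ultimately show ?thesis by auto
    qed
    then show "has_L2_gap \<pi> q"
      unfolding has_L2_gap_def using rho by (intro exI[of _ "1 - \<rho>"]) auto
  qed
qed

end

section \<open>The two-step kernel\<close>

context reversible_kernel
begin

text \<open>Everything proved for a stationary kernel becomes available for P^2, including the
  Lawler-Sokal inequality; \<open>two.flow_inf\<close> is k_2.\<close>

sublocale two: stationary_kernel \<pi> "\<lambda>x. q x \<bind> q"
proof
  show "(\<lambda>x. q x \<bind> q) \<in> \<pi> \<rightarrow>\<^sub>M prob_algebra \<pi>"
    by (rule measurable_bind_prob_space[OF kernel kernel])
  show "\<pi> \<bind> (\<lambda>x. q x \<bind> q) = \<pi>"
    using bind_assoc[OF kernel_subprob kernel_subprob] by (simp add: stationary)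
qed

lemma markov_op_two:
  fixes f :: "'a \<Rightarrow> real"
  assumes f: "integrable \<pi> f"
  shows "AE x in \<pi>. markov_op (\<lambda>x. q x \<bind> q) f x = markov_op q (markov_op q f) x"
  using two.AE_integrable_kernel[OF f]
proof (rule AE_mp, intro AE_I2 impI)
  fix x assume x: "x \<in> space \<pi>" and i: "integrable (q x \<bind> q) f"
  have "q \<in> q x \<rightarrow>\<^sub>M prob_algebra \<pi>" using x kernel by (rule measurable_q)
  from integral_bind_real[OF this i] f
  show "markov_op (\<lambda>x. q x \<bind> q) f x = markov_op q (markov_op q f) x"
    by (simp add: markov_op_def)
qed

text \<open>Self-adjointness turns <f, P^2 f> into ||P f||^2, so a form bound for the two-step
  kernel is a norm bound for P.\<close>

lemma two_step_form:
  fixes f :: "'a \<Rightarrow> real"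
  assumes f: "f \<in> L2_fun \<pi>"
  shows "(\<integral>x. f x * markov_op (\<lambda>x. q x \<bind> q) f x \<partial>\<pi>) = (\<integral>x. (markov_op q f x)\<^sup>2 \<partial>\<pi>)"
proof -
  have [measurable]: "f \<in> borel_measurable \<pi>" using L2_funD(1)[OF f] .
  have "(\<integral>x. f x * markov_op (\<lambda>x. q x \<bind> q) f x \<partial>\<pi>) = (\<integral>x. f x * markov_op q (markov_op q f) x \<partial>\<pi>)"
    using markov_op_two[OF L2_integrable[OF f]]
    by (intro integral_cong_AE) (auto elim!: eventually_mono intro!: borel_measurable_times two.measurable_markov_op)
  also have "\<dots> = (\<integral>x. (markov_op q f x)\<^sup>2 \<partial>\<pi>)"
    using markov_op_symmetric[OF f L2_markov_op[OF f]] by (simp add: power2_eq_square)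
  finally show ?thesis .
qed

lemma iso_ratio_one:
  assumes A: "A \<in> sets \<pi>"
  shows "iso_ratio \<pi> q 1 A = flow_ratio A"
proof -
  have "(LINT x:A|\<pi>. measure (kernel_power \<pi> q 1 x) (space \<pi> - A)) = flow A"
    unfolding flow_def using A sets.sets_into_space[OF A]
    by (intro set_lebesgue_integral_cong) (auto simp: bind_return[OF kernel_subprob])
  then show ?thesis by (simp add: iso_ratio_def flow_ratio_def)
qed

lemma iso_ratio_two:
  assumes A: "A \<in> sets \<pi>"
  shows "iso_ratio \<pi> q 2 A = two.flow_ratio A"
proof -
  have "(LINT x:A|\<pi>. measure (kernel_power \<pi> q 2 x) (space \<pi> - A)) = two.flow A"
    unfolding two.flow_def using A sets.sets_into_space[OF A]
    by (intro set_lebesgue_integral_cong) (auto simp: numeral_2_eq_2 bind_return[OF kernel_subprob])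
  then show ?thesis by (simp add: iso_ratio_def two.flow_ratio_def)
qed

lemma iso_inf_one: "iso_inf \<pi> q 1 = flow_inf"
  unfolding iso_inf_def flow_inf_def
  by (intro INF_cong refl iso_ratio_one) (simp add: nontrivial_events_def)

lemma iso_inf_two: "iso_inf \<pi> q 2 = two.flow_inf"
  unfolding iso_inf_def two.flow_inf_def
  by (intro INF_cong refl iso_ratio_two) (simp add: nontrivial_events_def)

lemma
  shows flow_ratio_le_iso_sup: "A \<in> nontrivial_events \<pi> \<Longrightarrow> flow_ratio A \<le> iso_sup \<pi> q"
    and iso_sup_least: "(\<And>A. A \<in> nontrivial_events \<pi> \<Longrightarrow> flow_ratio A \<le> c) \<Longrightarrow> iso_sup \<pi> q \<le> c"
proof -
  have eq: "iso_sup \<pi> q = (SUP A \<in> nontrivial_events \<pi>. flow_ratio A)"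
    unfolding iso_sup_def by (intro SUP_cong refl iso_ratio_one) (simp add: nontrivial_events_def)
  show "A \<in> nontrivial_events \<pi> \<Longrightarrow> flow_ratio A \<le> iso_sup \<pi> q"
    unfolding eq using flow_ratio_bounds by (intro cSUP_upper bdd_aboveI[of _ 2]) auto
  show "(\<And>A. A \<in> nontrivial_events \<pi> \<Longrightarrow> flow_ratio A \<le> c) \<Longrightarrow> iso_sup \<pi> q \<le> c"
    unfolding eq using ex_nontrivial by (intro cSUP_least) auto
qed

lemma flow_inf_le_iso_sup: "flow_inf \<le> iso_sup \<pi> q"
  using ex_nontrivial flow_inf_le flow_ratio_le_iso_sup by (meson all_not_in_conv order_trans)

lemma flow_ratio_form:
  assumes A: "A \<in> nontrivial_events \<pi>"
  defines "S \<equiv> measure \<pi> A * measure \<pi> (space \<pi> - A)"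
  shows "(\<integral>x. centered A x * markov_op q (centered A) x \<partial>\<pi>) = (1 - flow_ratio A) * S"
    and "(\<integral>x. (markov_op q (centered A) x)\<^sup>2 \<partial>\<pi>) = (1 - two.flow_ratio A) * S"
proof -
  have As: "A \<in> sets \<pi>" using A by (simp add: nontrivial_events_def)
  show "(\<integral>x. centered A x * markov_op q (centered A) x \<partial>\<pi>) = (1 - flow_ratio A) * S"
    using flow_centered[OF As] flow_eq_ratio[OF A] by (simp add: S_def left_diff_distrib)
  show "(\<integral>x. (markov_op q (centered A) x)\<^sup>2 \<partial>\<pi>) = (1 - two.flow_ratio A) * S"
    using two_step_form[OF centered_L2[OF As]] two.flow_centered[OF As] two.flow_eq_ratio[OF A]
    by (simp add: S_def left_diff_distrib two.centered_def centered_def)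
qed

text \<open>
  For \<open>f = 1\<^sub>A - \<pi>(A)\<close> with small two-step flow, \<open>P\<^sup>2 f\<close> is close to \<open>f\<close>, hence \<open>h = f + P f\<close> is
  almost invariant. The one-step gap then forces \<open>h\<close> to be small, that is \<open>P f\<close> close to \<open>- f\<close>,
  which is excluded by \<open>K < 2\<close>.
\<close>

lemma two_step_flow_ratio_ge:
  assumes A: "A \<in> nontrivial_events \<pi>"
  shows "lawler_sokal_const / 8 * flow_inf\<^sup>2 * (4 - 2 * flow_ratio A - two.flow_ratio A) \<le> 2 * two.flow_ratio A"
proof -
  have As: "A \<in> sets \<pi>" using A by (simp add: nontrivial_events_def)
  define S where "S = measure \<pi> A * measure \<pi> (space \<pi> - A)"
  have S: "0 < S" unfolding S_def by (rule nontrivial_variance_pos[OF A])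
  define f g where "f = centered A" and "g = markov_op q f"
  have f: "f \<in> L2_fun \<pi>" unfolding f_def by (rule centered_L2[OF As])
  have g: "g \<in> L2_fun \<pi>" unfolding g_def by (rule L2_markov_op[OF f])
  note Pg = L2_markov_op[OF g]
  define ip where "ip u v = (\<integral>x. u x * v x \<partial>\<pi>)" for u v :: "'a \<Rightarrow> real"
  have ipadd: "ip (\<lambda>x. a * u x + b * v x) w = a * ip u w + b * ip v w"
    if u: "u \<in> L2_fun \<pi>" and v: "v \<in> L2_fun \<pi>" and w: "w \<in> L2_fun \<pi>" for u v w a b
    using L2_mult_integrable[OF u w] L2_mult_integrable[OF v w] by (simp add: ip_def distrib_right mult.assoc)
  have comm: "ip u v = ip v u" for u v by (simp add: ip_def mult.commute)
  have form: "ip (\<lambda>x. a * f x + b * g x) (markov_op q (\<lambda>x. a * f x + b * g x))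
      = a * a * ip f g + 2 * a * b * ip g g + b * b * ip g (markov_op q g)" for a b
  proof -
    have h: "(\<lambda>x. a * f x + b * g x) \<in> L2_fun \<pi>" by (intro L2_add L2_scale f g)
    have "ip (\<lambda>x. a * f x + b * g x) (markov_op q (\<lambda>x. a * f x + b * g x))
       = a * ip (\<lambda>x. a * f x + b * g x) g + b * ip (\<lambda>x. a * f x + b * g x) (markov_op q g)"
      using markov_op_lincomb_integral[OF f g h] by (simp add: ip_def g_def)
    also have "\<dots> = a * (a * ip f g + b * ip g g) + b * (a * ip f (markov_op q g) + b * ip g (markov_op q g))"
      by (simp add: ipadd f g Pg)
    also have "ip f (markov_op q g) = ip g g"
      using markov_op_symmetric[OF f g] by (simp add: ip_def g_def)
    finally show ?thesis by (simp add: algebra_simps)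
  qed
  have square: "(\<integral>x. (a * f x + b * g x)\<^sup>2 \<partial>\<pi>) = a * a * ip f f + 2 * a * b * ip f g + b * b * ip g g" for a b
  proof -
    have h: "(\<lambda>x. a * f x + b * g x) \<in> L2_fun \<pi>" by (intro L2_add L2_scale f g)
    have "(\<integral>x. (a * f x + b * g x)\<^sup>2 \<partial>\<pi>) = ip (\<lambda>x. a * f x + b * g x) (\<lambda>x. a * f x + b * g x)"
      by (simp add: ip_def power2_eq_square)
    also have "\<dots> = a * ip (\<lambda>x. a * f x + b * g x) f + b * ip (\<lambda>x. a * f x + b * g x) g"
      unfolding ipadd[OF f g h] by (simp add: comm)
    also have "\<dots> = a * a * ip f f + 2 * a * b * ip f g + b * b * ip g g"
      unfolding ipadd[OF f g f] ipadd[OF f g g] by (simp add: comm[of g f] algebra_simps)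
    finally show ?thesis .
  qed
  have ff: "ip f f = S"
    using integral_centered_square[OF As] by (simp add: ip_def f_def S_def power2_eq_square)
  have fg: "ip f g = (1 - flow_ratio A) * S" and gg: "ip g g = (1 - two.flow_ratio A) * S"
    using flow_ratio_form[OF A] by (simp_all add: ip_def f_def g_def S_def power2_eq_square)
  have mean: "(\<integral>x. 1 * f x + 1 * g x \<partial>\<pi>) = 0"
    using integral_centered[OF As] integral_markov_op[OF L2_integrable[OF f]] L2_integrable[OF f] L2_integrable[OF g]
    by (simp add: f_def g_def)
  have "(\<lambda>x. 1 * f x + 1 * g x) \<in> L2_fun \<pi>" by (intro L2_add L2_scale f g)
  from flow_inf_spectral_bound[OF ex_nontrivial this mean]
  have gap: "ip f g + 2 * ip g g + ip g (markov_op q g)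
      \<le> (1 - lawler_sokal_const / 8 * flow_inf\<^sup>2) * (ip f f + 2 * ip f g + ip g g)"
    using form[of 1 1] square[of 1 1] by (simp add: ip_def)
  \<comment> \<open>The inequality \<open>gap\<close> contains <g, P g>, the third moment <f, P^3
    f>. The lower form bound at f - g gives <g, P g> >= <f, g> + <g, g> - <f, f>, which eliminates
    it and leaves 2 (<f, f> - <g, g>) on the right.\<close>
  have "(\<lambda>x. 1 * f x + - 1 * g x) \<in> L2_fun \<pi>" by (intro L2_add L2_scale f g)
  from markov_op_form_bound[OF this]
  have "0 \<le> (ip f f - 2 * ip f g + ip g g) + (ip f g - 2 * ip g g + ip g (markov_op q g))"
    using form[of 1 "-1"] square[of 1 "-1"] by (simp add: ip_def)
  with gap have "lawler_sokal_const / 8 * flow_inf\<^sup>2 * (ip f f + 2 * ip f g + ip g g) \<le> 2 * (ip f f - ip g g)"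
    by (simp add: left_diff_distrib)
  then have "lawler_sokal_const / 8 * flow_inf\<^sup>2 * (4 - 2 * flow_ratio A - two.flow_ratio A) * S \<le> 2 * two.flow_ratio A * S"
    unfolding ff fg gg by (simp add: algebra_simps)
  then show ?thesis using S by simp
qed

text \<open>The uniform bound 1/2 passes to the infimum only if some admissible pair exists;
  independent copies of a normalised centred indicator supply one.\<close>

lemma lawler_sokal_const_ge: "1 / 2 \<le> lawler_sokal_const"
proof -
  obtain A where A: "A \<in> nontrivial_events \<pi>" using ex_nontrivial by blast
  then have As: "A \<in> sets \<pi>" by (simp add: nontrivial_events_def)
  define S where "S = measure \<pi> A * measure \<pi> (space \<pi> - A)"
  have S: "0 < S" unfolding S_def by (rule nontrivial_variance_pos[OF A])
  let ?g = "\<lambda>x. 1 / sqrt S * centered A x"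
  have "?g \<in> L2_fun \<pi>" by (rule L2_scale[OF centered_L2[OF As]])
  moreover have "(\<integral>x. ?g x \<partial>\<pi>) = 0" by (simp add: integral_centered[OF As])
  moreover have "(\<integral>x. (?g x)\<^sup>2 \<partial>\<pi>) = 1"
    using S by (simp add: power_divide integral_centered_square[OF As, folded S_def])
  ultimately have "iid_standardized (distr \<pi> borel ?g \<Otimes>\<^sub>M distr \<pi> borel ?g) fst snd"
    by (rule iid_standardized_distr)
  then have "{(N :: (real \<times> real) measure, X, Y). iid_standardized N X Y} \<noteq> {}" by blast
  then show ?thesis
    unfolding lawler_sokal_const_def using iid_functional_SUP_ge by (intro cINF_greatest) auto
qed

text \<open>Since \<kappa> / 8 >= 1/16, the preceding inequality becomes k^2 (4 - 2 k(A) - k_2(A))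
  <= 32 k_2(A). Moving k^2 k_2(A) <= 4 k_2(A) to the right gives 2 k^2 (2 - k(A)) <= 36 k_2(A),
  hence 18.\<close>

lemma two_step_flow_inf_ge: "flow_inf\<^sup>2 * (2 - iso_sup \<pi> q) / 18 \<le> two.flow_inf"
  unfolding two.flow_inf_def
proof (rule cINF_greatest[OF ex_nontrivial])
  fix A assume A: "A \<in> nontrivial_events \<pi>"
  define \<eta> where "\<eta> = two.flow_ratio A"
  have eta: "0 \<le> \<eta>" unfolding \<eta>_def by (rule two.flow_ratio_bounds[OF A])
  have k: "0 \<le> flow_inf" by (rule flow_inf_nonneg[OF ex_nontrivial])
  have k2: "flow_inf \<le> 2" using flow_inf_le[OF A] flow_ratio_bounds(2)[OF A] by linarith
  have "flow_inf * flow_inf \<le> 2 * 2" using k k2 by (intro mult_mono) auto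
  then have ksq: "flow_inf\<^sup>2 \<le> 4" by (simp add: power2_eq_square)
  let ?d = "4 - 2 * flow_ratio A - \<eta>"
  have *: "flow_inf\<^sup>2 * ?d \<le> 32 * \<eta>"
  \<comment> \<open>Replacing \<kappa> by its lower bound is monotone only if its factor is
    nonnegative; otherwise the left side is at most 0.\<close>
  proof (cases "0 \<le> ?d")
    case True
    have "1 / 16 * (flow_inf\<^sup>2 * ?d) \<le> lawler_sokal_const / 8 * (flow_inf\<^sup>2 * ?d)"
      using lawler_sokal_const_ge True by (intro mult_right_mono) auto
    also have "\<dots> \<le> 2 * \<eta>" using two_step_flow_ratio_ge[OF A] by (simp add: \<eta>_def mult.assoc)
    finally show ?thesis by simp
  next
    case False
    then have "flow_inf\<^sup>2 * ?d \<le> 0" by (intro mult_nonneg_nonpos) auto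
    with eta show ?thesis by linarith
  qed
  have "flow_inf\<^sup>2 * (2 - iso_sup \<pi> q) \<le> flow_inf\<^sup>2 * (2 - flow_ratio A)"
    using flow_ratio_le_iso_sup[OF A] by (intro mult_left_mono) auto
  moreover have "flow_inf\<^sup>2 * \<eta> \<le> 4 * \<eta>" using ksq eta by (rule mult_right_mono)
  moreover have "flow_inf\<^sup>2 * ?d = 2 * (flow_inf\<^sup>2 * (2 - flow_ratio A)) - flow_inf\<^sup>2 * \<eta>"
    by (simp add: algebra_simps)
  ultimately show "flow_inf\<^sup>2 * (2 - iso_sup \<pi> q) / 18 \<le> two.flow_ratio A"
    using * unfolding \<eta>_def by linarith
qed

end

section \<open>Inverting the shifted Markov operator on complex functions\<close>

lemma L2_norm_nonneg: "0 \<le> L2_norm \<mu> f"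
  by (simp add: L2_norm_def)

lemma L2_norm_square: "(L2_norm \<mu> f)\<^sup>2 = (\<integral>x. (norm (f x))\<^sup>2 \<partial>\<mu>)"
  by (simp add: L2_norm_def)

lemma L2_norm_norm: "L2_norm \<mu> (\<lambda>x. norm (f x)) = L2_norm \<mu> f"
  by (simp add: L2_norm_def)

lemma L2_fun_norm: "f \<in> L2_fun \<mu> \<Longrightarrow> (\<lambda>x. norm (f x)) \<in> L2_fun \<mu>"
  by (auto simp: L2_fun_def)

lemma L2_norm_triangle:
  fixes f g :: "'a \<Rightarrow> real"
  assumes f: "f \<in> L2_fun \<mu>" and g: "g \<in> L2_fun \<mu>"
  shows "L2_norm \<mu> (\<lambda>x. f x + g x) \<le> L2_norm \<mu> f + L2_norm \<mu> g"
proof -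
  have i: "integrable \<mu> (\<lambda>x. (f x)\<^sup>2)" "integrable \<mu> (\<lambda>x. (g x)\<^sup>2)" "integrable \<mu> (\<lambda>x. f x * g x)"
    using f g L2_mult_integrable[OF f g] by (auto simp: L2_real_iff)
  have "(\<integral>x. f x * g x \<partial>\<mu>) \<le> sqrt ((\<integral>x. (f x)\<^sup>2 \<partial>\<mu>) * (\<integral>x. (g x)\<^sup>2 \<partial>\<mu>))"
    by (rule real_le_rsqrt[OF L2_Cauchy_Schwarz[OF f g]])
  then have "(\<integral>x. f x * g x \<partial>\<mu>) \<le> L2_norm \<mu> f * L2_norm \<mu> g"
    by (simp add: L2_norm_def real_sqrt_mult)
  moreover have "(L2_norm \<mu> (\<lambda>x. f x + g x))\<^sup>2 = (\<integral>x. (f x)\<^sup>2 + (g x)\<^sup>2 + 2 * (f x * g x) \<partial>\<mu>)"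
    by (simp add: L2_norm_square power2_sum mult.assoc)
  moreover have "\<dots> = (L2_norm \<mu> f)\<^sup>2 + (L2_norm \<mu> g)\<^sup>2 + 2 * (\<integral>x. f x * g x \<partial>\<mu>)"
    using i by (simp add: L2_norm_square)
  ultimately have "(L2_norm \<mu> (\<lambda>x. f x + g x))\<^sup>2 \<le> (L2_norm \<mu> f + L2_norm \<mu> g)\<^sup>2"
    by (simp add: power2_sum)
  then show ?thesis by (rule power2_le_imp_le) (simp add: L2_norm_nonneg add_nonneg_nonneg)
qed

lemma L2_norm_mono_AE:
  fixes f :: "'a \<Rightarrow> 'b::{banach, second_countable_topology}" and g :: "'a \<Rightarrow> real"
  assumes f: "f \<in> borel_measurable \<mu>" and g: "g \<in> L2_fun \<mu>" and le: "AE x in \<mu>. norm (f x) \<le> g x"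
  shows "f \<in> L2_fun \<mu>" "L2_norm \<mu> f \<le> L2_norm \<mu> g"
proof -
  note [measurable] = f L2_funD(1)[OF g]
  have gi: "integrable \<mu> (\<lambda>x. (g x)\<^sup>2)" using g by (simp add: L2_real_iff)
  have sq: "AE x in \<mu>. (norm (f x))\<^sup>2 \<le> (g x)\<^sup>2"
    using le by eventually_elim (simp add: power_mono)
  have fi: "integrable \<mu> (\<lambda>x. (norm (f x))\<^sup>2)"
    using gi by (rule Bochner_Integration.integrable_bound) (use sq in \<open>auto elim!: eventually_mono\<close>)
  then show "f \<in> L2_fun \<mu>" using f by (simp add: L2_fun_def)
  show "L2_norm \<mu> f \<le> L2_norm \<mu> g"
    using integral_mono_AE[OF fi gi sq] by (simp add: L2_norm_def)
qed

lemma L2_sum: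
  fixes u :: "nat \<Rightarrow> 'a \<Rightarrow> real"
  assumes u: "\<And>n. u n \<in> L2_fun \<mu>"
  shows "(\<lambda>x. \<Sum>n<N. u n x) \<in> L2_fun \<mu>"
    and "L2_norm \<mu> (\<lambda>x. \<Sum>n<N. u n x) \<le> (\<Sum>n<N. L2_norm \<mu> (u n))"
proof (induction N)
  case 0
  show "(\<lambda>x. \<Sum>n<0. u n x) \<in> L2_fun \<mu>" "L2_norm \<mu> (\<lambda>x. \<Sum>n<0. u n x) \<le> (\<Sum>n<0. L2_norm \<mu> (u n))"
    by (simp_all add: L2_real_iff L2_norm_def)
next
  case (Suc N)
  show "(\<lambda>x. \<Sum>n<Suc N. u n x) \<in> L2_fun \<mu>" using L2_add[OF Suc(1) u[of N]] by simp
  show "L2_norm \<mu> (\<lambda>x. \<Sum>n<Suc N. u n x) \<le> (\<Sum>n<Suc N. L2_norm \<mu> (u n))"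
    using L2_norm_triangle[OF Suc(1) u[of N]] Suc(2) by simp
qed

text \<open>The concrete form of completeness used here. The triangle inequality bounds the partial
  sums in norm; monotone convergence of their squares gives almost-everywhere finiteness, hence
  summability, and square-integrability of the sum.\<close>

lemma (in prob_space) L2_geometric_series:
  fixes u :: "nat \<Rightarrow> 'a \<Rightarrow> real"
  assumes u: "\<And>n. u n \<in> L2_fun M" and pos: "\<And>n x. 0 \<le> u n x"
    and bound: "\<And>n. L2_norm M (u n) \<le> C * \<rho> ^ n" and rho: "0 \<le> \<rho>" "\<rho> < 1"
  shows "AE x in M. summable (\<lambda>n. u n x)" and "(\<lambda>x. \<Sum>n. u n x) \<in> L2_fun M"
proof -
  have um[measurable]: "u n \<in> borel_measurable M" for n using L2_funD(1)[OF u] .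
  have "0 \<le> C" using bound[of 0] L2_norm_nonneg[of M "u 0"] by simp
  have geo: "(\<Sum>n<N. L2_norm M (u n)) \<le> C / (1 - \<rho>)" for N
  proof -
    have "(\<Sum>n<N. L2_norm M (u n)) \<le> (\<Sum>n<N. C * \<rho> ^ n)" by (intro sum_mono bound)
    also have "\<dots> \<le> (\<Sum>n. C * \<rho> ^ n)"
      using rho \<open>0 \<le> C\<close> by (intro sum_le_suminf summable_mult summable_geometric) auto
    also have "\<dots> = C / (1 - \<rho>)"
      using rho by (simp add: suminf_mult summable_geometric suminf_geometric)
    finally show ?thesis .
  qed
  define B where "B = C / (1 - \<rho>)"
  define s where "s N x = (\<Sum>n<N. u n x)" for N x
  have s: "s N \<in> L2_fun M" "L2_norm M (s N) \<le> B" for N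
    using L2_sum(1)[where u = u and N = N, OF u] order_trans[OF L2_sum(2)[where u = u and N = N, OF u] geo[of N]]
    by (simp_all add: s_def[abs_def] B_def)
  have sm[measurable]: "s N \<in> borel_measurable M" for N using L2_funD(1)[OF s(1)] .
  have sn: "(\<integral>\<^sup>+x. ennreal ((s N x)\<^sup>2) \<partial>M) \<le> ennreal (B\<^sup>2)" for N
  proof -
    have "integrable M (\<lambda>x. (s N x)\<^sup>2)" using s(1)[of N] by (simp add: L2_real_iff)
    then have "(\<integral>\<^sup>+x. ennreal ((s N x)\<^sup>2) \<partial>M) = ennreal ((L2_norm M (s N))\<^sup>2)"
      by (simp add: nn_integral_eq_integral L2_norm_square)
    also have "\<dots> \<le> ennreal (B\<^sup>2)"
      using s(2)[of N] by (intro ennreal_leI power_mono L2_norm_nonneg)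
    finally show ?thesis .
  qed
  have inc: "incseq (\<lambda>N x. ennreal ((s N x)\<^sup>2))"
    by (auto simp: incseq_def le_fun_def s_def intro!: ennreal_leI power_mono sum_mono2 sum_nonneg pos)
  have "(\<integral>\<^sup>+x. (SUP N. ennreal ((s N x)\<^sup>2)) \<partial>M) \<le> ennreal (B\<^sup>2)"
    by (subst nn_integral_monotone_convergence_SUP[OF inc]) (auto intro!: SUP_least sn)
  then have "(\<integral>\<^sup>+x. (SUP N. ennreal ((s N x)\<^sup>2)) \<partial>M) \<noteq> \<infinity>" by (auto simp: top_unique)
  then have "AE x in M. (SUP N. ennreal ((s N x)\<^sup>2)) \<noteq> \<infinity>"
    by (intro nn_integral_noteq_infinite) auto
  then show sums: "AE x in M. summable (\<lambda>n. u n x)"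
  proof eventually_elim
    case (elim x)
    then obtain b where b: "0 \<le> b" "(SUP N. ennreal ((s N x)\<^sup>2)) = ennreal b"
      by (cases "SUP N. ennreal ((s N x)\<^sup>2)" rule: ennreal_cases) auto
    have "ennreal ((s N x)\<^sup>2) \<le> ennreal b" for N
      unfolding b(2)[symmetric] by (rule SUP_upper) simp
    then have "(s N x)\<^sup>2 \<le> b" for N using b(1) by simp
    then have "s N x \<le> sqrt b" for N by (rule real_le_rsqrt)
    then show "summable (\<lambda>n. u n x)"
      using pos by (intro summableI_nonneg_bounded[of _ "sqrt b"]) (auto simp: s_def)
  qed
  have [measurable]: "(\<lambda>x. \<Sum>n. u n x) \<in> borel_measurable M" by measurable
  have "AE x in M. ennreal ((\<Sum>n. u n x)\<^sup>2) = (SUP N. ennreal ((s N x)\<^sup>2))"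
    using sums
  proof eventually_elim
    case (elim x)
    have "(\<lambda>N. ennreal ((s N x)\<^sup>2)) \<longlonglongrightarrow> ennreal ((\<Sum>n. u n x)\<^sup>2)"
      unfolding s_def using summable_LIMSEQ[OF elim] by (intro tendsto_ennrealI tendsto_power)
    moreover have "(\<lambda>N. ennreal ((s N x)\<^sup>2)) \<longlonglongrightarrow> (SUP N. ennreal ((s N x)\<^sup>2))"
      using inc by (intro LIMSEQ_SUP) (auto simp: incseq_def le_fun_def)
    ultimately show ?case by (rule LIMSEQ_unique)
  qed
  then have "(\<integral>\<^sup>+x. ennreal ((\<Sum>n. u n x)\<^sup>2) \<partial>M) \<le> ennreal (B\<^sup>2)"
    using \<open>(\<integral>\<^sup>+x. (SUP N. ennreal ((s N x)\<^sup>2)) \<partial>M) \<le> ennreal (B\<^sup>2)\<close> by (simp add: nn_integral_cong_AE)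
  then have "integrable M (\<lambda>x. (\<Sum>n. u n x)\<^sup>2)"
    by (intro integrableI_nonneg) (auto simp: less_top[symmetric] top_unique)
  then show "(\<lambda>x. \<Sum>n. u n x) \<in> L2_fun M" by (simp add: L2_real_iff)
qed

section \<open>Complex functions through real and imaginary parts\<close>

lemma integrable_complexI:
  fixes f :: "'a \<Rightarrow> complex"
  assumes "integrable M (\<lambda>x. Re (f x))" "integrable M (\<lambda>x. Im (f x))"
  shows "integrable M f"
proof -
  have "integrable M (\<lambda>x. complex_of_real (Re (f x)) + \<i> * complex_of_real (Im (f x)))"
    using assms by auto
  then show ?thesis by (simp add: complex_eq[symmetric])
qed

lemma L2_complex_iff:
  fixes f :: "'a \<Rightarrow> complex"
  shows "f \<in> L2_fun \<mu> \<longleftrightarrow> (\<lambda>x. Re (f x)) \<in> L2_fun \<mu> \<and> (\<lambda>x. Im (f x)) \<in> L2_fun \<mu>"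
proof
  assume f: "f \<in> L2_fun \<mu>"
  note [measurable] = L2_funD(1)[OF f]
  show "(\<lambda>x. Re (f x)) \<in> L2_fun \<mu> \<and> (\<lambda>x. Im (f x)) \<in> L2_fun \<mu>"
    by (intro conjI L2_norm_mono_AE(1)[OF _ L2_fun_norm[OF f]])
      (simp_all add: abs_Re_le_cmod abs_Im_le_cmod)
next
  assume "(\<lambda>x. Re (f x)) \<in> L2_fun \<mu> \<and> (\<lambda>x. Im (f x)) \<in> L2_fun \<mu>"
  then show "f \<in> L2_fun \<mu>"
    unfolding L2_real_iff by (auto simp: L2_fun_def borel_measurable_complex_iff cmod_power2)
qed

lemma L2_norm_complex_square:
  fixes f :: "'a \<Rightarrow> complex"
  assumes "f \<in> L2_fun \<mu>"
  shows "(\<integral>x. (cmod (f x))\<^sup>2 \<partial>\<mu>) = (\<integral>x. (Re (f x))\<^sup>2 \<partial>\<mu>) + (\<integral>x. (Im (f x))\<^sup>2 \<partial>\<mu>)"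
  using assms unfolding L2_complex_iff L2_real_iff by (simp add: cmod_power2)

lemma (in prob_space) L2_integrable_complex:
  fixes f :: "'a \<Rightarrow> complex"
  shows "f \<in> L2_fun M \<Longrightarrow> integrable M f"
  unfolding L2_complex_iff by (intro integrable_complexI L2_integrable) auto

lemma (in prob_space) L20_complex_iff:
  fixes f :: "'a \<Rightarrow> complex"
  shows "f \<in> L20_fun M \<longleftrightarrow> f \<in> L2_fun M \<and> (\<integral>x. Re (f x) \<partial>M) = 0 \<and> (\<integral>x. Im (f x) \<partial>M) = 0"
  using L2_integrable_complex[of f] by (auto simp: L20_fun_def complex_eq_iff)

context stationary_kernel
begin

lemma AE_integrable_kernel_complex:
  fixes f :: "'a \<Rightarrow> complex"
  assumes f: "integrable \<pi> f"
  shows "AE x in \<pi>. integrable (q x) f"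
  using AE_integrable_kernel[OF integrable_Re[OF f]] AE_integrable_kernel[OF integrable_Im[OF f]]
  by eventually_elim (rule integrable_complexI)

text \<open>Restricted to almost every x because a Bochner integral defaults to 0 where f is not
  integrable, while one of its two parts may still be integrable there.\<close>

lemma markov_op_Re_Im:
  fixes f :: "'a \<Rightarrow> complex"
  assumes f: "integrable \<pi> f"
  shows "AE x in \<pi>. Re (markov_op q f x) = markov_op q (\<lambda>x. Re (f x)) x \<and>
    Im (markov_op q f x) = markov_op q (\<lambda>x. Im (f x)) x"
  using AE_integrable_kernel_complex[OF f] by eventually_elim (simp add: markov_op_def)

lemma L2_cong_AE:
  fixes f g :: "'a \<Rightarrow> real"
  assumes f: "f \<in> L2_fun \<pi>" and g: "g \<in> borel_measurable \<pi>" and eq: "AE x in \<pi>. g x = f x"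
  shows "g \<in> L2_fun \<pi>"
  by (rule L2_norm_mono_AE(1)[OF g L2_abs[OF f]]) (use eq in \<open>auto elim!: eventually_mono\<close>)

lemma markov_op_shift_L20:
  fixes f :: "'a \<Rightarrow> complex"
  assumes f: "f \<in> L20_fun \<pi>"
  shows "(\<lambda>x. a * markov_op q f x + b * f x) \<in> L20_fun \<pi>"
proof -
  have f2: "f \<in> L2_fun \<pi>" and m: "(\<integral>x. Re (f x) \<partial>\<pi>) = 0" "(\<integral>x. Im (f x) \<partial>\<pi>) = 0"
    using f by (auto simp: L20_complex_iff)
  note i = L2_integrable_complex[OF f2]
  note [measurable] = L2_funD(1)[OF f2]
  have ri: "(\<lambda>x. Re (f x)) \<in> L2_fun \<pi>" "(\<lambda>x. Im (f x)) \<in> L2_fun \<pi>" using f2 by (auto simp: L2_complex_iff)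
  have AR: "AE x in \<pi>. Re (markov_op q f x) = markov_op q (\<lambda>x. Re (f x)) x"
    and AI: "AE x in \<pi>. Im (markov_op q f x) = markov_op q (\<lambda>x. Im (f x)) x"
    using markov_op_Re_Im[OF i] by auto
  have P: "(\<lambda>x. Re (markov_op q f x)) \<in> L2_fun \<pi>" "(\<lambda>x. Im (markov_op q f x)) \<in> L2_fun \<pi>"
    using L2_cong_AE[OF L2_markov_op[OF ri(1)] _ AR] L2_cong_AE[OF L2_markov_op[OF ri(2)] _ AI] by auto
  have PR: "(\<integral>x. Re (markov_op q f x) \<partial>\<pi>) = 0"
    using integral_cong_AE[OF _ _ AR] integral_markov_op[OF L2_integrable[OF ri(1)]] m by auto
  have PI: "(\<integral>x. Im (markov_op q f x) \<partial>\<pi>) = 0"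
    using integral_cong_AE[OF _ _ AI] integral_markov_op[OF L2_integrable[OF ri(2)]] m by auto
  have "(\<lambda>x. a * markov_op q f x + b * f x) \<in> L2_fun \<pi>"
    unfolding L2_complex_iff by (auto intro!: L2_add L2_diff L2_scale P ri)
  then show ?thesis
    using L2_integrable[OF P(1)] L2_integrable[OF P(2)] L2_integrable[OF ri(1)] L2_integrable[OF ri(2)] PR PI m
    by (simp add: L20_complex_iff)
qed

end

lemma L2_norm_scale: "L2_norm \<mu> (\<lambda>x. a * f x) = \<bar>a\<bar> * L2_norm \<mu> f" for f :: "'a \<Rightarrow> real"
  by (simp add: L2_norm_def power_mult_distrib real_sqrt_mult)

context stationary_kernel
begin

text \<open>
  Writing \<open>z - P = (z - c) - (P - c)\<close>, the hypothesis makes \<open>R = (P - c) / (z - c)\<close> a strict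
  contraction, and \<open>z - P\<close> is inverted by the Neumann series of \<open>R\<close>.
\<close>

lemma L20_resolventI:
  fixes c z :: complex
  assumes D: "1 \<le> (cmod (z - c))\<^sup>2"
    and contr: "\<And>f. f \<in> L20_fun \<pi> \<Longrightarrow>
      (\<integral>x. (cmod (markov_op q f x - c * f x))\<^sup>2 \<partial>\<pi>) \<le> ((cmod (z - c))\<^sup>2 - 1) * (\<integral>x. (cmod (f x))\<^sup>2 \<partial>\<pi>)"
  shows "z \<in> L20_resolvent_set \<pi> (markov_op q)"
proof -
  define w where "w = z - c"
  have w0: "w \<noteq> 0" using D by (auto simp: w_def)
  have wD: "1 \<le> (cmod w)\<^sup>2" using D by (simp add: w_def)
  \<comment> \<open>This is the contraction factor of R: the hypothesis divided by |w|^2 has the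
    factor (|w|^2 - 1) / |w|^2.\<close>
  define \<rho> where "\<rho> = sqrt (1 - 1 / (cmod w)\<^sup>2)"
  have rho: "0 \<le> \<rho>" "\<rho> < 1" "\<rho>\<^sup>2 = 1 - 1 / (cmod w)\<^sup>2"
    using wD w0 by (simp_all add: \<rho>_def real_sqrt_less_iff[of _ 1, simplified])
  have rho_w: "(cmod w)\<^sup>2 * \<rho>\<^sup>2 = (cmod w)\<^sup>2 - 1"
    using w0 by (simp add: rho(3) right_diff_distrib)
  define R where "R f = (\<lambda>x. 1 / w * markov_op q f x + (- c / w) * f x)" for f
  have R: "R f \<in> L20_fun \<pi>" if "f \<in> L20_fun \<pi>" for f
    unfolding R_def by (rule markov_op_shift_L20[OF that])
  have R_eq: "w * R f x = markov_op q f x - c * f x" for f x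
    using w0 by (simp add: R_def field_simps)
  have R_norm: "L2_norm \<pi> (R f) \<le> \<rho> * L2_norm \<pi> f" if f: "f \<in> L20_fun \<pi>" for f
  proof (rule power2_le_imp_le)
    have "(cmod w)\<^sup>2 * (L2_norm \<pi> (R f))\<^sup>2 = (\<integral>x. (cmod (w * R f x))\<^sup>2 \<partial>\<pi>)"
      by (simp add: L2_norm_square norm_mult power_mult_distrib)
    also have "\<dots> \<le> ((cmod w)\<^sup>2 - 1) * (L2_norm \<pi> f)\<^sup>2"
      unfolding R_eq L2_norm_square using contr[OF f] unfolding w_def .
    also have "\<dots> = (cmod w)\<^sup>2 * (\<rho> * L2_norm \<pi> f)\<^sup>2"
      by (simp only: power_mult_distrib mult.assoc[symmetric] rho_w)
    finally show "(L2_norm \<pi> (R f))\<^sup>2 \<le> (\<rho> * L2_norm \<pi> f)\<^sup>2" using w0 by simp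
  qed (simp add: rho L2_norm_nonneg)
  \<comment> \<open>Here z - P = w (1 - R), and ||(1 - R) f|| >= (1 - \<rho>) ||f||. The same
    estimate yields injectivity.\<close>
  have bound: "L2_norm \<pi> f \<le> 1 / (cmod w * (1 - \<rho>)) * L2_norm \<pi> (\<lambda>x. z * f x - markov_op q f x)"
    if f: "f \<in> L20_fun \<pi>" for f
  proof -
    let ?e = "\<lambda>x. z * f x - markov_op q f x"
    have f2: "f \<in> L2_fun \<pi>" using f by (simp add: L20_fun_def)
    have e: "?e \<in> L2_fun \<pi>" using markov_op_shift_L20[OF f, of "-1" z] by (simp add: L20_fun_def)
    have Rf: "R f \<in> L2_fun \<pi>" using R[OF f] by (simp add: L20_fun_def)
    have n: "(\<lambda>x. cmod (R f x)) \<in> L2_fun \<pi>" "(\<lambda>x. 1 / cmod w * cmod (?e x)) \<in> L2_fun \<pi>"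
      by (rule L2_fun_norm[OF Rf], rule L2_scale[OF L2_fun_norm[OF e]])
    have "cmod (f x) \<le> cmod (R f x) + 1 / cmod w * cmod (?e x)" for x
    proof -
      have "w * f x = w * R f x + ?e x" unfolding R_eq by (simp add: w_def left_diff_distrib)
      then have "f x = R f x + 1 / w * ?e x" using w0 by (simp add: field_simps)
      then have "cmod (f x) \<le> cmod (R f x) + cmod (1 / w * ?e x)" by (metis norm_triangle_ineq)
      then show ?thesis by (simp add: norm_mult norm_divide)
    qed
    then have "L2_norm \<pi> f \<le> L2_norm \<pi> (\<lambda>x. cmod (R f x) + 1 / cmod w * cmod (?e x))"
      by (intro L2_norm_mono_AE(2)[OF L2_funD(1)[OF f2] L2_add[OF n]]) auto
    also have "\<dots> \<le> L2_norm \<pi> (R f) + 1 / cmod w * L2_norm \<pi> ?e"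
      using L2_norm_triangle[OF n] unfolding L2_norm_scale L2_norm_norm by simp
    also have "\<dots> \<le> \<rho> * L2_norm \<pi> f + 1 / cmod w * L2_norm \<pi> ?e" using R_norm[OF f] by simp
    finally have "(1 - \<rho>) * L2_norm \<pi> f \<le> 1 / cmod w * L2_norm \<pi> ?e" by (simp add: left_diff_distrib)
    then show ?thesis using rho w0 by (simp add: field_simps)
  qed
  have inj: "AE x in \<pi>. f x = 0" if f: "f \<in> L20_fun \<pi>" and 0: "AE x in \<pi>. z * f x - markov_op q f x = 0" for f
  proof -
    have f2: "f \<in> L2_fun \<pi>" using f by (simp add: L20_fun_def)
    have e: "(\<lambda>x. z * f x - markov_op q f x) \<in> L2_fun \<pi>"
      using markov_op_shift_L20[OF f, of "-1" z] by (simp add: L20_fun_def)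
    have "(\<integral>x. (cmod (z * f x - markov_op q f x))\<^sup>2 \<partial>\<pi>) = 0"
      by (rule integral_eq_zero_AE) (use 0 in \<open>auto elim!: eventually_mono\<close>)
    then have "L2_norm \<pi> f \<le> 0" using bound[OF f] by (simp add: L2_norm_def)
    then have "(\<integral>x. (cmod (f x))\<^sup>2 \<partial>\<pi>) = 0"
      by (simp add: L2_norm_def order_antisym)
    then have "AE x in \<pi>. (cmod (f x))\<^sup>2 = 0"
      using L2_funD(2)[OF f2] by (simp add: integral_nonneg_eq_0_iff_AE)
    then show ?thesis by simp
  qed
  have surj: "\<exists>f \<in> L20_fun \<pi>. AE x in \<pi>. z * f x - markov_op q f x = g x" if g: "g \<in> L20_fun \<pi>" for g
  proof -
    \<comment> \<open>The terms R^n (g / w) of the Neumann series. The summand with factor 0 fits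
      the starting term to \<open>markov_op_shift_L20\<close>.\<close>
    define F where "F n = (R ^^ n) (\<lambda>x. 0 * markov_op q g x + 1 / w * g x)" for n
    have F0: "w * F 0 x = g x" for x using w0 by (simp add: F_def)
    have FS: "markov_op q (F n) x = c * F n x + w * F (Suc n) x" for n x
      using R_eq[of "F n" x] by (simp add: F_def)
    have F: "F n \<in> L20_fun \<pi>" for n
    proof (induction n)
      case 0
      show ?case unfolding F_def using markov_op_shift_L20[OF g, of 0 "1 / w"] by simp
    next
      case (Suc n)
      then show ?case using R by (simp add: F_def)
    qed
    have F2: "F n \<in> L2_fun \<pi>" for n using F by (simp add: L20_fun_def)
    have FL: "L2_norm \<pi> (F n) \<le> L2_norm \<pi> (F 0) * \<rho> ^ n" for n
    proof (induction n)
      case (Suc n)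
      have "L2_norm \<pi> (F (Suc n)) \<le> \<rho> * L2_norm \<pi> (F n)" using R_norm[OF F[of n]] by (simp add: F_def)
      also have "\<dots> \<le> \<rho> * (L2_norm \<pi> (F 0) * \<rho> ^ n)" using Suc rho by (intro mult_left_mono) auto
      finally show ?case by (simp add: mult_ac)
    qed simp
    have series: "AE x in \<pi>. summable (\<lambda>n. cmod (F n x))" "(\<lambda>x. \<Sum>n. cmod (F n x)) \<in> L2_fun \<pi>"
      using L2_geometric_series[of "\<lambda>n x. cmod (F n x)" "L2_norm \<pi> (F 0)" \<rho>] L2_fun_norm[OF F2] FL rho
      by (simp_all add: L2_norm_norm)
    have [measurable]: "F n \<in> borel_measurable \<pi>" for n using L2_funD(1)[OF F2] .
    define f where "f = (\<lambda>x. \<Sum>n. F n x)"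
    have fm[measurable]: "f \<in> borel_measurable \<pi>" unfolding f_def by measurable
    have "AE x in \<pi>. cmod (f x) \<le> (\<Sum>n. cmod (F n x))"
      using series(1) unfolding f_def by eventually_elim (rule summable_norm)
    then have f2: "f \<in> L2_fun \<pi>" by (rule L2_norm_mono_AE(1)[OF fm series(2)])
    \<comment> \<open>One dominating function for all N, used twice: under \<open>\<pi>\<close> to
      see that the sum has mean zero, and under \<open>q x\<close> to apply P termwise.\<close>
    have dom: "AE x in \<pi>. \<forall>N. norm (\<Sum>n<N. F n x) \<le> (\<Sum>n. cmod (F n x))"
      using series(1)
    proof eventually_elim
      case (elim x)
      show ?case
      proof
        fix N
        have "norm (\<Sum>n<N. F n x) \<le> (\<Sum>n<N. cmod (F n x))" by (rule norm_sum)
        also have "\<dots> \<le> (\<Sum>n. cmod (F n x))" by (rule sum_le_suminf[OF elim]) auto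
        finally show "norm (\<Sum>n<N. F n x) \<le> (\<Sum>n. cmod (F n x))" .
      qed
    qed
    have lim: "AE x in \<pi>. (\<lambda>N. \<Sum>n<N. F n x) \<longlonglongrightarrow> f x"
      using series(1) unfolding f_def
      by eventually_elim (rule summable_LIMSEQ[OF summable_norm_cancel])
    have "(\<lambda>N. \<integral>x. (\<Sum>n<N. F n x) \<partial>\<pi>) \<longlonglongrightarrow> (\<integral>x. f x \<partial>\<pi>)"
    proof (rule integral_dominated_convergence[OF _ _ L2_integrable[OF series(2)] lim])
      show "AE x in \<pi>. norm (\<Sum>n<N. F n x) \<le> (\<Sum>n. cmod (F n x))" for N
        using dom by eventually_elim simp
    qed measurable
    moreover have "(\<integral>x. (\<Sum>n<N. F n x) \<partial>\<pi>) = 0" for N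
      using F L2_integrable_complex[OF F2] by (simp add: L20_fun_def)
    ultimately have "(\<integral>x. f x \<partial>\<pi>) = 0" by (simp add: LIMSEQ_const_iff)
    then have f20: "f \<in> L20_fun \<pi>" using f2 by (simp add: L20_fun_def)
    have Fi: "AE x in \<pi>. \<forall>n. integrable (q x) (F n)"
      unfolding AE_all_countable using AE_integrable_kernel_complex[OF L2_integrable_complex[OF F2]] by blast
    \<comment> \<open>P is interchanged with the series by dominated convergence under
      \<open>q x\<close>; \<open>AE_kernel\<close> makes domination and convergence hold there for
      almost every x.\<close>
    have "AE x in \<pi>. z * f x - markov_op q f x = g x"
      using AE_space AE_integrable_kernel[OF L2_integrable[OF series(2)]] Fi AE_kernel[OF dom] AE_kernel[OF lim] lim
    proof eventually_elim
      case (elim x)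
      have "(\<lambda>N. \<integral>y. (\<Sum>n<N. F n y) \<partial>q x) \<longlonglongrightarrow> (\<integral>y. f y \<partial>q x)"
      proof (rule integral_dominated_convergence[OF _ _ elim(2) elim(5)])
        show "AE y in q x. norm (\<Sum>n<N. F n y) \<le> (\<Sum>n. cmod (F n y))" for N
          using elim(4) by eventually_elim simp
      qed (auto intro!: measurable_q[OF elim(1)])
      \<comment> \<open>The recursion P F_n = c F_n + w F_(n+1) shifts the index. In the limit P f =
        c f + w (f - F_0), and w F_0 = g together with c + w = z gives the equation.\<close>
      moreover have "(\<integral>y. (\<Sum>n<N. F n y) \<partial>q x) = c * (\<Sum>n<N. F n x) + w * ((\<Sum>n<Suc N. F n x) - F 0 x)" for N
      proof -
        have "(\<integral>y. (\<Sum>n<N. F n y) \<partial>q x) = (\<Sum>n<N. markov_op q (F n) x)"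
          using elim(3) by (simp add: markov_op_def)
        also have "\<dots> = c * (\<Sum>n<N. F n x) + w * (\<Sum>n<N. F (Suc n) x)"
          by (simp add: FS sum.distrib sum_distrib_left)
        also have "(\<Sum>n<N. F (Suc n) x) = (\<Sum>n<Suc N. F n x) - F 0 x"
          by (simp only: sum.lessThan_Suc_shift) simp
        finally show ?thesis .
      qed
      ultimately have "(\<lambda>N. c * (\<Sum>n<N. F n x) + w * ((\<Sum>n<Suc N. F n x) - F 0 x)) \<longlonglongrightarrow> markov_op q f x"
        by (simp add: markov_op_def)
      moreover have "(\<lambda>N. c * (\<Sum>n<N. F n x) + w * ((\<Sum>n<Suc N. F n x) - F 0 x)) \<longlonglongrightarrow> c * f x + w * (f x - F 0 x)"
        by (intro tendsto_intros elim(6) LIMSEQ_Suc[OF elim(6)])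
      ultimately have "markov_op q f x = c * f x + w * (f x - F 0 x)" by (rule LIMSEQ_unique)
      then show ?case using F0[of x] by (simp add: w_def algebra_simps)
    qed
    with f20 show ?thesis by blast
  qed
  show ?thesis
    unfolding L20_resolvent_set_def using inj surj bound by blast
qed

end

section \<open>From the numerical range to the spectrum\<close>

context reversible_kernel
begin

text \<open>Expand the square in real and imaginary parts. The terms with Im c cancel by symmetry of
  P, and contractivity bounds ||P f||^2.\<close>

lemma norm_markov_op_shift:
  fixes f :: "'a \<Rightarrow> complex"
  assumes f: "f \<in> L2_fun \<pi>"
  shows "(\<integral>x. (cmod (markov_op q f x - c * f x))\<^sup>2 \<partial>\<pi>) \<le> (1 + (cmod c)\<^sup>2) * (\<integral>x. (cmod (f x))\<^sup>2 \<partial>\<pi>)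
    - 2 * Re c * ((\<integral>x. Re (f x) * markov_op q (\<lambda>x. Re (f x)) x \<partial>\<pi>) + (\<integral>x. Im (f x) * markov_op q (\<lambda>x. Im (f x)) x \<partial>\<pi>))"
proof -
  define u v where "u = (\<lambda>x. Re (f x))" and "v = (\<lambda>x. Im (f x))"
  have u: "u \<in> L2_fun \<pi>" and v: "v \<in> L2_fun \<pi>" using f by (auto simp: L2_complex_iff u_def v_def)
  note Pu = L2_markov_op[OF u] and Pv = L2_markov_op[OF v]
  note [measurable] = L2_funD(1)[OF f] L2_funD(1)[OF u] L2_funD(1)[OF v]
  have sq: "integrable \<pi> (\<lambda>x. (h x)\<^sup>2)" if "h \<in> L2_fun \<pi>" for h :: "'a \<Rightarrow> real"
    using that by (simp add: L2_real_iff)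
  have "(\<integral>x. (cmod (markov_op q f x - c * f x))\<^sup>2 \<partial>\<pi>) =
     (\<integral>x. (markov_op q u x)\<^sup>2 + (markov_op q v x)\<^sup>2 + (cmod c)\<^sup>2 * ((u x)\<^sup>2 + (v x)\<^sup>2)
        - 2 * Re c * (u x * markov_op q u x + v x * markov_op q v x)
        + 2 * Im c * (v x * markov_op q u x - u x * markov_op q v x) \<partial>\<pi>)"
  proof (rule integral_cong_AE)
    show "AE x in \<pi>. (cmod (markov_op q f x - c * f x))\<^sup>2 =
      (markov_op q u x)\<^sup>2 + (markov_op q v x)\<^sup>2 + (cmod c)\<^sup>2 * ((u x)\<^sup>2 + (v x)\<^sup>2)
        - 2 * Re c * (u x * markov_op q u x + v x * markov_op q v x)
        + 2 * Im c * (v x * markov_op q u x - u x * markov_op q v x)"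
      using markov_op_Re_Im[OF L2_integrable_complex[OF f]]
    proof eventually_elim
      case (elim x)
      then have "Re (markov_op q f x) = markov_op q u x" "Im (markov_op q f x) = markov_op q v x"
        by (simp_all add: u_def v_def)
      moreover have "Re (f x) = u x" "Im (f x) = v x" by (simp_all add: u_def v_def)
      ultimately show ?case by (simp add: cmod_power2) (simp add: power2_eq_square algebra_simps)
    qed
  qed measurable
  also have "\<dots> = (\<integral>x. (markov_op q u x)\<^sup>2 \<partial>\<pi>) + (\<integral>x. (markov_op q v x)\<^sup>2 \<partial>\<pi>)
     + (cmod c)\<^sup>2 * ((\<integral>x. (u x)\<^sup>2 \<partial>\<pi>) + (\<integral>x. (v x)\<^sup>2 \<partial>\<pi>))
     - 2 * Re c * ((\<integral>x. u x * markov_op q u x \<partial>\<pi>) + (\<integral>x. v x * markov_op q v x \<partial>\<pi>))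
     + 2 * Im c * ((\<integral>x. v x * markov_op q u x \<partial>\<pi>) - (\<integral>x. u x * markov_op q v x \<partial>\<pi>))"
    using sq[OF u] sq[OF v] sq[OF Pu] sq[OF Pv] L2_mult_integrable[OF u Pu] L2_mult_integrable[OF v Pv]
      L2_mult_integrable[OF u Pv] L2_mult_integrable[OF v Pu] by simp
  also have "(\<integral>x. v x * markov_op q u x \<partial>\<pi>) - (\<integral>x. u x * markov_op q v x \<partial>\<pi>) = 0"
    using markov_op_symmetric[OF v u] by (simp add: mult.commute)
  finally show ?thesis
    using markov_op_contraction[OF u] markov_op_contraction[OF v] L2_norm_complex_square[OF f]
    by (simp add: u_def v_def algebra_simps)
qed

text \<open>Every z off the segment needs a centre c for which the affine condition in
  \<open>res\<close> holds for all admissible N and Q.\<close>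

lemma L20_spectrum_subset:
  assumes form: "\<And>f :: 'a \<Rightarrow> real. f \<in> L2_fun \<pi> \<Longrightarrow> (\<integral>x. f x \<partial>\<pi>) = 0 \<Longrightarrow>
      \<alpha> * (\<integral>x. (f x)\<^sup>2 \<partial>\<pi>) \<le> (\<integral>x. f x * markov_op q f x \<partial>\<pi>) \<and>
      (\<integral>x. f x * markov_op q f x \<partial>\<pi>) \<le> \<beta> * (\<integral>x. (f x)\<^sup>2 \<partial>\<pi>)"
  shows "L20_spectrum \<pi> (markov_op q) \<subseteq> complex_of_real ` {\<alpha>..\<beta>}"
proof -
  have res: "z \<in> L20_resolvent_set \<pi> (markov_op q)"
    if c: "\<And>N Q. 0 \<le> N \<Longrightarrow> \<alpha> * N \<le> Q \<Longrightarrow> Q \<le> \<beta> * N \<Longrightarrow>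
      (1 + (cmod c)\<^sup>2) * N - 2 * Re c * Q \<le> ((cmod (z - c))\<^sup>2 - 1) * N" for z c
  proof (rule L20_resolventI)
    show contr: "(\<integral>x. (cmod (markov_op q f x - c * f x))\<^sup>2 \<partial>\<pi>) \<le> ((cmod (z - c))\<^sup>2 - 1) * (\<integral>x. (cmod (f x))\<^sup>2 \<partial>\<pi>)"
      if f: "f \<in> L20_fun \<pi>" for f
    proof -
      have f2: "f \<in> L2_fun \<pi>" and m: "(\<integral>x. Re (f x) \<partial>\<pi>) = 0" "(\<integral>x. Im (f x) \<partial>\<pi>) = 0"
        using f by (auto simp: L20_complex_iff)
      have "(\<lambda>x. Re (f x)) \<in> L2_fun \<pi>" "(\<lambda>x. Im (f x)) \<in> L2_fun \<pi>" using f2 by (auto simp: L2_complex_iff)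
      note b = form[OF this(1) m(1)] form[OF this(2) m(2)]
      note norm_markov_op_shift[OF f2, of c]
      also have "(1 + (cmod c)\<^sup>2) * (\<integral>x. (cmod (f x))\<^sup>2 \<partial>\<pi>)
        - 2 * Re c * ((\<integral>x. Re (f x) * markov_op q (\<lambda>x. Re (f x)) x \<partial>\<pi>) + (\<integral>x. Im (f x) * markov_op q (\<lambda>x. Im (f x)) x \<partial>\<pi>))
        \<le> ((cmod (z - c))\<^sup>2 - 1) * (\<integral>x. (cmod (f x))\<^sup>2 \<partial>\<pi>)"
        by (rule c) (use b in \<open>auto simp: L2_norm_complex_square[OF f2] distrib_left\<close>)
      finally show ?thesis .
    qed
    \<comment> \<open>The side condition on |z - c| follows from the contraction estimate at one
      nonzero function, since its left side is nonnegative.\<close>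
    obtain A where A: "A \<in> nontrivial_events \<pi>" using ex_nontrivial by blast
    then have As: "A \<in> sets \<pi>" by (simp add: nontrivial_events_def)
    let ?f = "\<lambda>x. complex_of_real (centered A x)"
    have "?f \<in> L20_fun \<pi>"
      using centered_L2[OF As] integral_centered[OF As] by (simp add: L20_complex_iff L2_complex_iff L2_const)
    have "0 \<le> (\<integral>x. (cmod (markov_op q ?f x - c * ?f x))\<^sup>2 \<partial>\<pi>)" by simp
    also have "\<dots> \<le> ((cmod (z - c))\<^sup>2 - 1) * (\<integral>x. (cmod (?f x))\<^sup>2 \<partial>\<pi>)" by (rule contr) fact
    also have "(\<integral>x. (cmod (?f x))\<^sup>2 \<partial>\<pi>) = measure \<pi> A * measure \<pi> (space \<pi> - A)"
      using integral_centered_square[OF As] by simp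
    finally show "1 \<le> (cmod (z - c))\<^sup>2"
      using nontrivial_variance_pos[OF A] by (simp add: zero_le_mult_iff)
  qed
  have "z \<in> L20_resolvent_set \<pi> (markov_op q)" if z: "z \<notin> complex_of_real ` {\<alpha>..\<beta>}" for z
  proof (cases "Im z = 0")
    case False
    define y where "y = Im z"
    have y: "y \<noteq> 0" using False by (simp add: y_def)
    \<comment> \<open>An imaginary centre removes Q. Placed opposite to z, it adds 2 y (1/y) = 2 to
      |z - c|^2, the amount needed.\<close>
    let ?c = "Complex 0 (- 1 / y)"
    have cz: "(cmod (z - ?c))\<^sup>2 = (Re z)\<^sup>2 + y\<^sup>2 + 2 + (1 / y)\<^sup>2"
      using y by (simp add: cmod_power2 y_def[symmetric] power2_sum)
    have cc: "(cmod ?c)\<^sup>2 = (1 / y)\<^sup>2" by (simp add: cmod_power2 power_divide)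
    show ?thesis
    proof (rule res[of ?c])
      fix N Q :: real
      assume "0 \<le> N"
      then have "(1 + (1 / y)\<^sup>2) * N \<le> ((Re z)\<^sup>2 + y\<^sup>2 + 2 + (1 / y)\<^sup>2 - 1) * N"
        by (intro mult_right_mono) auto
      then show "(1 + (cmod ?c)\<^sup>2) * N - 2 * Re ?c * Q \<le> ((cmod (z - ?c))\<^sup>2 - 1) * N"
        unfolding cz cc by simp
    qed
  next
    case True
    define x where "x = Re z"
    have zx: "z = complex_of_real x" using True by (simp add: x_def complex_eq_iff)
    have norm_real: "(cmod (z - complex_of_real r))\<^sup>2 = (x - r)\<^sup>2" "(cmod (complex_of_real r))\<^sup>2 = r\<^sup>2" for r
      by (simp_all add: zx cmod_power2)
    have "x < \<alpha> \<or> \<beta> < x" using z zx by force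
    then show ?thesis
    proof
      assume x: "x < \<alpha>"
      \<comment> \<open>At the worst case Q = \<alpha> N the condition reads 2 - 2 s (\<alpha> - x)
        <= x^2; this s makes the left side 0. Beyond \<beta> the choice is the mirror image.\<close>
      define s where "s = 1 / (\<alpha> - x)"
      have s: "0 < s" "s * (\<alpha> - x) = 1" using x by (simp_all add: s_def)
      show ?thesis
      proof (rule res[of "complex_of_real s"], unfold norm_real)
        fix N Q :: real
        assume N: "0 \<le> N" "\<alpha> * N \<le> Q"
        have "2 * s * (\<alpha> * N) \<le> 2 * s * Q" using s N by (intro mult_left_mono) auto
        moreover have "(1 + s\<^sup>2) * N - 2 * s * (\<alpha> * N) = (s\<^sup>2 + 1 - 2 * (s * (\<alpha> - x)) - 2 * s * x) * N"
          by (simp add: algebra_simps)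
        moreover have "\<dots> = (s\<^sup>2 - 1 - 2 * s * x) * N" unfolding s(2) by simp
        moreover have "\<dots> \<le> ((x - s)\<^sup>2 - 1) * N"
          using N(1) by (intro mult_right_mono) (auto simp: power2_diff)
        ultimately show "(1 + s\<^sup>2) * N - 2 * Re (complex_of_real s) * Q \<le> ((x - s)\<^sup>2 - 1) * N"
          by simp
      qed
    next
      assume x: "\<beta> < x"
      define s where "s = 1 / (x - \<beta>)"
      have s: "0 < s" "s * (x - \<beta>) = 1" using x by (simp_all add: s_def)
      show ?thesis
      proof (rule res[of "complex_of_real (- s)"], unfold norm_real)
        fix N Q :: real
        assume N: "0 \<le> N" "Q \<le> \<beta> * N"
        have "2 * s * Q \<le> 2 * s * (\<beta> * N)" using s N by (intro mult_left_mono) auto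
        moreover have "(1 + s\<^sup>2) * N + 2 * s * (\<beta> * N) = (s\<^sup>2 + 1 - 2 * (s * (x - \<beta>)) + 2 * s * x) * N"
          by (simp add: algebra_simps)
        moreover have "\<dots> = (s\<^sup>2 - 1 + 2 * s * x) * N" unfolding s(2) by simp
        moreover have "\<dots> \<le> ((x - - s)\<^sup>2 - 1) * N"
          using N(1) by (intro mult_right_mono) (auto simp: power2_sum)
        ultimately show "(1 + (- s)\<^sup>2) * N - 2 * Re (complex_of_real (- s)) * Q \<le> ((x - - s)\<^sup>2 - 1) * N"
          by simp
      qed
    qed
  qed
  then show ?thesis unfolding L20_spectrum_def by blast
qed

end

section \<open>The equivalences and the parameter bound\<close>

context reversible_kernel
begin

lemma norm_markov_op_le:
  fixes f :: "'a \<Rightarrow> real"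
  assumes f: "f \<in> L2_fun \<pi>" and m: "(\<integral>x. f x \<partial>\<pi>) = 0"
  shows "(\<integral>x. (markov_op q f x)\<^sup>2 \<partial>\<pi>) \<le> (1 - lawler_sokal_const / 8 * two.flow_inf\<^sup>2) * (\<integral>x. (f x)\<^sup>2 \<partial>\<pi>)"
  using two.flow_inf_spectral_bound[OF ex_nontrivial f m] by (simp only: two_step_form[OF f])

text \<open>The real \<open>sqrt\<close> is odd, so recovering its argument by squaring requires
  nonnegativity. It follows from ||P f||^2 >= 0 at a centred indicator.\<close>

lemma two_step_gap_nonneg: "0 \<le> 1 - lawler_sokal_const / 8 * two.flow_inf\<^sup>2"
proof -
  obtain A where A: "A \<in> nontrivial_events \<pi>" using ex_nontrivial by blast
  then have As: "A \<in> sets \<pi>" by (simp add: nontrivial_events_def)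
  have "0 \<le> (\<integral>x. (markov_op q (centered A) x)\<^sup>2 \<partial>\<pi>)" by simp
  also have "\<dots> \<le> (1 - lawler_sokal_const / 8 * two.flow_inf\<^sup>2) * (measure \<pi> A * measure \<pi> (space \<pi> - A))"
    using norm_markov_op_le[OF centered_L2[OF As] integral_centered[OF As]]
    unfolding integral_centered_square[OF As] .
  finally show ?thesis
    using nontrivial_variance_pos[OF A] unfolding zero_le_mult_iff by linarith
qed

text \<open>The two-step bound controls ||P f||, hence by Cauchy-Schwarz the form from both sides.
  The one-step bound is an upper estimate, so the minimum appears only at the right end.\<close>

lemma spectrum_inclusion:
  "L20_spectrum \<pi> (markov_op q) \<subseteq> complex_of_real `
     {- sqrt (1 - lawler_sokal_const / 8 * two.flow_inf\<^sup>2) ..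
      min (sqrt (1 - lawler_sokal_const / 8 * two.flow_inf\<^sup>2)) (1 - lawler_sokal_const / 8 * flow_inf\<^sup>2)}"
proof (rule L20_spectrum_subset)
  fix f :: "'a \<Rightarrow> real"
  assume f: "f \<in> L2_fun \<pi>" and m: "(\<integral>x. f x \<partial>\<pi>) = 0"
  define s where "s = sqrt (1 - lawler_sokal_const / 8 * two.flow_inf\<^sup>2)"
  define N where "N = (\<integral>x. (f x)\<^sup>2 \<partial>\<pi>)"
  have N: "0 \<le> N" by (simp add: N_def)
  have s: "0 \<le> s" "s\<^sup>2 = 1 - lawler_sokal_const / 8 * two.flow_inf\<^sup>2"
    using two_step_gap_nonneg by (simp_all add: s_def)
  have "(\<integral>x. f x * markov_op q f x \<partial>\<pi>)\<^sup>2 \<le> N * (\<integral>x. (markov_op q f x)\<^sup>2 \<partial>\<pi>)"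
    unfolding N_def by (rule L2_Cauchy_Schwarz[OF f L2_markov_op[OF f]])
  also have "\<dots> \<le> N * (s\<^sup>2 * N)"
    using norm_markov_op_le[OF f m] N unfolding s(2) N_def[symmetric] by (rule mult_left_mono)
  also have "\<dots> = (s * N)\<^sup>2" by (simp add: power2_eq_square)
  finally have "\<bar>\<integral>x. f x * markov_op q f x \<partial>\<pi>\<bar> \<le> \<bar>s * N\<bar>" by (simp only: abs_le_square_iff)
  then have "\<bar>\<integral>x. f x * markov_op q f x \<partial>\<pi>\<bar> \<le> s * N" using s(1) N by simp
  moreover have "(\<integral>x. f x * markov_op q f x \<partial>\<pi>) \<le> (1 - lawler_sokal_const / 8 * flow_inf\<^sup>2) * N"
    unfolding N_def by (rule flow_inf_spectral_bound[OF ex_nontrivial f m])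
  ultimately show "- s * N \<le> (\<integral>x. f x * markov_op q f x \<partial>\<pi>) \<and>
      (\<integral>x. f x * markov_op q f x \<partial>\<pi>) \<le> min s (1 - lawler_sokal_const / 8 * flow_inf\<^sup>2) * N"
    by (auto simp: min_def)
qed

text \<open>If ||P f|| <= r ||f||, centred indicators give 1 - r <= k(A) <= 1 + r and k_2(A) >= 1 -
  r^2. These bounds are uniform in A, so strictness survives the infimum and supremum.\<close>

lemma gap_imp_flow_bounds:
  assumes "has_L2_gap \<pi> q"
  shows "0 < flow_inf" "iso_sup \<pi> q < 2" "0 < two.flow_inf"
proof -
  obtain r' where "r' < 1" and le': "\<And>f :: 'a \<Rightarrow> real. f \<in> L2_fun \<pi> \<Longrightarrow> (\<integral>x. f x \<partial>\<pi>) = 0 \<Longrightarrow>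
      L2_norm \<pi> (markov_op q f) \<le> r' * L2_norm \<pi> f"
    using assms unfolding has_L2_gap_iff by blast
  define r where "r = max 0 r'"
  have r: "0 \<le> r" "r < 1" using \<open>r' < 1\<close> by (auto simp: r_def)
  have le: "L2_norm \<pi> (markov_op q f) \<le> r * L2_norm \<pi> f"
    if "f \<in> L2_fun \<pi>" "(\<integral>x. f x \<partial>\<pi>) = 0" for f :: "'a \<Rightarrow> real"
    using le'[OF that] mult_right_mono[of r' r "L2_norm \<pi> f"] L2_norm_nonneg[of \<pi> f] by (simp add: r_def)
  have r2: "r\<^sup>2 < 1" using r by (simp add: power_less_one_iff abs_square_less_1)
  have ratios: "1 - r \<le> flow_ratio A" "flow_ratio A \<le> 1 + r" "1 - r\<^sup>2 \<le> two.flow_ratio A"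
    if A: "A \<in> nontrivial_events \<pi>" for A
  proof -
    have As: "A \<in> sets \<pi>" using A by (simp add: nontrivial_events_def)
    define S where "S = measure \<pi> A * measure \<pi> (space \<pi> - A)"
    have S: "0 < S" unfolding S_def by (rule nontrivial_variance_pos[OF A])
    note f = centered_L2[OF As] and m = integral_centered[OF As]
    have "(L2_norm \<pi> (markov_op q (centered A)))\<^sup>2 \<le> (r * L2_norm \<pi> (centered A))\<^sup>2"
      by (intro power_mono le f m L2_norm_nonneg)
    then have n: "(\<integral>x. (markov_op q (centered A) x)\<^sup>2 \<partial>\<pi>) \<le> r\<^sup>2 * S"
      by (simp add: power_mult_distrib L2_norm_square integral_centered_square[OF As] S_def)
    then have "(1 - two.flow_ratio A) * S \<le> r\<^sup>2 * S"
      using flow_ratio_form(2)[OF A] by (simp only: S_def)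
    then show "1 - r\<^sup>2 \<le> two.flow_ratio A" using S by simp
    have "((1 - flow_ratio A) * S)\<^sup>2 \<le> S * (\<integral>x. (markov_op q (centered A) x)\<^sup>2 \<partial>\<pi>)"
      using L2_Cauchy_Schwarz[OF f L2_markov_op[OF f]]
      unfolding flow_ratio_form(1)[OF A] integral_centered_square[OF As] S_def .
    also have "\<dots> \<le> S * (r\<^sup>2 * S)" using n S by (intro mult_left_mono) auto
    also have "\<dots> = (r * S)\<^sup>2" by (simp add: power2_eq_square)
    finally have "\<bar>(1 - flow_ratio A) * S\<bar> \<le> \<bar>r * S\<bar>" by (simp only: abs_le_square_iff)
    then have "\<bar>1 - flow_ratio A\<bar> \<le> r" using S r by (simp add: abs_mult)
    then show "1 - r \<le> flow_ratio A" "flow_ratio A \<le> 1 + r" by linarith+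
  qed
  have "1 - r \<le> flow_inf" unfolding flow_inf_def by (rule cINF_greatest[OF ex_nontrivial ratios(1)])
  then show "0 < flow_inf" using r by linarith
  have "1 - r\<^sup>2 \<le> two.flow_inf" unfolding two.flow_inf_def by (rule cINF_greatest[OF ex_nontrivial ratios(3)])
  then show "0 < two.flow_inf" using r2 by linarith
  have "iso_sup \<pi> q \<le> 1 + r" by (rule iso_sup_least[OF ratios(2)])
  then show "iso_sup \<pi> q < 2" using r by linarith
qed

lemma two_step_flow_imp_gap:
  assumes "0 < two.flow_inf"
  shows "has_L2_gap \<pi> q"
proof -
  define s where "s = sqrt (1 - lawler_sokal_const / 8 * two.flow_inf\<^sup>2)"
  have "0 < lawler_sokal_const / 8 * two.flow_inf\<^sup>2" using assms lawler_sokal_const_ge by simp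
  then have "s < 1" unfolding s_def by (simp add: real_sqrt_less_iff[of _ 1, simplified])
  moreover have "L2_norm \<pi> (markov_op q f) \<le> s * L2_norm \<pi> f"
    if "f \<in> L2_fun \<pi>" "(\<integral>x. f x \<partial>\<pi>) = 0" for f :: "'a \<Rightarrow> real"
    using real_sqrt_le_mono[OF norm_markov_op_le[OF that]] by (simp add: L2_norm_def real_sqrt_mult s_def)
  ultimately show ?thesis unfolding has_L2_gap_iff by blast
qed

lemma two_step_flow_pos:
  assumes "0 < flow_inf" "iso_sup \<pi> q < 2"
  shows "0 < two.flow_inf"
proof -
  have "0 < flow_inf\<^sup>2 * (2 - iso_sup \<pi> q) / 18" using assms by simp
  with two_step_flow_inf_ge show ?thesis by linarith
qed

lemma two_step_parameter_bound:
  fixes \<delta> \<epsilon>\<^sub>1 \<epsilon>\<^sub>2 \<epsilon> :: real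
  assumes "0 < \<delta>" "\<delta> < 1" "0 < \<epsilon>\<^sub>1" "\<epsilon>\<^sub>1 < 1" "0 < \<epsilon>\<^sub>2" "\<epsilon>\<^sub>2 < 1" "0 < \<epsilon>" "\<epsilon> < 1"
  shows "min (flow_inf\<^sup>2 / 16 * \<delta>)
      ((flow_inf * ((2 - \<epsilon>) * (1 - \<epsilon>\<^sub>1) * (1 - \<epsilon>\<^sub>2) * (1 - \<delta>) / ((1 - \<epsilon>) * iso_sup \<pi> q) - 1 / (1 - \<epsilon>)) - \<epsilon> / (1 - \<epsilon>)) * \<epsilon>)
    \<le> two.flow_inf" (is "min ?a (( _ * (?X / ?Y - _) - _) * _) \<le> _")
proof (cases "0 < (flow_inf * (?X / ?Y - 1 / (1 - \<epsilon>)) - \<epsilon> / (1 - \<epsilon>)) * \<epsilon>")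
  case False
  moreover have "0 \<le> two.flow_inf" by (rule two.flow_inf_nonneg[OF ex_nontrivial])
  ultimately show ?thesis by linarith
next
  case True
  have k: "0 \<le> flow_inf" by (rule flow_inf_nonneg[OF ex_nontrivial])
  have K: "flow_inf \<le> iso_sup \<pi> q" by (rule flow_inf_le_iso_sup)
  have "0 < flow_inf * (?X / ?Y - 1 / (1 - \<epsilon>)) - \<epsilon> / (1 - \<epsilon>)"
    using True assms by (simp add: zero_less_mult_iff)
  moreover have "0 < \<epsilon> / (1 - \<epsilon>)" using assms by simp
  ultimately have p: "0 < flow_inf * (?X / ?Y - 1 / (1 - \<epsilon>))" by linarith
  \<comment> \<open>Positivity of the product forces k > 0, and K >= k then excludes K = 0, where
    the quotient would default to 0.\<close>
  then have "0 < flow_inf" and X: "1 / (1 - \<epsilon>) < ?X / ?Y"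
    using k by (auto simp: zero_less_mult_iff)
  then have K0: "0 < iso_sup \<pi> q" using K by linarith
  have "0 < ?Y" using K0 assms by simp
  with X have "1 / (1 - \<epsilon>) * ?Y < ?X" by (simp only: pos_less_divide_eq)
  then have "iso_sup \<pi> q < ?X" using assms by simp
  also have "?X \<le> 2 * (1 - \<delta>)"
  proof -
    have "(2 - \<epsilon>) * (1 - \<epsilon>\<^sub>1) * (1 - \<epsilon>\<^sub>2) \<le> 2 * 1 * 1" using assms by (intro mult_mono) auto
    then show ?thesis using assms by (intro mult_right_mono) auto
  qed
  finally have "2 * \<delta> \<le> 2 - iso_sup \<pi> q" by simp
  then have "flow_inf\<^sup>2 * (2 * \<delta>) \<le> flow_inf\<^sup>2 * (2 - iso_sup \<pi> q)" by (intro mult_left_mono) auto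
  then have "2 * (flow_inf\<^sup>2 * \<delta>) \<le> flow_inf\<^sup>2 * (2 - iso_sup \<pi> q)" by (simp add: mult_ac)
  moreover have "0 \<le> flow_inf\<^sup>2 * \<delta>" using assms by simp
  moreover have "?a = flow_inf\<^sup>2 * \<delta> / 16" by simp
  \<comment> \<open>With 2 \<delta> <= 2 - K, the lower bound on k_2 is at least k^2 \<delta> / 9,
    which exceeds the required k^2 \<delta> / 16.\<close>
  ultimately have "?a \<le> two.flow_inf" using two_step_flow_inf_ge by linarith
  then show ?thesis by linarith
qed

end

theorem theorem2:
  fixes M \<pi> :: "'a measure"
    and p :: "'a \<Rightarrow> 'a measure"
    and k K k2 \<kappa> :: real
  assumes kernel: "p \<in> M \<rightarrow>\<^sub>M prob_algebra M"
    and unique_stationary: "stationary_distributions M p = {\<pi>}"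
    and reversible: "reversible \<pi> p"
    and nontrivial: "\<exists>A \<in> sets M. 0 < measure \<pi> A \<and> measure \<pi> A < 1"
  defines "k \<equiv> iso_inf \<pi> p 1"
    and "K \<equiv> iso_sup \<pi> p"
    and "k2 \<equiv> iso_inf \<pi> p 2"
    and "\<kappa> \<equiv> lawler_sokal_const"
  shows "(has_L2_gap \<pi> p \<longleftrightarrow> 0 < k \<and> k \<le> K \<and> K < 2)
       \<and> (0 < k \<and> k \<le> K \<and> K < 2 \<longleftrightarrow> k2 > 0)
       \<and> L20_spectrum \<pi> (markov_op p) \<subseteq>
           complex_of_real ` {- sqrt (1 - \<kappa> / 8 * k2\<^sup>2) ..
                              min (sqrt (1 - \<kappa> / 8 * k2\<^sup>2)) (1 - \<kappa> / 8 * k\<^sup>2)}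
       \<and> k2 \<ge> (SUP (\<delta>, \<epsilon>\<^sub>1, \<epsilon>\<^sub>2, \<epsilon>) \<in> proportion_params.
                  Min {k\<^sup>2 / 16 * \<delta>,
                       k / 4 * (\<epsilon>\<^sub>1 * \<epsilon>\<^sub>2 * (1 - \<delta>) - \<delta>),
                       (k * ((2 - \<epsilon>) * (1 - \<epsilon>\<^sub>1) * (1 - \<epsilon>\<^sub>2) * (1 - \<delta>) / ((1 - \<epsilon>) * K)
                             - 1 / (1 - \<epsilon>)) - \<epsilon> / (1 - \<epsilon>)) * \<epsilon>})"
proof -
  have "\<pi> \<in> stationary_distributions M p" using unique_stationary by simp
  then have prob: "prob_space \<pi>" and sets[measurable_cong]: "sets \<pi> = sets M" and stat: "\<pi> \<bind> p = \<pi>"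
    by (auto simp: stationary_distributions_def space_prob_algebra)
  interpret prob_space \<pi> by fact
  \<comment> \<open>The kernel is given over M, whereas the locale works over \<open>\<pi>\<close>;
    equal sigma-algebras make the two spaces of probability measures coincide.\<close>
  have prob_alg: "prob_algebra M = prob_algebra \<pi>"
    unfolding prob_algebra_def using subprob_algebra_cong[OF sets] by simp
  have kernel': "p \<in> \<pi> \<rightarrow>\<^sub>M prob_algebra \<pi>"
    using kernel unfolding prob_alg by (simp cong: measurable_cong_sets add: measurable_cong_sets[OF sets refl])
  interpret reversible_kernel \<pi> p
  proof
    show "nontrivial_events \<pi> \<noteq> {}" using nontrivial by (auto simp: nontrivial_events_def sets)
  qed (fact kernel' stat reversible)+
  have k: "k = flow_inf" and k2: "k2 = two.flow_inf"
    unfolding k_def k2_def by (rule iso_inf_one, rule iso_inf_two)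
  have kK: "k \<le> K" unfolding k K_def by (rule flow_inf_le_iso_sup)
  have "has_L2_gap \<pi> p \<longleftrightarrow> 0 < k \<and> k \<le> K \<and> K < 2" "0 < k \<and> k \<le> K \<and> K < 2 \<longleftrightarrow> k2 > 0"
    using gap_imp_flow_bounds two_step_flow_imp_gap two_step_flow_pos kK unfolding k k2 K_def by blast+
  moreover have "L20_spectrum \<pi> (markov_op p) \<subseteq>
           complex_of_real ` {- sqrt (1 - \<kappa> / 8 * k2\<^sup>2) ..
                              min (sqrt (1 - \<kappa> / 8 * k2\<^sup>2)) (1 - \<kappa> / 8 * k\<^sup>2)}"
    unfolding k k2 \<kappa>_def by (rule spectrum_inclusion)
  moreover have "(SUP (\<delta>, \<epsilon>\<^sub>1, \<epsilon>\<^sub>2, \<epsilon>) \<in> proportion_params.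
                  Min {k\<^sup>2 / 16 * \<delta>,
                       k / 4 * (\<epsilon>\<^sub>1 * \<epsilon>\<^sub>2 * (1 - \<delta>) - \<delta>),
                       (k * ((2 - \<epsilon>) * (1 - \<epsilon>\<^sub>1) * (1 - \<epsilon>\<^sub>2) * (1 - \<delta>) / ((1 - \<epsilon>) * K)
                             - 1 / (1 - \<epsilon>)) - \<epsilon> / (1 - \<epsilon>)) * \<epsilon>}) \<le> k2"
  proof (rule cSUP_least)
    have "(1 / 2, 1 / 2, 1 / 2, 1 / 2) \<in> proportion_params" by (simp add: proportion_params_def)
    then show "proportion_params \<noteq> {}" by blast
  next
    fix x assume x: "x \<in> proportion_params"
    obtain \<delta> \<epsilon>\<^sub>1 \<epsilon>\<^sub>2 \<epsilon> where xx: "x = (\<delta>, \<epsilon>\<^sub>1, \<epsilon>\<^sub>2, \<epsilon>)" by (cases x) auto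
    have "Min {a, b, c} \<le> min a c" for a b c :: real by simp
    also note two_step_parameter_bound[of \<delta> \<epsilon>\<^sub>1 \<epsilon>\<^sub>2 \<epsilon>]
    finally show "(case x of (\<delta>, \<epsilon>\<^sub>1, \<epsilon>\<^sub>2, \<epsilon>) \<Rightarrow>
       Min {k\<^sup>2 / 16 * \<delta>, k / 4 * (\<epsilon>\<^sub>1 * \<epsilon>\<^sub>2 * (1 - \<delta>) - \<delta>),
         (k * ((2 - \<epsilon>) * (1 - \<epsilon>\<^sub>1) * (1 - \<epsilon>\<^sub>2) * (1 - \<delta>) / ((1 - \<epsilon>) * K) - 1 / (1 - \<epsilon>)) - \<epsilon> / (1 - \<epsilon>)) * \<epsilon>}) \<le> k2"
      using x unfolding xx k k2 K_def prod.case proportion_params_def by simp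
  qed
  ultimately show ?thesis by blast
qed

end
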